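(* Let $\mathcal{H}$ be a complex Hilbert space and let $S$ be a positive, densely defined, closed operator in $\mathcal{H}$. Let $T=(I-S)(I+S)^{-1}\colon \operatorname{Ran}(I+S)\to\mathcal{H}$ be its Cayley transform, let $\mathcal{S}$ be the set of all positive selfadjoint extensions of $S$ on $\mathcal{H}$, and let $A$, $\Gamma_2$, $\mathcal{C}(T)$, $\widetilde T(\Gamma)$ be as defined in the context. For $\Gamma\in\mathcal{C}(T)$ put $$\widetilde S(\Gamma)=(I-\widetilde T(\Gamma))(I+\widetilde T(\Gamma))^{-1},\qquad \operatorname{Dom}(\widetilde S(\Gamma))=\operatorname{Ran}(I+\widetilde T(\Gamma)).$$ Then $\Gamma\mapsto\widetilde S(\Gamma)$ is a well-defined bijective mapping $\mathcal{C}(T)\to\mathcal{S}$. It is sequentially continuous with respect to the operator norm on $\mathcal{C}(T)$ and strong resolvent convergence on $\mathcal{S}$, and it is non-increasing in the sense that, for any $\Gamma',\Gamma''\in\mathcal{C}(T)$, $$\Gamma'\leq\Gamma''\quad\text{if and only if}\quad \widetilde S(\Gamma')\geq\widetilde S(\Gamma'').$$ Moreover, the two positive selfadjoint extensions $\widetilde S_{\mathrm K}=\widetilde S(I)$ and $\widetilde S_{\mathrm F}=\widetilde S(-I)$ of $S$ satisfy $\widetilde S_{\mathrm K}\leq\widetilde S_{\mathrm F}$, and a positive selfadjoint operator $R$ on $\mathcal{H}$ belongs to $\mathcal{S}$ if and only if $\widetilde S_{\mathrm K}\leq R\leq\widetilde S_{\mathrm F}$.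
   Context: Operators are linear and possibly unbounded. A densely defined operator $S$ in $\mathcal{H}$ is positive if it is symmetric and $\langle Sh,h\rangle\geq 0$ for all $h\in\operatorname{Dom}(S)$. For $S$ positive, closed and densely defined, $I+S$ is one-to-one, $\operatorname{Ran}(I+S)$ is a closed subspace of $\mathcal{H}$, and the Cayley transform $T=(I-S)(I+S)^{-1}$, with $\operatorname{Dom}(T)=\operatorname{Ran}(I+S)$, is a symmetric contraction: $\|Tx\|\le\|x\|$ and $\langle Tx,y\rangle=\langle x,Ty\rangle$ for all $x,y\in\operatorname{Dom}(T)$. For a contraction $C\colon\mathcal{H}_1\to\mathcal{H}_2$ between Hilbert spaces, $D_C=(I-C^*C)^{1/2}$ is its defect operator on $\mathcal{H}_1$ and $\mathcal{D}_C=\overline{D_C\mathcal{H}_1}$ its defect space. With respect to $\mathcal{H}=\operatorname{Dom}(T)\oplus(\mathcal{H}\ominus\operatorname{Dom}(T))$ one writes uniquely $T=\begin{bmatrix}A\\ \Gamma_2D_A\end{bmatrix}$, where $A\colon\operatorname{Dom}(T)\to\operatorname{Dom}(T)$ is the selfadjoint contraction given by the compression of $T$ to $\operatorname{Dom}(T)$, and $\Gamma_2\colon\mathcal{D}_A\to\mathcal{H}\ominus\operatorname{Dom}(T)$ is a contraction. Thus $\Gamma_2^*\colon\mathcal{H}\ominus\operatorname{Dom}(T)\to\mathcal{D}_A$ and $\mathcal{D}_{\Gamma_2^*}\subseteq\mathcal{H}\ominus\operatorname{Dom}(T)$. $\mathcal{C}(T)$ is the set of all bounded selfadjoint contractions $\Gamma\colon\mathcal{D}_{\Gamma_2^*}\to\mathcal{D}_{\Gamma_2^*}$,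 with the usual order of bounded selfadjoint operators. For $\Gamma\in\mathcal{C}(T)$, $$\widetilde T(\Gamma)=\begin{bmatrix}A & D_A\Gamma_2^*\\ \Gamma_2D_A & -\Gamma_2A\Gamma_2^*+D_{\Gamma_2^*}\Gamma D_{\Gamma_2^*}\end{bmatrix}$$ with respect to the decomposition $\mathcal{H}=\operatorname{Dom}(T)\oplus(\mathcal{H}\ominus\operatorname{Dom}(T))$. Order on positive selfadjoint operators: $R_1\leq R_2$ means $\operatorname{Dom}(R_2^{1/2})\subseteq\operatorname{Dom}(R_1^{1/2})$ and $\|R_1^{1/2}\xi\|\leq\|R_2^{1/2}\xi\|$ for all $\xi\in\operatorname{Dom}(R_2^{1/2})$. Strong resolvent convergence: selfadjoint operators $R_n$ converge to a selfadjoint operator $R$ in the strong resolvent sense if for every $\lambda\in\mathbb{C}\setminus\mathbb{R}$ and every $\xi\in\mathcal{H}$, $(\lambda I-R_n)^{-1}\xi\to(\lambda I-R)^{-1}\xi$ as $n\to\infty$. *)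

theory Defs
  imports "HOL-Analysis.Analysis"
begin

section \<open>Complex Hilbert spaces\<close>

text \<open>The inner product is linear in its first argument. The real inner product of the
  underlying \<^class>\<open>real_inner\<close> structure is its real part, so that norm and topology are those
  induced by the complex inner product.\<close>

class chilbert_space = real_inner + complete_space +
  fixes scaleC :: "complex \<Rightarrow> 'a \<Rightarrow> 'a" (infixr \<open>*\<^sub>C\<close> 75)
    and cinner :: "'a \<Rightarrow> 'a \<Rightarrow> complex"
  assumes scaleC_add_right: "a *\<^sub>C (x + y) = a *\<^sub>C x + a *\<^sub>C y"
    and scaleC_add_left: "(a + b) *\<^sub>C x = a *\<^sub>C x + b *\<^sub>C x"
    and scaleC_scaleC: "a *\<^sub>C (b *\<^sub>C x) = (a * b) *\<^sub>C x"
    and scaleC_complex_of_real: "complex_of_real r *\<^sub>C x = r *\<^sub>R x"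
    and cinner_add_left: "cinner (x + y) z = cinner x z + cinner y z"
    and cinner_scaleC_left: "cinner (a *\<^sub>C x) y = a * cinner x y"
    and cinner_commute: "cinner x y = cnj (cinner y x)"
    and inner_eq_Re_cinner: "inner x y = Re (cinner x y)"

instantiation complex :: chilbert_space
begin

definition scaleC_complex :: "complex \<Rightarrow> complex \<Rightarrow> complex" where
  "scaleC_complex a x = a * x"

definition cinner_complex :: "complex \<Rightarrow> complex \<Rightarrow> complex" where
  "cinner_complex x y = x * cnj y"

instance
  by standard (simp_all add: scaleC_complex_def cinner_complex_def algebra_simps
      scaleR_conv_of_real inner_complex_def)

end

definition orth :: "'a::chilbert_space set \<Rightarrow> 'a set" where
  "orth M = {x. \<forall>y\<in>M. cinner x y = 0}"


section \<open>Possibly unbounded operators\<close>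

text \<open>An operator with domain and range inside the Hilbert space is identified with its graph.
  Thus domain, range and inverse are \<^const>\<open>Domain\<close>, \<^const>\<open>Range\<close> and \<^const>\<open>converse\<close>,
  extension of operators is inclusion, \<^term>\<open>Id_on M\<close> is the identity of \<^term>\<open>M\<close>, and an
  operator is closed iff it is a closed subset of the product space. Operators between closed
  subspaces are treated likewise; the Hilbert spaces between which they act are passed as
  parameters wherever they matter.\<close>

definition linear_op :: "'a::chilbert_space rel \<Rightarrow> bool" where
  "linear_op G \<longleftrightarrow> single_valued G \<and> (0, 0) \<in> G \<and>
     (\<forall>x y x' y'. (x, y) \<in> G \<longrightarrow> (x', y') \<in> G \<longrightarrow> (x + x', y + y') \<in> G) \<and>
     (\<forall>c x y. (x, y) \<in> G \<longrightarrow> (c *\<^sub>C x, c *\<^sub>C y) \<in> G)"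

definition ap :: "'a::chilbert_space rel \<Rightarrow> 'a \<Rightarrow> 'a" where
  "ap G x = (THE y. (x, y) \<in> G)"

definition op_add :: "'a::chilbert_space rel \<Rightarrow> 'a rel \<Rightarrow> 'a rel" (infixl \<open>+\<^sub>o\<close> 65) where
  "F +\<^sub>o G = {(x, y + z) |x y z. (x, y) \<in> F \<and> (x, z) \<in> G}"

definition op_diff :: "'a::chilbert_space rel \<Rightarrow> 'a rel \<Rightarrow> 'a rel" (infixl \<open>-\<^sub>o\<close> 65) where
  "F -\<^sub>o G = {(x, y - z) |x y z. (x, y) \<in> F \<and> (x, z) \<in> G}"

definition op_scale :: "complex \<Rightarrow> 'a::chilbert_space rel \<Rightarrow> 'a rel" (infixr \<open>\<cdot>\<^sub>o\<close> 72) where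
  "c \<cdot>\<^sub>o G = {(x, c *\<^sub>C y) |x y. (x, y) \<in> G}"

text \<open>Composition in the usual order of operator products (right factor applied first),
  opposite to that of relation composition.\<close>

abbreviation op_comp :: "'a::chilbert_space rel \<Rightarrow> 'a rel \<Rightarrow> 'a rel" (infixr \<open>\<circ>\<^sub>o\<close> 75) where
  "G \<circ>\<^sub>o F \<equiv> F O G"

text \<open>The operator with block matrix \<open>(X\<^sub>1\<^sub>1 X\<^sub>1\<^sub>2; X\<^sub>2\<^sub>1 X\<^sub>2\<^sub>2)\<close> with respect to a decomposition
  \<open>M \<oplus> orth M\<close>; the entries of the first column have domain \<open>M\<close>, those of the second \<open>orth M\<close>.\<close>

definition block_op ::
  "'a::chilbert_space rel \<Rightarrow> 'a rel \<Rightarrow> 'a rel \<Rightarrow> 'a rel \<Rightarrow> 'a rel" where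
  "block_op X11 X12 X21 X22 =
     {(h + k, (a + b) + (c + d)) |h k a b c d.
        (h, a) \<in> X11 \<and> (k, b) \<in> X12 \<and> (h, c) \<in> X21 \<and> (k, d) \<in> X22}"

text \<open>Adjoint \<open>H\<^sub>2 \<rightarrow> H\<^sub>1\<close> of an operator \<open>H\<^sub>1 \<rightarrow> H\<^sub>2\<close> with domain dense in \<open>H\<^sub>1\<close>.\<close>

definition adj :: "'a::chilbert_space set \<Rightarrow> 'a set \<Rightarrow> 'a rel \<Rightarrow> 'a rel" where
  "adj H1 H2 G =
     {(y, z). y \<in> H2 \<and> z \<in> H1 \<and> (\<forall>x w. (x, w) \<in> G \<longrightarrow> cinner w y = cinner x z)}"

definition densely_defined :: "'a::chilbert_space set \<Rightarrow> 'a rel \<Rightarrow> bool" where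
  "densely_defined M G \<longleftrightarrow> linear_op G \<and> G \<subseteq> M \<times> M \<and> M \<subseteq> closure (Domain G)"

definition symmetric_op :: "'a::chilbert_space rel \<Rightarrow> bool" where
  "symmetric_op G \<longleftrightarrow>
     (\<forall>x y x' y'. (x, y) \<in> G \<longrightarrow> (x', y') \<in> G \<longrightarrow> cinner y x' = cinner x y')"

text \<open>For a symmetric operator the numbers \<open>\<langle>G x, x\<rangle>\<close> are real, hence the real parts below
  and in \<open>sa_le\<close>.\<close>

definition positive_op :: "'a::chilbert_space set \<Rightarrow> 'a rel \<Rightarrow> bool" where
  "positive_op M G \<longleftrightarrow> densely_defined M G \<and> symmetric_op G \<and>
     (\<forall>x y. (x, y) \<in> G \<longrightarrow> 0 \<le> Re (cinner y x))"

definition selfadjoint :: "'a::chilbert_space set \<Rightarrow> 'a rel \<Rightarrow> bool" where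
  "selfadjoint M G \<longleftrightarrow> densely_defined M G \<and> adj M M G = G"

definition positive_selfadjoint :: "'a::chilbert_space set \<Rightarrow> 'a rel \<Rightarrow> bool" where
  "positive_selfadjoint M G \<longleftrightarrow> positive_op M G \<and> selfadjoint M G"

text \<open>The positive selfadjoint square root \<open>R\<^sup>1\<^sup>/\<^sup>2\<close> in the Hilbert space \<open>M\<close>.\<close>

definition op_sqrt :: "'a::chilbert_space set \<Rightarrow> 'a rel \<Rightarrow> 'a rel" where
  "op_sqrt M R = (THE Q. positive_selfadjoint M Q \<and> Q \<circ>\<^sub>o Q = R)"

definition contraction :: "'a::chilbert_space set \<Rightarrow> 'a set \<Rightarrow> 'a rel \<Rightarrow> bool" where
  "contraction H1 H2 C \<longleftrightarrow> linear_op C \<and> Domain C = H1 \<and> Range C \<subseteq> H2 \<and>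
     (\<forall>x y. (x, y) \<in> C \<longrightarrow> norm y \<le> norm x)"

definition defect_op :: "'a::chilbert_space set \<Rightarrow> 'a set \<Rightarrow> 'a rel \<Rightarrow> 'a rel" where
  "defect_op H1 H2 C = op_sqrt H1 (Id_on H1 -\<^sub>o adj H1 H2 C \<circ>\<^sub>o C)"

definition defect_space :: "'a::chilbert_space set \<Rightarrow> 'a set \<Rightarrow> 'a rel \<Rightarrow> 'a set" where
  "defect_space H1 H2 C = closure (Range (defect_op H1 H2 C))"

definition op_norm :: "'a::chilbert_space rel \<Rightarrow> real" where
  "op_norm G = Sup {norm y |x y. (x, y) \<in> G \<and> norm x \<le> 1}"

text \<open>The usual order of bounded selfadjoint operators on a common domain.\<close>

definition sa_le :: "'a::chilbert_space rel \<Rightarrow> 'a rel \<Rightarrow> bool" where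
  "sa_le F G \<longleftrightarrow>
     (\<forall>x y z. (x, y) \<in> F \<longrightarrow> (x, z) \<in> G \<longrightarrow> Re (cinner y x) \<le> Re (cinner z x))"

text \<open>The order of positive selfadjoint, possibly unbounded, operators on the whole space.\<close>

definition form_le :: "'a::chilbert_space rel \<Rightarrow> 'a rel \<Rightarrow> bool" where
  "form_le R1 R2 \<longleftrightarrow>
     Domain (op_sqrt UNIV R2) \<subseteq> Domain (op_sqrt UNIV R1) \<and>
     (\<forall>\<xi>\<in>Domain (op_sqrt UNIV R2).
        norm (ap (op_sqrt UNIV R1) \<xi>) \<le> norm (ap (op_sqrt UNIV R2) \<xi>))"

definition resolvent :: "'a::chilbert_space rel \<Rightarrow> complex \<Rightarrow> 'a rel" where
  "resolvent R z = (z \<cdot>\<^sub>o Id -\<^sub>o R)\<inverse>"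

definition strong_resolvent_conv ::
  "(nat \<Rightarrow> 'a::chilbert_space rel) \<Rightarrow> 'a rel \<Rightarrow> bool" where
  "strong_resolvent_conv Rs R \<longleftrightarrow>
     (\<forall>z \<xi>. z \<notin> \<real> \<longrightarrow>
        (\<lambda>n. ap (resolvent (Rs n) z) \<xi>) \<longlonglongrightarrow> ap (resolvent R z) \<xi>)"


section \<open>Positive selfadjoint extensions\<close>

definition cayley :: "'a::chilbert_space rel \<Rightarrow> 'a rel" where
  "cayley S = (Id -\<^sub>o S) \<circ>\<^sub>o (Id +\<^sub>o S)\<inverse>"

definition pos_sa_extensions :: "'a::chilbert_space rel \<Rightarrow> 'a rel set" where
  "pos_sa_extensions S = {R. positive_selfadjoint UNIV R \<and> S \<subseteq> R}"

text \<open>In the following \<open>T\<close> is a symmetric contraction with closed domain.\<close>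

definition compr :: "'a::chilbert_space rel \<Rightarrow> 'a rel" where
  "compr T = {(x, a). a \<in> Domain T \<and> (\<exists>b\<in>orth (Domain T). (x, a + b) \<in> T)}"

abbreviation D_A :: "'a::chilbert_space rel \<Rightarrow> 'a rel" where
  "D_A T \<equiv> defect_op (Domain T) (Domain T) (compr T)"

abbreviation D_A_space :: "'a::chilbert_space rel \<Rightarrow> 'a set" where
  "D_A_space T \<equiv> defect_space (Domain T) (Domain T) (compr T)"

text \<open>The column decomposition of \<open>T\<close> into \<open>A\<close> and \<open>\<Gamma>\<^sub>2 D\<^sub>A\<close>, whose ranges are orthogonal,
  is the sum of the two operators.\<close>

definition Gamma2 :: "'a::chilbert_space rel \<Rightarrow> 'a rel" where
  "Gamma2 T = (THE G. contraction (D_A_space T) (orth (Domain T)) G \<and>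
                      T = compr T +\<^sub>o G \<circ>\<^sub>o D_A T)"

definition Gamma2_adj :: "'a::chilbert_space rel \<Rightarrow> 'a rel" where
  "Gamma2_adj T = adj (D_A_space T) (orth (Domain T)) (Gamma2 T)"

abbreviation D_Gamma2_adj :: "'a::chilbert_space rel \<Rightarrow> 'a rel" where
  "D_Gamma2_adj T \<equiv> defect_op (orth (Domain T)) (D_A_space T) (Gamma2_adj T)"

abbreviation D_Gamma2_adj_space :: "'a::chilbert_space rel \<Rightarrow> 'a set" where
  "D_Gamma2_adj_space T \<equiv> defect_space (orth (Domain T)) (D_A_space T) (Gamma2_adj T)"

definition sa_contractions :: "'a::chilbert_space rel \<Rightarrow> 'a rel set" where
  "sa_contractions T =
     {\<Gamma>. contraction (D_Gamma2_adj_space T) (D_Gamma2_adj_space T) \<Gamma> \<and>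
         selfadjoint (D_Gamma2_adj_space T) \<Gamma>}"

definition T_tilde :: "'a::chilbert_space rel \<Rightarrow> 'a rel \<Rightarrow> 'a rel" where
  "T_tilde T \<Gamma> = block_op
     (compr T)              (D_A T \<circ>\<^sub>o Gamma2_adj T)
     (Gamma2 T \<circ>\<^sub>o D_A T)    ((-1) \<cdot>\<^sub>o (Gamma2 T \<circ>\<^sub>o compr T \<circ>\<^sub>o Gamma2_adj T)
                               +\<^sub>o D_Gamma2_adj T \<circ>\<^sub>o \<Gamma> \<circ>\<^sub>o D_Gamma2_adj T)"

definition S_tilde :: "'a::chilbert_space rel \<Rightarrow> 'a rel \<Rightarrow> 'a rel" where
  "S_tilde S \<Gamma> = (Id -\<^sub>o T_tilde (cayley S) \<Gamma>) \<circ>\<^sub>o (Id +\<^sub>o T_tilde (cayley S) \<Gamma>)\<inverse>"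

definition S_K :: "'a::chilbert_space rel \<Rightarrow> 'a rel" where
  "S_K S = S_tilde S (Id_on (D_Gamma2_adj_space (cayley S)))"

definition S_F :: "'a::chilbert_space rel \<Rightarrow> 'a rel" where
  "S_F S = S_tilde S ((-1) \<cdot>\<^sub>o Id_on (D_Gamma2_adj_space (cayley S)))"

end

theory Submission
  imports Defs
begin

text \<open>Cayley transformation identifies the positive selfadjoint extensions \<open>R\<close> of \<open>S\<close> with the
  selfadjoint contractions \<open>B\<close> extending \<open>T\<close>; here \<open>1 + B\<close> is injective because its range contains
  the dense set \<open>Dom S\<close>, and \<open>(1 + R)\<inverse> = (1 + B)/2\<close>. If \<open>s\<close> and \<open>r\<close> are the square roots of
  \<open>(1 + B)/2\<close> and \<open>(1 - B)/2\<close>, then \<open>R\<^sup>1\<^sup>/\<^sup>2\<close> has the graph \<open>{(s v, r v)}\<close>, and Douglas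
  factorization turns \<open>R\<^sub>1 \<le> R\<^sub>2\<close> into \<open>B\<^sub>2 \<le> B\<^sub>1\<close>.

  The map \<open>W (h + k) = (h, \<Gamma>\<^sub>2* k, D k)\<close>, \<open>D\<close> the defect operator of \<open>\<Gamma>\<^sub>2*\<close>, is isometric and the
  extension with parameter \<open>\<Gamma>\<close> is \<open>W* (J \<oplus> \<Gamma>) W\<close>, \<open>J\<close> the Julia operator of \<open>A\<close>; hence it is a
  contraction. Conversely, minimising the forms of \<open>1 \<plusminus> B\<close> over \<open>Dom T\<close> bounds
  \<open>B\<^sub>2\<^sub>2 + \<Gamma>\<^sub>2 A \<Gamma>\<^sub>2*\<close> by \<open>\<plusminus> D\<^sup>2\<close>, so it factors as \<open>D \<Gamma> D\<close>. Extensions differ only in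
  the block \<open>D \<Gamma> D\<close>, which gives the order statements: an operator between \<open>\<Gamma> = -1\<close> and \<open>\<Gamma> = 1\<close>
  must agree with \<open>T\<close> on \<open>Dom T\<close>.\<close>

text \<open>Two obstacles shape the proof. The notions are formulated for graphs between closed
  subspaces, and square roots and \<open>Gamma2\<close> are picked by definite description, so
  uniqueness has to be proved before any of them can be computed. Bounded operators are therefore
  carried as total functions, extended by zero through \<open>proj\<close>; compositions, adjoints
  and roots are computed there and translated back with \<open>graph_on\<close>. The other obstacle
  is the unbounded square root, for which no functional calculus is set up. Roots of bounded
  operators come from an iteration. An unbounded operator is handled only through a parametrization
  of its graph, by \<open>(v + B v, v - B v)\<close> for R and by \<open>(s v, r v)\<close> for its
  root, where s and r commute and their squares add up to 1. Inverses never have to be formed: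
  questions on domains, adjoints and resolvents become equations for bounded operators in the
  parameter \<open>v\<close>. The resolvent at \<open>z\<close>, for instance, sends
  \<open>z *\<^sub>C (v + B v) - (v - B v)\<close> to \<open>v + B v\<close>, and so its convergence
  follows from pointwise convergence of the operators \<open>B\<close>.\<close>

section \<open>Algebra and continuity of the complex inner product\<close>

lemma cinner_add_right: "cinner x (y + z) = cinner x y + cinner x z"
  by (metis cinner_add_left cinner_commute complex_cnj_add)

lemma cinner_scaleC_right: "cinner x (a *\<^sub>C y) = cnj a * cinner x y"
  by (metis cinner_commute cinner_scaleC_left complex_cnj_mult)

lemma scaleC_zero_left [simp]: "0 *\<^sub>C (x::'a::chilbert_space) = 0"
  using scaleC_complex_of_real[of 0 x] by simp

lemma scaleC_zero_right [simp]: "c *\<^sub>C (0::'a::chilbert_space) = 0"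
  using scaleC_add_right[of c 0 0] by simp

lemma scaleC_minus_one: "(- 1) *\<^sub>C (x::'a::chilbert_space) = - x"
  using scaleC_complex_of_real[of "-1" x] by simp

lemma scaleC_minus_right: "c *\<^sub>C (- x) = - (c *\<^sub>C (x::'a::chilbert_space))"
  by (metis add.right_inverse minus_unique scaleC_add_right scaleC_zero_right)

lemma scaleC_diff_right: "c *\<^sub>C (x - y) = c *\<^sub>C x - c *\<^sub>C (y::'a::chilbert_space)"
  using scaleC_add_right[of c x "- y"] by (simp add: scaleC_minus_right)

lemma cinner_zero_left [simp]: "cinner 0 x = 0"
  using cinner_add_left[of 0 0 x] by simp

lemma cinner_zero_right [simp]: "cinner x 0 = 0"
  using cinner_add_right[of x 0 0] by simp

lemma cinner_minus_left: "cinner (- x) y = - cinner x y"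
  by (metis add.right_inverse cinner_add_left cinner_zero_left minus_unique)

lemma cinner_minus_right: "cinner x (- y) = - cinner x y"
  by (metis add.right_inverse cinner_add_right cinner_zero_right minus_unique)

lemma cinner_diff_left: "cinner (x - y) z = cinner x z - cinner y z"
  using cinner_add_left[of x "- y" z] by (simp add: cinner_minus_left)

lemma cinner_diff_right: "cinner z (x - y) = cinner z x - cinner z y"
  using cinner_add_right[of z x "- y"] by (simp add: cinner_minus_right)

lemma cinner_scaleR_left: "cinner (r *\<^sub>R x) y = of_real r * cinner x y"
  by (metis cinner_scaleC_left scaleC_complex_of_real)

lemma cinner_scaleR_right: "cinner x (r *\<^sub>R y) = of_real r * cinner x y"
  by (metis cinner_scaleC_right complex_cnj_complex_of_real scaleC_complex_of_real)

lemmas cinner_simps = cinner_add_left cinner_add_right cinner_diff_left cinner_diff_right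
  cinner_minus_left cinner_minus_right cinner_scaleR_left cinner_scaleR_right
  cinner_scaleC_left cinner_scaleC_right

lemma cinner_self: "cinner x x = of_real ((norm x)\<^sup>2)"
proof -
  have "Im (cinner x x) = 0"
    using cinner_commute[of x x] by (metis cnj.simps(2) equal_neg_zero)
  moreover have "Re (cinner x x) = (norm x)\<^sup>2"
    by (metis inner_eq_Re_cinner power2_norm_eq_inner)
  ultimately show ?thesis by (simp add: complex_eq_iff)
qed

lemma Re_cinner_self [simp]: "Re (cinner x x) = (norm x)\<^sup>2"
  by (simp add: cinner_self)

lemma Re_cinner_commute: "Re (cinner x y) = Re (cinner y x)"
  by (metis cinner_commute cnj.simps(1))

lemma cinner_eqI: "(\<And>y. cinner x y = cinner x' y) \<Longrightarrow> x = x'"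
proof -
  assume "\<And>y. cinner x y = cinner x' y"
  then have "cinner (x - x') (x - x') = 0" by (simp add: cinner_diff_left)
  then show ?thesis by (simp add: cinner_self)
qed

lemma norm_scaleC: "norm (c *\<^sub>C (x::'a::chilbert_space)) = norm c * norm x"
proof -
  have "of_real ((norm (c *\<^sub>C x))\<^sup>2) = (c * cnj c) * complex_of_real ((norm x)\<^sup>2)"
    by (simp only: cinner_self[symmetric] cinner_scaleC_left cinner_scaleC_right ac_simps)
  also have "\<dots> = of_real ((norm c * norm x)\<^sup>2)"
    by (simp add: complex_norm_square[symmetric] power_mult_distrib)
  finally have "(norm (c *\<^sub>C x))\<^sup>2 = (norm c * norm x)\<^sup>2"
    using of_real_eq_iff by blast
  then show ?thesis by simp
qed

text \<open>A unimodular factor \<open>?u\<close> rotates the product onto the positive real axis,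
  where it coincides with \<open>inner\<close>; the real Cauchy-Schwarz inequality then
  applies.\<close>

lemma norm_cinner_le: "norm (cinner x y) \<le> norm x * norm y"
proof (cases "cinner x y = 0")
  case False
  let ?u = "cnj (cinner x y) / of_real (norm (cinner x y))"
  have u: "norm ?u = 1" using False by (simp add: norm_divide)
  have "cinner (?u *\<^sub>C x) y = of_real (norm (cinner x y))"
    using False complex_norm_square[of "cinner x y"]
    by (simp add: cinner_scaleC_left power2_eq_square mult.commute divide_eq_eq)
  then have "norm (cinner x y) = inner (?u *\<^sub>C x) y"
    by (simp add: inner_eq_Re_cinner)
  also have "\<dots> \<le> norm (?u *\<^sub>C x) * norm y" by (rule norm_cauchy_schwarz)
  also have "\<dots> = norm x * norm y" using u by (simp only: norm_scaleC mult_1)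
  finally show ?thesis .
qed simp

lemma Re_cinner_le: "Re (cinner x y) \<le> norm x * norm y"
  using norm_cinner_le[of x y] complex_Re_le_cmod[of "cinner x y"] by linarith

lemma bounded_bilinear_cinner: "bounded_bilinear (cinner :: 'a::chilbert_space \<Rightarrow> 'a \<Rightarrow> complex)"
  by (rule bounded_bilinear.intro)
    (auto simp: cinner_simps scaleR_conv_of_real intro!: exI[of _ 1] norm_cinner_le)

lemmas tendsto_cinner = bounded_bilinear.tendsto[OF bounded_bilinear_cinner]

lemma bounded_linear_scaleC: "bounded_linear (\<lambda>x::'a::chilbert_space. c *\<^sub>C x)"
proof (rule bounded_linear_intro[of _ "norm c"])
  show "c *\<^sub>C (r *\<^sub>R x) = r *\<^sub>R c *\<^sub>C x" for r and x :: 'a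
    by (simp add: scaleC_complex_of_real[symmetric] scaleC_scaleC mult.commute)
qed (simp_all add: scaleC_add_right norm_scaleC mult.commute)

lemmas tendsto_scaleC = bounded_linear.tendsto[OF bounded_linear_scaleC]

lemma norm_add_sq: "(norm (x + y))\<^sup>2 = (norm x)\<^sup>2 + 2 * Re (cinner x y) + (norm (y::'a::chilbert_space))\<^sup>2"
  by (simp add: Re_cinner_self[symmetric] cinner_simps Re_cinner_commute[of y x] del: Re_cinner_self)

lemma norm_diff_sq: "(norm (x - y))\<^sup>2 = (norm x)\<^sup>2 - 2 * Re (cinner x y) + (norm (y::'a::chilbert_space))\<^sup>2"
  by (simp add: Re_cinner_self[symmetric] cinner_simps Re_cinner_commute[of y x] del: Re_cinner_self)

text \<open>Discriminant argument: \<open>t = r / A\<close> is the optimal choice, and for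
  \<open>A = 0\<close> the left side is unbounded in \<open>t\<close> unless \<open>r = 0\<close>.
  It yields Cauchy-Schwarz inequalities for forms that may degenerate.\<close>

lemma quadratic_nonneg_bound:
  fixes r A B :: real
  assumes "\<And>t. 2 * t * r \<le> t\<^sup>2 * A + B" "A \<ge> 0"
  shows "r\<^sup>2 \<le> A * B"
proof (cases "A = 0")
  case True
  have "r = 0"
  proof (rule ccontr)
    assume "r \<noteq> 0"
    then show False using assms(1)[of "(B + 1) / (2 * r)"] True by simp
  qed
  then show ?thesis using True by simp
next
  case False
  then have A: "A > 0" using assms(2) by simp
  have "2 * (r / A) * r \<le> (r / A)\<^sup>2 * A + B" by (rule assms(1))
  then show ?thesis using A by (simp add: divide_simps power2_eq_square) (simp add: algebra_simps)
qed

section \<open>Closed subspaces and projections\<close>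

definition csubspace :: "'a::chilbert_space set \<Rightarrow> bool" where
  "csubspace M \<longleftrightarrow> 0 \<in> M \<and> (\<forall>x\<in>M. \<forall>y\<in>M. x + y \<in> M) \<and> (\<forall>c. \<forall>x\<in>M. c *\<^sub>C x \<in> M)"

definition closed_csubspace :: "'a::chilbert_space set \<Rightarrow> bool" where
  "closed_csubspace M \<longleftrightarrow> csubspace M \<and> closed M"

lemma csubspaceD:
  assumes "csubspace M"
  shows "0 \<in> M" "x \<in> M \<Longrightarrow> y \<in> M \<Longrightarrow> x + y \<in> M" "x \<in> M \<Longrightarrow> c *\<^sub>C x \<in> M"
    "x \<in> M \<Longrightarrow> - x \<in> M" "x \<in> M \<Longrightarrow> y \<in> M \<Longrightarrow> x - y \<in> M" "x \<in> M \<Longrightarrow> r *\<^sub>R x \<in> M"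
proof -
  show 1: "0 \<in> M" "x \<in> M \<Longrightarrow> y \<in> M \<Longrightarrow> x + y \<in> M" "x \<in> M \<Longrightarrow> c *\<^sub>C x \<in> M" for x y c
    using assms by (auto simp: csubspace_def)
  show 2: "x \<in> M \<Longrightarrow> - x \<in> M" for x using 1(3)[of x "-1"] by (simp add: scaleC_minus_one)
  show "x \<in> M \<Longrightarrow> y \<in> M \<Longrightarrow> x - y \<in> M" using 1(2)[of x "- y"] 2 by simp
  show "x \<in> M \<Longrightarrow> r *\<^sub>R x \<in> M" using 1(3)[of x "of_real r"] by (simp add: scaleC_complex_of_real)
qed

lemma closed_csubspace_csubspace: "closed_csubspace M \<Longrightarrow> csubspace M" by (simp add: closed_csubspace_def)

lemma closed_csubspace_UNIV: "closed_csubspace UNIV" by (simp add: closed_csubspace_def csubspace_def)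

lemma closed_csubspace_closure:
  assumes "csubspace M" shows "closed_csubspace (closure M)"
  unfolding closed_csubspace_def csubspace_def
proof (intro conjI ballI allI)
  show "0 \<in> closure M" using csubspaceD(1)[OF assms] closure_subset by blast
next
  fix x y assume "x \<in> closure M" "y \<in> closure M"
  then obtain f h where "\<And>n. f n \<in> M" "f \<longlonglongrightarrow> x" "\<And>n. h n \<in> M" "h \<longlonglongrightarrow> y"
    unfolding closure_sequential by blast
  then have "\<And>n. f n + h n \<in> M" "(\<lambda>n. f n + h n) \<longlonglongrightarrow> x + y"
    using csubspaceD(2)[OF assms] by (auto intro: tendsto_add)
  then show "x + y \<in> closure M"
    unfolding closure_sequential by (intro exI[of _ "\<lambda>n. f n + h n"]) auto
next
  fix c x assume "x \<in> closure M"
  then obtain f where "\<And>n. f n \<in> M" "f \<longlonglongrightarrow> x" unfolding closure_sequential by blast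
  then have "\<And>n. c *\<^sub>C f n \<in> M" "(\<lambda>n. c *\<^sub>C f n) \<longlonglongrightarrow> c *\<^sub>C x"
    using csubspaceD(3)[OF assms] by (auto intro: tendsto_scaleC)
  then show "c *\<^sub>C x \<in> closure M"
    unfolding closure_sequential by (intro exI[of _ "\<lambda>n. c *\<^sub>C f n"]) auto
qed simp

lemma orthD: "x \<in> orth M \<Longrightarrow> y \<in> M \<Longrightarrow> cinner x y = 0" "x \<in> orth M \<Longrightarrow> y \<in> M \<Longrightarrow> cinner y x = 0"
  unfolding orth_def by (auto, metis cinner_commute complex_cnj_zero)

lemma closed_csubspace_orth: "closed_csubspace (orth M)"
  unfolding closed_csubspace_def
proof
  show "csubspace (orth M)" by (simp add: csubspace_def orth_def cinner_simps)
  show "closed (orth M)" unfolding closed_sequential_limits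
  proof (intro allI impI, elim conjE)
    fix f l assume f: "\<forall>n. f n \<in> orth M" and l: "f \<longlonglongrightarrow> l"
    have "cinner l y = 0" if "y \<in> M" for y
    proof -
      have "(\<lambda>n. cinner (f n) y) \<longlonglongrightarrow> cinner l y" by (intro tendsto_cinner l tendsto_const)
      moreover have "(\<lambda>n. cinner (f n) y) = (\<lambda>n. 0)" using f that by (auto simp: orth_def)
      ultimately show ?thesis by (simp add: LIMSEQ_const_iff)
    qed
    then show "l \<in> orth M" by (simp add: orth_def)
  qed
qed

text \<open>A sequence minimising the distance to \<open>x\<close> is Cauchy by the parallelogram
  law, and the first variation of the distance vanishes at its limit.\<close>

lemma projection_exists:
  assumes M: "closed_csubspace M"
  shows "\<exists>p\<in>M. x - p \<in> orth (M :: 'a::chilbert_space set)"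
proof -
  have L: "csubspace M" and cl: "closed M" using M by (auto simp: closed_csubspace_def)
  have ne: "M \<noteq> {}" using csubspaceD(1)[OF L] by auto
  define d where "d = infdist x M"
  have d0: "d \<ge> 0" unfolding d_def by (rule infdist_nonneg)
  have low: "d\<^sup>2 \<le> (norm (x - m))\<^sup>2" if "m \<in> M" for m
    using infdist_le[OF that, of x] d0 unfolding d_def by (intro power_mono) (auto simp: dist_norm)
  have "\<exists>m\<in>M. (norm (x - m))\<^sup>2 < d\<^sup>2 + inverse (Suc n)" for n
  proof -
    have "d < sqrt (d\<^sup>2 + inverse (Suc n))" by (rule real_less_rsqrt) simp
    then obtain m where "m \<in> M" "dist x m < sqrt (d\<^sup>2 + inverse (Suc n))"
      using ne cInf_lessD[of "dist x ` M" "sqrt (d\<^sup>2 + inverse (Suc n))"]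
      unfolding d_def infdist_def by auto
    then have "(norm (x - m))\<^sup>2 < (sqrt (d\<^sup>2 + inverse (Suc n)))\<^sup>2"
      by (intro power_strict_mono) (auto simp: dist_norm)
    moreover have "d\<^sup>2 + inverse (Suc n) \<ge> 0" by simp
    ultimately show ?thesis using \<open>m \<in> M\<close> by (intro bexI[of _ m]) (auto simp del: of_nat_Suc)
  qed
  then obtain m where mM: "\<And>n. m n \<in> M"
    and m: "\<And>n. (norm (x - m n))\<^sup>2 < d\<^sup>2 + inverse (Suc n)" by metis
  have est: "(norm (m k - m n))\<^sup>2 < 2 * inverse (Suc k) + 2 * inverse (Suc n)" for k n
  proof -
    \<comment> \<open>The midpoint of two members lies in \<open>M\<close>, so it is no closer to
      \<open>x\<close> than \<open>d\<close>.\<close>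
    have mid: "(1/2) *\<^sub>R (m k + m n) \<in> M" by (intro csubspaceD(6)[OF L] csubspaceD(2)[OF L] mM)
    have "x - m n + (x - m k) = 2 *\<^sub>R (x - (1/2) *\<^sub>R (m k + m n))"
      by (simp add: algebra_simps scaleR_2)
    then have "(norm (x - m n + (x - m k)))\<^sup>2 = 4 * (norm (x - (1/2) *\<^sub>R (m k + m n)))\<^sup>2"
      by (simp add: power_mult_distrib)
    moreover have "(norm (x - m n + (x - m k)))\<^sup>2 + (norm (x - m n - (x - m k)))\<^sup>2
        = 2 * (norm (x - m n))\<^sup>2 + 2 * (norm (x - m k))\<^sup>2"
      by (simp only: norm_add_sq[of "x - m n"] norm_diff_sq[of "x - m n"])
    moreover have "x - m n - (x - m k) = m k - m n" by simp
    ultimately show ?thesis using low[OF mid] m[of n] m[of k] by simp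
  qed
  have "Cauchy m"
  proof (rule metric_CauchyI)
    fix e :: real assume e: "e > 0"
    then obtain N where N: "inverse (real (Suc N)) < e\<^sup>2 / 4"
      using reals_Archimedean[of "e\<^sup>2 / 4"] by auto
    have "dist (m k) (m n) < e" if "k \<ge> N" "n \<ge> N" for k n
    proof -
      have "inverse (real (Suc k)) \<le> inverse (real (Suc N))" "inverse (real (Suc n)) \<le> inverse (real (Suc N))"
        using that by (auto intro!: le_imp_inverse_le)
      then have "(norm (m k - m n))\<^sup>2 < e\<^sup>2" using est[of k n] N by linarith
      then show ?thesis using e by (simp add: dist_norm power_less_imp_less_base)
    qed
    then show "\<exists>M. \<forall>k\<ge>M. \<forall>n\<ge>M. dist (m k) (m n) < e" by blast
  qed
  then obtain p where p: "m \<longlonglongrightarrow> p" using Cauchy_convergent convergent_def by blast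
  have pM: "p \<in> M" using cl mM p closed_sequentially by blast
  have "(\<lambda>n. (norm (x - m n))\<^sup>2) \<longlonglongrightarrow> (norm (x - p))\<^sup>2" by (intro tendsto_intros p)
  moreover have "(\<lambda>n. d\<^sup>2 + inverse (real (Suc n))) \<longlonglongrightarrow> d\<^sup>2"
    using LIMSEQ_inverse_real_of_nat_add by blast
  ultimately have pd: "(norm (x - p))\<^sup>2 \<le> d\<^sup>2"
    by (rule LIMSEQ_le) (use m in \<open>auto intro: less_imp_le simp del: of_nat_Suc\<close>)
  have re: "Re (cinner (x - p) y) = 0" if "y \<in> M" for y
  proof -
    have pos: "0 \<le> 2 * t * Re (cinner (x - p) y) + t\<^sup>2 * (norm y)\<^sup>2" for t
    proof -
      have "p - t *\<^sub>R y \<in> M" using pM that by (intro csubspaceD(5)[OF L] csubspaceD(6)[OF L])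
      have "x - (p - t *\<^sub>R y) = x - p + t *\<^sub>R y" by simp
      with low[OF \<open>p - t *\<^sub>R y \<in> M\<close>] pd have "(norm (x - p))\<^sup>2 \<le> (norm (x - p + t *\<^sub>R y))\<^sup>2"
        by (metis order_trans)
      then show ?thesis by (simp add: norm_add_sq cinner_simps power_mult_distrib)
    qed
    have "(- Re (cinner (x - p) y))\<^sup>2 \<le> (norm y)\<^sup>2 * 0"
    proof (rule quadratic_nonneg_bound)
      show "2 * t * - Re (cinner (x - p) y) \<le> t\<^sup>2 * (norm y)\<^sup>2 + 0" for t
        using pos[of t] by simp
    qed simp
    then show ?thesis by simp
  qed
  \<comment> \<open>The variation controls only the real part. Testing with
    \<open>\<i> *\<^sub>C y\<close>, which stays in the complex subspace, gives the imaginary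
    part.\<close>
  have "cinner (x - p) y = 0" if "y \<in> M" for y
  proof (rule complex_eqI)
    show "Re (cinner (x - p) y) = Re 0" using re[OF that] by simp
    have "Re (cinner (x - p) (\<i> *\<^sub>C y)) = 0" by (intro re csubspaceD(3)[OF L] that)
    then show "Im (cinner (x - p) y) = Im 0" by (simp add: cinner_scaleC_right)
  qed
  then show ?thesis using pM by (auto simp: orth_def)
qed

definition proj :: "'a::chilbert_space set \<Rightarrow> 'a \<Rightarrow> 'a" where
  "proj M x = (SOME p. p \<in> M \<and> x - p \<in> orth M)"

lemma proj_in: "closed_csubspace M \<Longrightarrow> proj M x \<in> M"
  and proj_orth: "closed_csubspace M \<Longrightarrow> x - proj M x \<in> orth M"
proof -
  assume "closed_csubspace M"
  then have "proj M x \<in> M \<and> x - proj M x \<in> orth M"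
    unfolding proj_def by (rule someI_ex[OF projection_exists[unfolded Bex_def]])
  then show "proj M x \<in> M" "x - proj M x \<in> orth M" by auto
qed

lemma proj_eqI:
  assumes M: "closed_csubspace M" and p: "p \<in> M" "x - p \<in> orth M"
  shows "proj M x = p"
proof -
  have "proj M x - p \<in> M" using M p proj_in by (auto intro!: csubspaceD(5)[OF closed_csubspace_csubspace[OF M]])
  moreover have "(x - p) - (x - proj M x) \<in> orth M"
    by (intro csubspaceD(5)[OF closed_csubspace_csubspace[OF closed_csubspace_orth]] p proj_orth M)
  ultimately have "cinner (proj M x - p) (proj M x - p) = 0" using orthD(1) by auto
  then show ?thesis by (simp add: cinner_self)
qed

lemma proj_id: "closed_csubspace M \<Longrightarrow> x \<in> M \<Longrightarrow> proj M x = x"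
  using csubspaceD(1)[OF closed_csubspace_csubspace[OF closed_csubspace_orth[of M]]] by (intro proj_eqI) auto

lemma proj_zero: "closed_csubspace M \<Longrightarrow> x \<in> orth M \<Longrightarrow> proj M x = 0"
  using csubspaceD(1)[OF closed_csubspace_csubspace] by (intro proj_eqI) auto

lemma orth_orth:
  assumes M: "closed_csubspace M" shows "orth (orth M) = M"
proof
  show "M \<subseteq> orth (orth M)" using orthD(2) by (force simp: orth_def[of "orth M"])
  show "orth (orth M) \<subseteq> M"
  proof
    fix x assume x: "x \<in> orth (orth M)"
    have "cinner (x - proj M x) (x - proj M x) = 0"
      using orthD(1)[OF x proj_orth[OF M, of x]] orthD(2)[OF proj_orth[OF M, of x] proj_in[OF M, of x]]
      by (simp add: cinner_diff_left[of x])
    then show "x \<in> M" using proj_in[OF M, of x] by (simp add: cinner_self)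
  qed
qed

lemma proj_orth_eq:
  assumes M: "closed_csubspace M" shows "proj (orth M) x = x - proj M x"
  by (rule proj_eqI) (auto simp: closed_csubspace_orth proj_orth orth_orth proj_in M)

lemma dense_iff_orth:
  assumes "csubspace M" "\<And>x. x \<in> orth M \<Longrightarrow> x = 0"
  shows "closure M = UNIV"
proof -
  note C = closed_csubspace_closure[OF assms(1)]
  have "x - proj (closure M) x \<in> orth M" for x
    using proj_orth[OF C, of x] closure_subset[of M] by (auto simp: orth_def)
  then have "x = proj (closure M) x" for x using assms(2) by (metis right_minus_eq)
  then show ?thesis using proj_in[OF C] by (metis UNIV_eq_I)
qed

section \<open>Everywhere defined operators\<close>

definition clinear :: "('a::chilbert_space \<Rightarrow> 'a) \<Rightarrow> bool" where
  "clinear f \<longleftrightarrow> (\<forall>x y. f (x + y) = f x + f y) \<and> (\<forall>c x. f (c *\<^sub>C x) = c *\<^sub>C f x)"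

definition contractive :: "('a::chilbert_space \<Rightarrow> 'a) \<Rightarrow> bool" where
  "contractive f \<longleftrightarrow> (\<forall>x. norm (f x) \<le> norm x)"

definition adjoint_pair :: "('a::chilbert_space \<Rightarrow> 'a) \<Rightarrow> ('a \<Rightarrow> 'a) \<Rightarrow> bool" where
  "adjoint_pair f g \<longleftrightarrow> (\<forall>x y. cinner (f x) y = cinner x (g y))"

abbreviation hermitian :: "('a::chilbert_space \<Rightarrow> 'a) \<Rightarrow> bool" where
  "hermitian f \<equiv> adjoint_pair f f"

lemma adjoint_pairD: "adjoint_pair f g \<Longrightarrow> cinner (f x) y = cinner x (g y)" by (simp add: adjoint_pair_def)

lemma adjoint_pair_sym: "adjoint_pair f g \<Longrightarrow> adjoint_pair g f"
  unfolding adjoint_pair_def by (metis cinner_commute)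

text \<open>Having an adjoint forces linearity, so \<open>hermitian\<close> carries linearity with
  it.\<close>

lemma adjoint_pair_clinear: "adjoint_pair f g \<Longrightarrow> clinear f"
  unfolding clinear_def by (intro conjI allI; rule cinner_eqI; simp add: adjoint_pair_def cinner_simps)

lemma clinearD:
  assumes "clinear f"
  shows "f (x + y) = f x + f y" "f (c *\<^sub>C x) = c *\<^sub>C f x" "f 0 = 0" "f (- x) = - f x"
    "f (x - y) = f x - f y" "f (r *\<^sub>R x) = r *\<^sub>R f x"
proof -
  show 1: "f (x + y) = f x + f y" "f (c *\<^sub>C x) = c *\<^sub>C f x" for x y c using assms by (auto simp: clinear_def)
  show "f 0 = 0" using 1(2)[of 0 0] by simp
  show 2: "f (- x) = - f x" for x using 1(2)[of "- 1" x] by (simp add: scaleC_minus_one)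
  show "f (x - y) = f x - f y" using 1(1)[of x "- y"] 2[of y] by simp
  show "f (r *\<^sub>R x) = r *\<^sub>R f x" using 1(2)[of "of_real r" x] by (simp add: scaleC_complex_of_real)
qed

lemma contractiveD: "contractive f \<Longrightarrow> norm (f x) \<le> norm x" by (simp add: contractive_def)

lemma contractive_tendsto:
  assumes "clinear f" "contractive f" "u \<longlonglongrightarrow> l" shows "(\<lambda>n. f (u n)) \<longlonglongrightarrow> f l"
proof -
  have "bounded_linear f"
    by (rule bounded_linear_intro[of _ 1]) (use assms in \<open>auto simp: clinearD contractiveD\<close>)
  then show ?thesis using assms(3) by (rule bounded_linear.tendsto)
qed

lemma hermitian_proj: "closed_csubspace M \<Longrightarrow> hermitian (proj M)"
proof -
  assume M: "closed_csubspace M"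
  have "cinner (proj M x) y = cinner (proj M x) (proj M y)"
    and "cinner x (proj M y) = cinner (proj M x) (proj M y)" for x y
    using orthD(2)[OF proj_orth[OF M, of y] proj_in[OF M, of x]]
      orthD(1)[OF proj_orth[OF M, of x] proj_in[OF M, of y]]
    by (simp_all add: cinner_simps)
  then show ?thesis by (simp add: adjoint_pair_def)
qed

lemma proj_norm_sq: "closed_csubspace M \<Longrightarrow> (norm x)\<^sup>2 = (norm (proj M x))\<^sup>2 + (norm (x - proj M x))\<^sup>2"
  using norm_add_sq[of "proj M x" "x - proj M x"] orthD(2)[OF proj_orth[of M x] proj_in[of M x]] by simp

lemma contractive_proj: "closed_csubspace M \<Longrightarrow> contractive (proj M)"
  unfolding contractive_def using proj_norm_sq by (metis le_add_same_cancel1 norm_ge_zero power2_le_imp_le zero_le_power2)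

lemma csubspace_range: "clinear f \<Longrightarrow> csubspace (range f)"
  unfolding csubspace_def by (auto, metis clinearD(3) rangeI, metis clinearD(1) rangeI, metis clinearD(2) rangeI)

lemma cinner_closure_ext:
  assumes "\<And>y. y \<in> M \<Longrightarrow> cinner u y = 0" "z \<in> closure M" shows "cinner u z = 0"
proof -
  obtain f where f: "\<And>n. f n \<in> M" "f \<longlonglongrightarrow> z" using assms(2) unfolding closure_sequential by blast
  have "(\<lambda>n. cinner u (f n)) \<longlonglongrightarrow> cinner u z" by (intro tendsto_cinner f tendsto_const)
  then show ?thesis using f assms(1) by (simp add: LIMSEQ_const_iff)
qed

section \<open>Riesz representation, adjoints and Douglas factorization\<close>

text \<open>For non-zero \<open>\<phi>\<close>, a vector \<open>u\<close> orthogonal to the kernel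
  spans the complement, since \<open>x - (\<phi> x / \<phi> u) *\<^sub>C u\<close> lies in the
  kernel. The representing vector is the multiple \<open>z\<close> of \<open>u\<close> normalised by
  \<open>\<phi> u = cinner u z\<close>.\<close>

lemma riesz:
  assumes add: "\<And>x y. \<phi> (x + y) = \<phi> x + \<phi> y" and sc: "\<And>c x. \<phi> (c *\<^sub>C x) = c * \<phi> x"
    and bd: "\<And>x. norm (\<phi> x) \<le> K * norm x"
  shows "\<exists>z::'a::chilbert_space. \<forall>x. \<phi> x = cinner x z"
proof -
  have bl: "bounded_linear \<phi>"
  proof (rule bounded_linear_intro[of _ K])
    show "\<phi> (r *\<^sub>R x) = r *\<^sub>R \<phi> x" for r x
      using sc[of "of_real r" x] by (simp add: scaleC_complex_of_real scaleR_conv_of_real)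
  qed (use add bd in \<open>auto simp: mult.commute\<close>)
  let ?N = "{x. \<phi> x = 0}"
  have "closed ?N" using bounded_linear.continuous_on[OF bl, of UNIV "\<lambda>x. x"]
    by (intro closed_Collect_eq) auto
  moreover have "csubspace ?N" using sc[of 0 0] by (auto simp: csubspace_def add sc)
  ultimately have N: "closed_csubspace ?N" by (simp add: closed_csubspace_def)
  show ?thesis
  proof (cases "\<forall>x. \<phi> x = 0")
    case True then show ?thesis by (intro exI[of _ 0]) simp
  next
    case False
    then obtain v where v: "\<phi> v \<noteq> 0" by auto
    define u where "u = v - proj ?N v"
    have u: "u \<in> orth ?N" unfolding u_def by (rule proj_orth[OF N])
    have "\<phi> u = \<phi> v" using proj_in[OF N, of v] bounded_linear.linear[OF bl]
      unfolding u_def by (simp add: linear_diff)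
    then have pu: "\<phi> u \<noteq> 0" using v by simp
    then have u0: "u \<noteq> 0" using sc[of 0 0] by auto
    define z where "z = cnj (\<phi> u / of_real ((norm u)\<^sup>2)) *\<^sub>C u"
    have "\<phi> x = cinner x z" for x
    proof -
      have "\<phi> (x - (\<phi> x / \<phi> u) *\<^sub>C u) = 0"
        using pu bounded_linear.linear[OF bl] by (simp add: linear_diff sc)
      then have "cinner (x - (\<phi> x / \<phi> u) *\<^sub>C u) u = 0" using orthD(2)[OF u] by simp
      then have "cinner x u = (\<phi> x / \<phi> u) * of_real ((norm u)\<^sup>2)"
        by (simp add: cinner_simps cinner_self)
      then show ?thesis unfolding z_def using pu u0 by (simp add: cinner_simps)
    qed
    then show ?thesis by blast
  qed
qed

lemma adjoint_exists:
  assumes "clinear f" "contractive f"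
  shows "\<exists>g. adjoint_pair f g \<and> contractive g"
proof -
  have "\<exists>z. \<forall>x. cinner (f x) y = cinner x z" for y
  proof (rule riesz)
    show "norm (cinner (f x) y) \<le> norm y * norm x" for x
      using norm_cinner_le[of "f x" y] mult_right_mono[OF contractiveD[OF assms(2), of x] norm_ge_zero[of y]]
      by (simp add: mult.commute)
  qed (auto simp: clinearD[OF assms(1)] cinner_simps)
  then obtain g where g: "\<And>x y. cinner (f x) y = cinner x (g y)" by metis
  have "norm (g y) \<le> norm y" for y
  proof -
    have "(norm (g y))\<^sup>2 = Re (cinner (f (g y)) y)" using g[of "g y" y] by simp
    also have "\<dots> \<le> norm (g y) * norm y"
      using Re_cinner_le[of "f (g y)" y] mult_right_mono[OF contractiveD[OF assms(2), of "g y"] norm_ge_zero[of y]]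
      by linarith
    finally show ?thesis by (metis mult_le_cancel_left norm_le_zero_iff not_le power2_eq_square norm_ge_zero
      linorder_not_less order_le_less)
  qed
  then show ?thesis using g by (auto simp: adjoint_pair_def contractive_def)
qed

text \<open>The rule \<open>g x\<close> to \<open>f x\<close> is extended by continuity to the
  closure of the range of \<open>g\<close>, and by zero to the orthogonal complement. The last
  conjunct records the zero extension; through \<open>adjoint_pair_proj_range\<close> it makes an
  adjoint of \<open>k\<close> take its values in that closure.\<close>

lemma douglas_factorization:
  fixes f g :: "'a::chilbert_space \<Rightarrow> 'a"
  assumes f: "clinear f" and g: "clinear g" and le: "\<And>x. norm (f x) \<le> norm (g x)"
  shows "\<exists>k. clinear k \<and> contractive k \<and> (\<forall>x. k (g x) = f x) \<and> (\<forall>x. k (proj (closure (range g)) x) = k x)"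
proof -
  let ?C = "closure (range g)"
  have C: "closed_csubspace ?C" by (intro closed_csubspace_closure csubspace_range g)
  have seq: "\<exists>u. (\<lambda>n. g (u n)) \<longlonglongrightarrow> y" if y: "y \<in> ?C" for y
  proof -
    obtain w where w: "\<And>n. w n \<in> range g" "w \<longlonglongrightarrow> y" using y unfolding closure_sequential by blast
    then obtain u where "\<And>n. w n = g (u n)" unfolding image_iff by metis
    then have "w = (\<lambda>n. g (u n))" by (rule ext)
    then show ?thesis using w by blast
  qed
  \<comment> \<open>Well-definedness of the extension: \<open>f\<close> of a difference is dominated
    by \<open>g\<close> of it, so all sequences with \<open>g (u n)\<close> tending to
    \<open>y\<close> share one limit of \<open>f (u n)\<close>.\<close>
  have "\<exists>l. \<forall>u. (\<lambda>n. g (u n)) \<longlonglongrightarrow> y \<longrightarrow> (\<lambda>n. f (u n)) \<longlonglongrightarrow> l" if "y \<in> ?C" for y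
  proof -
    obtain u0 where u0: "(\<lambda>n. g (u0 n)) \<longlonglongrightarrow> y"
      using seq[OF \<open>y \<in> ?C\<close>] by blast
    have "Cauchy (\<lambda>n. f (u0 n))"
    proof (rule metric_CauchyI)
      fix e :: real assume "e > 0"
      then obtain N where N: "\<forall>m\<ge>N. \<forall>n\<ge>N. dist (g (u0 m)) (g (u0 n)) < e"
        using LIMSEQ_imp_Cauchy[OF u0] metric_CauchyD by blast
      have "dist (f (u0 m)) (f (u0 n)) \<le> dist (g (u0 m)) (g (u0 n))" for m n
        using le[of "u0 m - u0 n"] by (simp add: dist_norm clinearD[OF f] clinearD[OF g])
      then show "\<exists>M. \<forall>m\<ge>M. \<forall>n\<ge>M. dist (f (u0 m)) (f (u0 n)) < e"
        using N by (meson le_less_trans)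
    qed
    then obtain l where l: "(\<lambda>n. f (u0 n)) \<longlonglongrightarrow> l" using Cauchy_convergent convergent_def by blast
    have "(\<lambda>n. f (u n)) \<longlonglongrightarrow> l" if u: "(\<lambda>n. g (u n)) \<longlonglongrightarrow> y" for u
    proof -
      have "(\<lambda>n. g (u n) - g (u0 n)) \<longlonglongrightarrow> 0" using tendsto_diff[OF u u0] by simp
      then have "(\<lambda>n. f (u n) - f (u0 n)) \<longlonglongrightarrow> 0"
      proof (rule Lim_null_comparison[rotated, OF tendsto_norm_zero])
        show "\<forall>\<^sub>F n in sequentially. norm (f (u n) - f (u0 n)) \<le> norm (g (u n) - g (u0 n))"
          using le[of "u _ - u0 _"] by (simp add: clinearD[OF f] clinearD[OF g])
      qed
      from tendsto_add[OF this l] show ?thesis by simp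
    qed
    then show ?thesis by blast
  qed
  then obtain k0 where k0: "\<And>y u. y \<in> ?C \<Longrightarrow> (\<lambda>n. g (u n)) \<longlonglongrightarrow> y \<Longrightarrow> (\<lambda>n. f (u n)) \<longlonglongrightarrow> k0 y"
    by metis
  define k where "k x = k0 (proj ?C x)" for x
  have lim: "(\<lambda>n. f (u n)) \<longlonglongrightarrow> k x" if "(\<lambda>n. g (u n)) \<longlonglongrightarrow> proj ?C x" for u x
    unfolding k_def by (rule k0[OF proj_in[OF C] that])
  have pl: "clinear (proj ?C)" using hermitian_proj[OF C] by (rule adjoint_pair_clinear)
  show ?thesis
  proof (intro exI conjI allI)
    show "clinear k" unfolding clinear_def
    proof (intro conjI allI)
      fix x y
      obtain u v where uv: "(\<lambda>n. g (u n)) \<longlonglongrightarrow> proj ?C x" "(\<lambda>n. g (v n)) \<longlonglongrightarrow> proj ?C y"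
        using seq proj_in[OF C] by metis
      have "(\<lambda>n. f (u n + v n)) \<longlonglongrightarrow> k (x + y)"
        by (rule lim) (use tendsto_add[OF uv] in \<open>simp add: clinearD[OF g] clinearD[OF pl]\<close>)
      moreover have "(\<lambda>n. f (u n + v n)) \<longlonglongrightarrow> k x + k y"
        using tendsto_add[OF lim[OF uv(1)] lim[OF uv(2)]] by (simp add: clinearD[OF f])
      ultimately show "k (x + y) = k x + k y" by (rule LIMSEQ_unique)
    next
      fix c x
      obtain u where u: "(\<lambda>n. g (u n)) \<longlonglongrightarrow> proj ?C x" using seq proj_in[OF C] by metis
      have "(\<lambda>n. f (c *\<^sub>C u n)) \<longlonglongrightarrow> k (c *\<^sub>C x)"
        by (rule lim) (use tendsto_scaleC[OF u] in \<open>simp add: clinearD[OF g] clinearD[OF pl]\<close>)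
      moreover have "(\<lambda>n. f (c *\<^sub>C u n)) \<longlonglongrightarrow> c *\<^sub>C k x"
        using tendsto_scaleC[OF lim[OF u]] by (simp add: clinearD[OF f])
      ultimately show "k (c *\<^sub>C x) = c *\<^sub>C k x" by (rule LIMSEQ_unique)
    qed
    show "contractive k" unfolding contractive_def
    proof
      fix x
      obtain u where u: "(\<lambda>n. g (u n)) \<longlonglongrightarrow> proj ?C x" using seq proj_in[OF C] by metis
      have "norm (k x) \<le> norm (proj ?C x)"
        by (rule LIMSEQ_le[OF tendsto_norm[OF lim[OF u]] tendsto_norm[OF u]]) (use le in auto)
      also have "\<dots> \<le> norm x" by (rule contractiveD[OF contractive_proj[OF C]])
      finally show "norm (k x) \<le> norm x" .
    qed
    fix x
    have "proj ?C (g x) = g x" using closure_subset[of "range g"] by (intro proj_id[OF C]) auto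
    then have "(\<lambda>n::nat. f x) \<longlonglongrightarrow> k (g x)" by (intro lim) simp
    then show "k (g x) = f x" by (simp add: LIMSEQ_const_iff)
    show "k (proj ?C x) = k x" unfolding k_def by (simp add: proj_id[OF C] proj_in[OF C])
  qed
qed

section \<open>Square roots of bounded operators\<close>

text \<open>A Cauchy-Schwarz inequality for a possibly indefinite form that is dominated by the
  square of a seminorm. Polarisation gives a sum of squares, scaling \<open>x\<close> by the optimal
  real \<open>t\<close> turns the sum into a product, and a unimodular factor passes from the real
  part to the modulus.\<close>

lemma hermitian_form_bound:
  assumes N: "hermitian N" and d: "clinear d"
    and le: "\<And>x. \<bar>Re (cinner (N x) x)\<bar> \<le> (norm (d x))\<^sup>2"
  shows "norm (cinner (N x) y) \<le> norm (d x) * norm (d y)"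
proof -
  note Nl = clinearD[OF adjoint_pair_clinear[OF N]] and dl = clinearD[OF d]
  have sum: "2 * Re (cinner (N x) y) \<le> (norm (d x))\<^sup>2 + (norm (d y))\<^sup>2" for x y
  proof -
    have "Re (cinner (N y) x) = Re (cinner (N x) y)"
      by (metis adjoint_pairD[OF N] Re_cinner_commute)
    then have "4 * Re (cinner (N x) y) = Re (cinner (N (x + y)) (x + y)) - Re (cinner (N (x - y)) (x - y))"
      by (simp add: Nl cinner_simps)
    also have "\<dots> \<le> (norm (d (x + y)))\<^sup>2 + (norm (d (x - y)))\<^sup>2"
      using le[of "x + y"] le[of "x - y"] by linarith
    also have "\<dots> = 2 * (norm (d x))\<^sup>2 + 2 * (norm (d y))\<^sup>2"
      by (simp add: dl norm_add_sq norm_diff_sq)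
    finally show ?thesis by simp
  qed
  have re: "Re (cinner (N x) y) \<le> norm (d x) * norm (d y)" for x y
  proof -
    have "2 * t * Re (cinner (N x) y) \<le> t\<^sup>2 * (norm (d x))\<^sup>2 + (norm (d y))\<^sup>2" for t
      using sum[of "t *\<^sub>R x" y] by (simp add: Nl dl cinner_simps power_mult_distrib)
    then have "(Re (cinner (N x) y))\<^sup>2 \<le> (norm (d x))\<^sup>2 * (norm (d y))\<^sup>2"
      by (rule quadratic_nonneg_bound) simp
    then have "(Re (cinner (N x) y))\<^sup>2 \<le> (norm (d x) * norm (d y))\<^sup>2"
      by (simp add: power_mult_distrib)
    then show ?thesis using abs_le_square_iff[of "Re (cinner (N x) y)" "norm (d x) * norm (d y)"] by simp
  qed
  show ?thesis
  proof (cases "cinner (N x) y = 0")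
    case False
    let ?u = "cnj (cinner (N x) y) / of_real (norm (cinner (N x) y))"
    have u: "norm ?u = 1" using False by (simp add: norm_divide)
    have "cinner (N (?u *\<^sub>C x)) y = of_real (norm (cinner (N x) y))"
      using False complex_norm_square[of "cinner (N x) y"]
      by (simp add: Nl cinner_scaleC_left power2_eq_square mult.commute divide_eq_eq)
    then have "norm (cinner (N x) y) \<le> norm (d (?u *\<^sub>C x)) * norm (d y)"
      using re[of "?u *\<^sub>C x" y] by simp
    also have "\<dots> = norm (d x) * norm (d y)" using u by (simp only: dl norm_scaleC mult_1)
    finally show ?thesis .
  qed simp
qed

text \<open>The norm of a hermitian operator is its numerical radius: the preceding bound is used
  with \<open>d\<close> the identity and \<open>y = N x\<close>.\<close>

lemma hermitian_contractiveI:
  assumes N: "hermitian N" and le: "\<And>x. \<bar>Re (cinner (N x) x)\<bar> \<le> (norm x)\<^sup>2"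
  shows "contractive N"
  unfolding contractive_def
proof
  fix x
  have "norm (cinner (N x) (N x)) \<le> norm x * norm (N x)"
    using hermitian_form_bound[OF N, of "\<lambda>x. x" x "N x"] le by (simp add: clinear_def)
  then have "norm (N x) * norm (N x) \<le> norm x * norm (N x)"
    by (simp add: cinner_self norm_power power2_eq_square norm_mult)
  then show "norm (N x) \<le> norm x" by (cases "N x = 0") auto
qed

text \<open>By Cauchy-Schwarz for the semidefinite form of \<open>f\<close>, a vector on which the
  form vanishes is null against every \<open>y\<close>, in particular against
  \<open>y = f x\<close>.\<close>

lemma pos_hermitian_zero:
  assumes f: "hermitian f" and pos: "\<And>y. 0 \<le> Re (cinner (f y) y)" and x: "Re (cinner (f x) x) = 0"
  shows "f x = 0"
proof -
  note l = clinearD[OF adjoint_pair_clinear[OF f]]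
  have c: "Re (cinner (f y) x) = Re (cinner (f x) y)" for y
    by (metis adjoint_pairD[OF f] Re_cinner_commute)
  have "(- Re (cinner (f x) y))\<^sup>2 \<le> Re (cinner (f y) y) * 0" for y
  proof (rule quadratic_nonneg_bound)
    show "2 * t * - Re (cinner (f x) y) \<le> t\<^sup>2 * Re (cinner (f y) y) + 0" for t
      using pos[of "x + t *\<^sub>R y"] x c[of y] by (simp add: l cinner_simps power2_eq_square algebra_simps)
  qed (rule pos)
  from this[of "f x"] show ?thesis by simp
qed

text \<open>The iteration for \<open>1 - sqrt (1 - c)\<close>, compared with its scalar instance \<open>c = 1\<close>.\<close>

primrec sqrt_iter :: "('a::chilbert_space \<Rightarrow> 'a) \<Rightarrow> nat \<Rightarrow> 'a \<Rightarrow> 'a" where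
  "sqrt_iter c 0 = (\<lambda>x. 0)"
| "sqrt_iter c (Suc n) = (\<lambda>x. (1/2) *\<^sub>R (c x + sqrt_iter c n (sqrt_iter c n x)))"

primrec sqrt_iter_scalar :: "nat \<Rightarrow> real" where
  "sqrt_iter_scalar 0 = 0"
| "sqrt_iter_scalar (Suc n) = (1 + (sqrt_iter_scalar n)\<^sup>2) / 2"

lemma sqrt_iter_scalar_bounds: "0 \<le> sqrt_iter_scalar n" "sqrt_iter_scalar n \<le> 1"
proof -
  have "0 \<le> sqrt_iter_scalar n \<and> sqrt_iter_scalar n \<le> 1"
  proof (induction n)
    case (Suc n)
    then have "(sqrt_iter_scalar n)\<^sup>2 \<le> 1" by (simp add: power_le_one)
    then show ?case by (auto intro: add_nonneg_nonneg)
  qed simp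
  then show "0 \<le> sqrt_iter_scalar n" "sqrt_iter_scalar n \<le> 1" by auto
qed

lemma sqrt_iter_scalar_Suc_diff: "sqrt_iter_scalar (Suc (Suc n)) - sqrt_iter_scalar (Suc n) = (sqrt_iter_scalar (Suc n) + sqrt_iter_scalar n) / 2 * (sqrt_iter_scalar (Suc n) - sqrt_iter_scalar n)"
  unfolding sqrt_iter_scalar.simps(2)[of "Suc n"] sqrt_iter_scalar.simps(2)[of n] by (simp add: power2_eq_square field_simps)

lemma sqrt_iter_scalar_mono: "mono sqrt_iter_scalar"
  unfolding mono_iff_le_Suc
proof
  fix n show "sqrt_iter_scalar n \<le> sqrt_iter_scalar (Suc n)"
  proof (induction n)
    case (Suc n)
    then have "0 \<le> (sqrt_iter_scalar (Suc n) + sqrt_iter_scalar n) / 2 * (sqrt_iter_scalar (Suc n) - sqrt_iter_scalar n)"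
      using sqrt_iter_scalar_bounds(1)[of n] sqrt_iter_scalar_bounds(1)[of "Suc n"] by (intro mult_nonneg_nonneg) auto
    then show ?case using sqrt_iter_scalar_Suc_diff[of n] by linarith
  qed simp
qed

lemma sqrt_iter_scalar_convergent: "convergent sqrt_iter_scalar"
  using sqrt_iter_scalar_bounds by (intro Bseq_monoseq_convergent BseqI'[of _ 1] incseq_imp_monoseq sqrt_iter_scalar_mono) auto

lemma hermitian_sqrt_iter: "hermitian c \<Longrightarrow> hermitian (sqrt_iter c n)"
  by (induction n) (auto simp: adjoint_pair_def cinner_simps)

text \<open>Every iterate is a polynomial in \<open>c\<close>. Taking \<open>g\<close> to be
  \<open>c\<close> and then an iterate shows that the iterates commute with one another.\<close>

lemma sqrt_iter_commute:
  assumes g: "clinear g" and gc: "\<And>x. g (c x) = c (g x)"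
  shows "g (sqrt_iter c n x) = sqrt_iter c n (g x)"
  by (induction n arbitrary: x) (simp_all add: clinearD[OF g] gc)

lemma sqrt_iter_norm:
  assumes c: "contractive c" shows "norm (sqrt_iter c n x) \<le> sqrt_iter_scalar n * norm x"
proof (induction n arbitrary: x)
  case (Suc n)
  have "norm (sqrt_iter c n (sqrt_iter c n x)) \<le> sqrt_iter_scalar n * (sqrt_iter_scalar n * norm x)"
    using Suc[of "sqrt_iter c n x"] mult_left_mono[OF Suc[of x] sqrt_iter_scalar_bounds(1)[of n]] by linarith
  then have "norm (c x + sqrt_iter c n (sqrt_iter c n x)) \<le> norm x + sqrt_iter_scalar n * (sqrt_iter_scalar n * norm x)"
    using norm_triangle_ineq[of "c x" "sqrt_iter c n (sqrt_iter c n x)"] contractiveD[OF c, of x] by linarith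
  then have "(1/2) * norm (c x + sqrt_iter c n (sqrt_iter c n x)) \<le> (1/2) * (norm x + sqrt_iter_scalar n * (sqrt_iter_scalar n * norm x))"
    by simp
  then show ?case unfolding sqrt_iter.simps norm_scaleR by (simp add: power2_eq_square algebra_simps)
qed simp

text \<open>For consecutive iterates Y and Z, which commute, Z Z - Y Y = (Z + Y) (Z - Y). The
  differences thus obey the recursion of the scalar sequence, whose factors are non-negative, and
  are majorised by it.\<close>

lemma sqrt_iter_norm_diff:
  assumes h: "hermitian c" and c: "contractive c"
  shows "norm (sqrt_iter c (Suc n) x - sqrt_iter c n x) \<le> (sqrt_iter_scalar (Suc n) - sqrt_iter_scalar n) * norm x"
proof (induction n arbitrary: x)
  case 0 show ?case using contractiveD[OF c, of x] by simp
next
  case (Suc n)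
  let ?Y = "sqrt_iter c n" and ?Z = "sqrt_iter c (Suc n)"
  note Y = clinearD[OF adjoint_pair_clinear[OF hermitian_sqrt_iter[OF h, of n]]] and Z = clinearD[OF adjoint_pair_clinear[OF hermitian_sqrt_iter[OF h, of "Suc n"]]]
  have cY: "?Y (c x) = c (?Y x)" for x
    using sqrt_iter_commute[of c c n x] adjoint_pair_clinear[OF h] by simp
  have "?Z (?Y x) = ?Y (?Z x)" for x
    by (rule sqrt_iter_commute[symmetric, OF adjoint_pair_clinear[OF hermitian_sqrt_iter[OF h]]]) (rule cY)
  then have "sqrt_iter c (Suc (Suc n)) x - ?Z x = (1/2) *\<^sub>R (?Z (?Z x - ?Y x) + ?Y (?Z x - ?Y x))"
    unfolding sqrt_iter.simps(2)[of c "Suc n"]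
    by (simp only: Y(5) Z(5)) (simp add: algebra_simps)
  then have "norm (sqrt_iter c (Suc (Suc n)) x - ?Z x) = (1/2) * norm (?Z (?Z x - ?Y x) + ?Y (?Z x - ?Y x))"
    unfolding norm_scaleR by simp
  also have "\<dots> \<le> (1/2) * (sqrt_iter_scalar (Suc n) * norm (?Z x - ?Y x) + sqrt_iter_scalar n * norm (?Z x - ?Y x))"
    by (intro mult_left_mono norm_triangle_mono sqrt_iter_norm c) simp
  also have "\<dots> = (sqrt_iter_scalar (Suc n) + sqrt_iter_scalar n) / 2 * norm (?Z x - ?Y x)" 
    by (simp add: distrib_right del: sqrt_iter_scalar.simps sqrt_iter.simps)
  also have "\<dots> \<le> (sqrt_iter_scalar (Suc n) + sqrt_iter_scalar n) / 2 * ((sqrt_iter_scalar (Suc n) - sqrt_iter_scalar n) * norm x)"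
    using sqrt_iter_scalar_bounds(1)[of n] sqrt_iter_scalar_bounds(1)[of "Suc n"] by (intro mult_left_mono Suc) (simp del: sqrt_iter_scalar.simps)
  also have "\<dots> = (sqrt_iter_scalar (Suc (Suc n)) - sqrt_iter_scalar (Suc n)) * norm x" by (simp only: sqrt_iter_scalar_Suc_diff mult.assoc)
  finally show ?case .
qed

text \<open>The scalar majorant is Cauchy, so the iterates converge pointwise. The limit equation
  says that the square of 1 - Y is 1 - c. Commutation passes to the limit weakly: a hermitian
  \<open>g\<close> is moved to the other argument of \<open>cinner\<close>, and no continuity of
  \<open>g\<close> is required.\<close>

lemma sqrt_iter_limit:
  assumes h: "hermitian c" and c: "contractive c"
  shows "\<exists>Y. hermitian Y \<and> contractive Y \<and> (\<forall>x. 2 *\<^sub>R Y x = c x + Y (Y x)) \<and>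
    (\<forall>g. hermitian g \<longrightarrow> (\<forall>x. g (c x) = c (g x)) \<longrightarrow> (\<forall>x. g (Y x) = Y (g x)))"
proof -
  let ?Y = "sqrt_iter c"
  have diff: "norm (?Y (n + k) x - ?Y n x) \<le> (sqrt_iter_scalar (n + k) - sqrt_iter_scalar n) * norm x" for n k x
  proof (induction k)
    case (Suc k)
    have "norm (?Y (n + Suc k) x - ?Y n x) \<le> norm (?Y (Suc (n + k)) x - ?Y (n + k) x) + norm (?Y (n + k) x - ?Y n x)"
      using norm_triangle_ineq[of "?Y (Suc (n + k)) x - ?Y (n + k) x" "?Y (n + k) x - ?Y n x"]
      by (simp del: sqrt_iter.simps)
    also have "\<dots> \<le> (sqrt_iter_scalar (Suc (n + k)) - sqrt_iter_scalar (n + k)) * norm x + (sqrt_iter_scalar (n + k) - sqrt_iter_scalar n) * norm x"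
      by (intro add_mono Suc sqrt_iter_norm_diff h c)
    also have "\<dots> = (sqrt_iter_scalar (n + Suc k) - sqrt_iter_scalar n) * norm x" by (simp add: left_diff_distrib del: sqrt_iter_scalar.simps)
    finally show ?case .
  qed simp
  have "Cauchy (\<lambda>n. ?Y n x)" for x
  proof (rule metric_CauchyI)
    fix e :: real assume e: "e > 0"
    have "Cauchy sqrt_iter_scalar" using sqrt_iter_scalar_convergent by (rule convergent_Cauchy)
    then obtain N where N: "\<And>m n. m \<ge> N \<Longrightarrow> n \<ge> N \<Longrightarrow> dist (sqrt_iter_scalar m) (sqrt_iter_scalar n) < e / (norm x + 1)"
      using metric_CauchyD[of sqrt_iter_scalar "e / (norm x + 1)"] e by (auto simp: add_nonneg_pos)
    have *: "dist (?Y m x) (?Y n x) < e" if "m \<ge> n" "n \<ge> N" for m n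
    proof -
      obtain k where k: "m = n + k" using le_Suc_ex[OF \<open>m \<ge> n\<close>] by blast
      have "dist (?Y m x) (?Y n x) \<le> (sqrt_iter_scalar m - sqrt_iter_scalar n) * norm x" using diff[of n k x] by (simp add: k dist_norm)
      also have "\<dots> \<le> (e / (norm x + 1)) * norm x"
        using N[of m n] that by (intro mult_right_mono) (auto simp: dist_real_def)
      also have "\<dots> < e" using e norm_ge_zero[of x] by (simp add: divide_less_eq add_nonneg_pos distrib_left)
      finally show ?thesis .
    qed
    show "\<exists>M. \<forall>m\<ge>M. \<forall>n\<ge>M. dist (?Y m x) (?Y n x) < e"
    proof (intro exI allI impI)
      fix m n assume "N \<le> m" "N \<le> n"
      then show "dist (?Y m x) (?Y n x) < e" using *[of n m] *[of m n] by (cases "n \<le> m") (auto simp: dist_commute)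
    qed
  qed
  then have "\<exists>l. (\<lambda>n. ?Y n x) \<longlonglongrightarrow> l" for x using Cauchy_convergent convergent_def by blast
  then obtain Y where Y: "\<And>x. (\<lambda>n. ?Y n x) \<longlonglongrightarrow> Y x" by metis
  have ctrn: "contractive (?Y n)" for n
    unfolding contractive_def
  proof
    fix x
    show "norm (?Y n x) \<le> norm x"
      using sqrt_iter_norm[OF c, of n x] mult_right_mono[OF sqrt_iter_scalar_bounds(2)[of n] norm_ge_zero[of x]] by linarith
  qed
  have hY: "hermitian Y" unfolding adjoint_pair_def
  proof (intro allI)
    fix x y
    have "(\<lambda>n. cinner (?Y n x) y) \<longlonglongrightarrow> cinner (Y x) y" by (intro tendsto_cinner Y tendsto_const)
    moreover have "(\<lambda>n. cinner x (?Y n y)) \<longlonglongrightarrow> cinner x (Y y)" by (intro tendsto_cinner Y tendsto_const)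
    ultimately show "cinner (Y x) y = cinner x (Y y)"
      by (simp add: adjoint_pairD[OF hermitian_sqrt_iter[OF h]] LIMSEQ_unique)
  qed
  have cY: "contractive Y" unfolding contractive_def
  proof
    fix x show "norm (Y x) \<le> norm x"
      using tendsto_norm[OF Y] by (rule LIMSEQ_le_const2) (use contractiveD[OF ctrn] in blast)
  qed
  have bounded_sqrt: "2 *\<^sub>R Y x = c x + Y (Y x)" for x
  proof -
    \<comment> \<open>The common bound 1 on the iterates allows the limit in both factors of the
      square at once.\<close>
    have "(\<lambda>n. ?Y n (?Y n x - Y x)) \<longlonglongrightarrow> 0"
    proof (rule Lim_null_comparison)
      show "\<forall>\<^sub>F n in sequentially. norm (?Y n (?Y n x - Y x)) \<le> norm (?Y n x - Y x)"
        using contractiveD[OF ctrn] by simp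
      show "(\<lambda>n. norm (?Y n x - Y x)) \<longlonglongrightarrow> 0"
        using tendsto_norm[OF tendsto_diff[OF Y[of x] tendsto_const[of "Y x"]]] by simp
    qed
    from tendsto_add[OF this Y[of "Y x"]] have "(\<lambda>n. ?Y n (?Y n x)) \<longlonglongrightarrow> Y (Y x)"
      by (simp add: clinearD[OF adjoint_pair_clinear[OF hermitian_sqrt_iter[OF h]]])
    then have "(\<lambda>n. (1/2) *\<^sub>R (c x + ?Y n (?Y n x))) \<longlonglongrightarrow> (1/2) *\<^sub>R (c x + Y (Y x))"
      by (intro tendsto_intros)
    then have "(\<lambda>n. ?Y (Suc n) x) \<longlonglongrightarrow> (1/2) *\<^sub>R (c x + Y (Y x))" by simp
    moreover have "(\<lambda>n. ?Y (Suc n) x) \<longlonglongrightarrow> Y x" using Y[of x] by (rule LIMSEQ_Suc)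
    ultimately have "Y x = (1/2) *\<^sub>R (c x + Y (Y x))" using LIMSEQ_unique by blast
    then have "2 *\<^sub>R Y x = 2 *\<^sub>R ((1/2) *\<^sub>R (c x + Y (Y x)))" by simp
    then show ?thesis by simp
  qed
  have "g (Y x) = Y (g x)" if g: "hermitian g" "\<And>x. g (c x) = c (g x)" for g x
  proof (rule cinner_eqI)
    fix y
    have "(\<lambda>n. cinner (?Y n x) (g y)) \<longlonglongrightarrow> cinner (Y x) (g y)" by (intro tendsto_cinner Y tendsto_const)
    moreover have "(\<lambda>n. cinner (?Y n (g x)) y) \<longlonglongrightarrow> cinner (Y (g x)) y" by (intro tendsto_cinner Y tendsto_const)
    moreover have "cinner (?Y n x) (g y) = cinner (?Y n (g x)) y" for n
      using sqrt_iter_commute[of g c n x, OF adjoint_pair_clinear[OF g(1)] g(2)] adjoint_pairD[OF g(1)] by metis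
    ultimately show "cinner (g (Y x)) y = cinner (Y (g x)) y"
      by (simp add: adjoint_pairD[OF g(1)] LIMSEQ_unique)
  qed
  then show ?thesis using hY cY bounded_sqrt by blast
qed

definition sqrt_of :: "('a::chilbert_space \<Rightarrow> 'a) \<Rightarrow> ('a \<Rightarrow> 'a) \<Rightarrow> bool" where
  "sqrt_of s b \<longleftrightarrow> hermitian s \<and> (\<forall>x. 0 \<le> Re (cinner (s x) x)) \<and> (\<forall>x. s (s x) = b x)"

text \<open>Commutation with the hermitian maps that commute with \<open>b\<close> is part of the
  choice, because the uniqueness of the root rests on it.\<close>

definition bounded_sqrt :: "('a::chilbert_space \<Rightarrow> 'a) \<Rightarrow> 'a \<Rightarrow> 'a" where
  "bounded_sqrt b = (SOME s. sqrt_of s b \<and>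
     (\<forall>g. hermitian g \<longrightarrow> (\<forall>x. g (b x) = b (g x)) \<longrightarrow> (\<forall>x. g (s x) = s (g x))))"

definition unit_interval_op :: "('a::chilbert_space \<Rightarrow> 'a) \<Rightarrow> bool" where
  "unit_interval_op b \<longleftrightarrow> hermitian b \<and>
     (\<forall>x. 0 \<le> Re (cinner (b x) x) \<and> Re (cinner (b x) x) \<le> (norm x)\<^sup>2)"

text \<open>The root is 1 - Y, where Y is the limit of the iteration for the contraction c = 1 - b.
  It is positive because Y is itself a contraction.\<close>

lemma bounded_sqrt_properties:
  assumes b: "unit_interval_op b"
  shows "sqrt_of (bounded_sqrt b) b \<and>
     (\<forall>g. hermitian g \<longrightarrow> (\<forall>x. g (b x) = b (g x)) \<longrightarrow> (\<forall>x. g (bounded_sqrt b x) = bounded_sqrt b (g x)))"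
proof -
  have hb: "hermitian b" and b0: "\<And>x. 0 \<le> Re (cinner (b x) x)" "\<And>x. Re (cinner (b x) x) \<le> (norm x)\<^sup>2"
    using b by (auto simp: unit_interval_op_def)
  define c where "c x = x - b x" for x
  have hc: "hermitian c" using adjoint_pairD[OF hb] by (simp add: adjoint_pair_def c_def cinner_simps)
  have cc: "contractive c"
  proof (rule hermitian_contractiveI[OF hc])
    show "\<bar>Re (cinner (c x) x)\<bar> \<le> (norm x)\<^sup>2" for x
      using b0[of x] by (simp add: c_def cinner_simps)
  qed
  obtain Y where Y: "hermitian Y" "contractive Y" "\<And>x. 2 *\<^sub>R Y x = c x + Y (Y x)"
    and Yc: "\<And>g x. hermitian g \<Longrightarrow> (\<And>x. g (c x) = c (g x)) \<Longrightarrow> g (Y x) = Y (g x)"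
    using sqrt_iter_limit[OF hc cc] by blast
  define s where "s x = x - Y x" for x
  have "hermitian s" using adjoint_pairD[OF Y(1)] by (simp add: adjoint_pair_def s_def cinner_simps)
  moreover have "0 \<le> Re (cinner (s x) x)" for x
    using Re_cinner_le[of "Y x" x] mult_right_mono[OF contractiveD[OF Y(2), of x] norm_ge_zero[of x]]
    by (simp add: s_def cinner_simps power2_eq_square)
  moreover have "s (s x) = b x" for x
    using Y(3)[of x] by (simp add: s_def clinearD[OF adjoint_pair_clinear[OF Y(1)]] c_def scaleR_2 algebra_simps)
  moreover have "g (s x) = s (g x)" if "hermitian g" "\<And>x. g (b x) = b (g x)" for g x
    using Yc[OF that(1), of x] that clinearD(5)[OF adjoint_pair_clinear[OF that(1)]] by (simp add: s_def c_def)
  ultimately have "\<exists>s. sqrt_of s b \<and>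
     (\<forall>g. hermitian g \<longrightarrow> (\<forall>x. g (b x) = b (g x)) \<longrightarrow> (\<forall>x. g (s x) = s (g x)))"
    by (intro exI[of _ s]) (simp add: sqrt_of_def)
  then show ?thesis unfolding bounded_sqrt_def by (rule someI_ex)
qed

lemma bounded_sqrtD:
  assumes "unit_interval_op b"
  shows "hermitian (bounded_sqrt b)" "0 \<le> Re (cinner (bounded_sqrt b x) x)" "bounded_sqrt b (bounded_sqrt b x) = b x"
    "hermitian g \<Longrightarrow> (\<And>x. g (b x) = b (g x)) \<Longrightarrow> g (bounded_sqrt b x) = bounded_sqrt b (g x)"
  using bounded_sqrt_properties[OF assms] by (auto simp: sqrt_of_def)

lemma bounded_sqrt_norm: "unit_interval_op b \<Longrightarrow> (norm (bounded_sqrt b x))\<^sup>2 = Re (cinner (b x) x)"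
  using adjoint_pairD[OF bounded_sqrtD(1), of b "bounded_sqrt b x" x] by (simp add: bounded_sqrtD)

text \<open>Any other root \<open>s\<close> commutes with \<open>b\<close>, hence with the chosen
  root r. Therefore r + s annihilates \<open>y = r x - s x\<close>. Both forms are non-negative, so
  r and s annihilate \<open>y\<close> separately, and the squared norm of \<open>y\<close> is
  \<open>cinner x (r y - s y) = 0\<close>.\<close>

lemma sqrt_of_unique:
  assumes b: "unit_interval_op b" and s: "sqrt_of s b"
  shows "s = bounded_sqrt b"
proof
  fix x
  let ?r = "bounded_sqrt b"
  have hs: "hermitian s" and s0: "\<And>x. 0 \<le> Re (cinner (s x) x)" and ss: "\<And>x. s (s x) = b x"
    using s by (auto simp: sqrt_of_def)
  note r = bounded_sqrtD[OF b]
  note ls = clinearD[OF adjoint_pair_clinear[OF hs]] and lr = clinearD[OF adjoint_pair_clinear[OF r(1)]]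
  have comm: "s (?r x) = ?r (s x)" for x
    by (rule r(4)[OF hs]) (simp add: ss[symmetric])
  define y where "y = ?r x - s x"
  have "?r y + s y = 0" by (simp add: y_def ls lr r(3) ss comm)
  then have "Re (cinner (?r y) y) + Re (cinner (s y) y) = 0"
    by (metis cinner_add_left cinner_zero_left plus_complex.sel(1) zero_complex.sel(1))
  then have "Re (cinner (?r y) y) = 0" "Re (cinner (s y) y) = 0"
    using r(2)[of y] s0[of y] by linarith+
  then have "?r y = 0" "s y = 0" using pos_hermitian_zero r(1,2) hs s0 by metis+
  moreover have "cinner y y = cinner x (?r y - s y)"
    by (simp add: y_def cinner_simps ls lr adjoint_pairD[OF r(1)] adjoint_pairD[OF hs])
  ultimately have "y = 0" by (simp add: cinner_self)
  then show "s x = ?r x" by (simp add: y_def)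
qed

section \<open>Graphs of everywhere defined operators\<close>

definition graph_on :: "'a::chilbert_space set \<Rightarrow> ('a \<Rightarrow> 'a) \<Rightarrow> 'a rel" where
  "graph_on M f = {(x, f x) |x. x \<in> M}"

lemma graph_on_iff: "(x, y) \<in> graph_on M f \<longleftrightarrow> x \<in> M \<and> y = f x" by (auto simp: graph_on_def)

lemma Domain_graph_on: "Domain (graph_on M f) = M" by (auto simp: graph_on_def)

lemma Range_graph_on: "Range (graph_on M f) = f ` M" by (auto simp: graph_on_def)

lemma single_valued_graph_on: "single_valued (graph_on M f)" by (auto simp: graph_on_def single_valued_def)

lemma ap_eqI: "single_valued G \<Longrightarrow> (x, y) \<in> G \<Longrightarrow> ap G x = y"
  unfolding ap_def by (rule the_equality) (auto dest: single_valuedD)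

lemma graph_on_comp: "f ` M \<subseteq> N \<Longrightarrow> graph_on N g \<circ>\<^sub>o graph_on M f = graph_on M (\<lambda>x. g (f x))"
  by (auto simp: graph_on_def)

lemma graph_on_add: "graph_on M f +\<^sub>o graph_on M g = graph_on M (\<lambda>x. f x + g x)"
  by (auto simp: graph_on_def op_add_def)

lemma graph_on_diff: "graph_on M f -\<^sub>o graph_on M g = graph_on M (\<lambda>x. f x - g x)"
  by (auto simp: graph_on_def op_diff_def)

lemma graph_on_scale: "c \<cdot>\<^sub>o graph_on M f = graph_on M (\<lambda>x. c *\<^sub>C f x)"
  by (auto simp: graph_on_def op_scale_def)

lemma Id_on_graph_on: "Id_on M = graph_on M (\<lambda>x. x)" by (auto simp: graph_on_def)

lemma Id_graph_on: "Id = graph_on UNIV (\<lambda>x. x)" by (auto simp: graph_on_def)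

lemma graph_on_eq_iff: "graph_on M f = graph_on M g \<longleftrightarrow> (\<forall>x\<in>M. f x = g x)"
  unfolding set_eq_iff by (auto simp: graph_on_def)

lemma linear_op_graph_on: "clinear f \<Longrightarrow> csubspace M \<Longrightarrow> linear_op (graph_on M f)"
  unfolding linear_op_def by (auto simp: single_valued_graph_on graph_on_iff clinearD csubspaceD)

lemma linear_opD:
  assumes "linear_op G"
  shows "single_valued G" "(0, 0) \<in> G" "(x, y) \<in> G \<Longrightarrow> (x', y') \<in> G \<Longrightarrow> (x + x', y + y') \<in> G"
    "(x, y) \<in> G \<Longrightarrow> (c *\<^sub>C x, c *\<^sub>C y) \<in> G" "(x, y) \<in> G \<Longrightarrow> (r *\<^sub>R x, r *\<^sub>R y) \<in> G"
    "(x, y) \<in> G \<Longrightarrow> (x', y') \<in> G \<Longrightarrow> (x - x', y - y') \<in> G"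
    "(x, y) \<in> G \<Longrightarrow> (x, y') \<in> G \<Longrightarrow> y = y'"
proof -
  show a: "single_valued G" "(0, 0) \<in> G" "(x, y) \<in> G \<Longrightarrow> (x', y') \<in> G \<Longrightarrow> (x + x', y + y') \<in> G"
    "(x, y) \<in> G \<Longrightarrow> (c *\<^sub>C x, c *\<^sub>C y) \<in> G" for x y x' y' c
    using assms by (auto simp: linear_op_def)
  show r: "(x, y) \<in> G \<Longrightarrow> (r *\<^sub>R x, r *\<^sub>R y) \<in> G" for x y r
    using a(4)[of x y "of_real r"] by (simp add: scaleC_complex_of_real)
  show "(x, y) \<in> G \<Longrightarrow> (x', y') \<in> G \<Longrightarrow> (x - x', y - y') \<in> G"
    using a(3)[of x y "- x'" "- y'"] r[of x' y' "-1"] by simp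
  show "(x, y) \<in> G \<Longrightarrow> (x, y') \<in> G \<Longrightarrow> y = y'" using a(1) by (auto dest: single_valuedD)
qed

text \<open>Precomposition with \<open>proj M\<close> makes the operator total, with value zero on
  the orthogonal complement. This is the passage from relations to functions.\<close>

lemma linear_op_repr:
  assumes G: "linear_op G" and M: "closed_csubspace M" and D: "Domain G = M"
  defines "f \<equiv> \<lambda>x. ap G (proj M x)"
  shows "clinear f" "G = graph_on M f" "f (proj M x) = f x"
proof -
  note l = linear_opD[OF G]
  have app: "(x, ap G x) \<in> G" if "x \<in> M" for x
    using that D ap_eqI[OF l(1)] by (metis DomainE)
  note pl = clinearD[OF adjoint_pair_clinear[OF hermitian_proj[OF M]]]
  have g: "(proj M x, f x) \<in> G" for x unfolding f_def by (rule app[OF proj_in[OF M]])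
  show "clinear f" unfolding clinear_def
  proof (intro conjI allI)
    show "f (x + y) = f x + f y" for x y
      using l(3)[OF g[of x] g[of y]] g[of "x + y"] l(7) by (simp add: pl)
    show "f (c *\<^sub>C x) = c *\<^sub>C f x" for c x
      using l(4)[OF g[of x], of c] g[of "c *\<^sub>C x"] l(7) by (simp add: pl)
  qed
  show "f (proj M x) = f x" by (simp add: f_def proj_id[OF M] proj_in[OF M])
  show "G = graph_on M f"
  proof (rule set_eqI, clarify)
    fix x y
    show "(x, y) \<in> G \<longleftrightarrow> (x, y) \<in> graph_on M f"
    proof (cases "x \<in> M")
      case True
      then have "f x = ap G x" by (simp add: f_def proj_id[OF M])
      then show ?thesis using app[OF True] l(7)[of x y "ap G x"] True by (auto simp: graph_on_iff)
    qed (use D in \<open>auto simp: graph_on_iff\<close>)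
  qed
qed

lemma contraction_repr:
  assumes C: "contraction M N C" and M: "closed_csubspace M"
  obtains f where "clinear f" "contractive f" "\<And>x. f (proj M x) = f x" "\<And>x. f x \<in> N" "C = graph_on M f"
proof -
  have lin: "linear_op C" and D: "Domain C = M" and R: "Range C \<subseteq> N"
    and n: "\<And>x y. (x, y) \<in> C \<Longrightarrow> norm y \<le> norm x" using C by (auto simp: contraction_def)
  define f where "f x = ap C (proj M x)" for x
  note rp = linear_op_repr[OF lin M D, folded f_def]
  have g: "(proj M x, f x) \<in> C" for x
    using rp(3)[of x] proj_in[OF M, of x] by (subst rp(2)) (simp add: graph_on_iff)
  show thesis
  proof (rule that[OF rp(1) _ rp(3) _ rp(2)])
    show "contractive f" unfolding contractive_def
      using n[OF g] contractiveD[OF contractive_proj[OF M]] order_trans by blast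
    show "f x \<in> N" for x using g[of x] R by auto
  qed
qed

lemma contraction_graph_on:
  "clinear f \<Longrightarrow> contractive f \<Longrightarrow> csubspace M \<Longrightarrow> (\<And>x. x \<in> M \<Longrightarrow> f x \<in> N) \<Longrightarrow> contraction M N (graph_on M f)"
  unfolding contraction_def by (auto simp: linear_op_graph_on Domain_graph_on Range_graph_on graph_on_iff contractiveD)

lemma adjoint_pair_proj_range:
  assumes M: "closed_csubspace M" and fg: "adjoint_pair f g" and f: "\<And>x. f (proj M x) = f x"
  shows "g y \<in> M"
proof -
  have "cinner (proj M (g y)) x = cinner (g y) x" for x
    using adjoint_pairD[OF hermitian_proj[OF M]] adjoint_pairD[OF adjoint_pair_sym[OF fg]] f by metis
  then have "proj M (g y) = g y" by (rule cinner_eqI)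
  then show ?thesis using proj_in[OF M] by metis
qed

lemma adj_graph_on:
  assumes M: "closed_csubspace M" and fg: "adjoint_pair f g" and g: "\<And>y. y \<in> N \<Longrightarrow> g y \<in> M"
  shows "adj M N (graph_on M f) = graph_on N g"
proof (rule set_eqI, clarify)
  fix y z
  have "z = g y" if "y \<in> N" "z \<in> M" "\<And>x. x \<in> M \<Longrightarrow> cinner (f x) y = cinner x z"
  proof -
    have "cinner (g y - z) (g y - z) = cinner (g y - z) (g y) - cinner (g y - z) z"
      by (simp add: cinner_simps)
    also have "\<dots> = 0"
      using that(3)[of "g y - z"] csubspaceD(5)[OF closed_csubspace_csubspace[OF M] g[OF that(1)] that(2)] adjoint_pairD[OF fg] by simp
    finally show ?thesis by (simp add: cinner_self)
  qed
  then show "(y, z) \<in> adj M N (graph_on M f) \<longleftrightarrow> (y, z) \<in> graph_on N g"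
    using g adjoint_pairD[OF fg] by (auto simp: adj_def graph_on_iff)
qed

lemma densely_defined_graph_on:
  "clinear f \<Longrightarrow> csubspace M \<Longrightarrow> (\<And>x. x \<in> M \<Longrightarrow> f x \<in> M) \<Longrightarrow> densely_defined M (graph_on M f)"
  unfolding densely_defined_def
  using closure_subset by (auto simp: linear_op_graph_on Domain_graph_on graph_on_iff)

lemma selfadjoint_graph_on:
  "closed_csubspace M \<Longrightarrow> hermitian f \<Longrightarrow> (\<And>x. x \<in> M \<Longrightarrow> f x \<in> M) \<Longrightarrow> selfadjoint M (graph_on M f)"
  unfolding selfadjoint_def
  by (simp add: adj_graph_on densely_defined_graph_on adjoint_pair_clinear closed_csubspace_csubspace)

text \<open>The squared norm of the root at a vector is the form of \<open>b\<close> there, so the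
  root vanishes on the complement of \<open>M\<close> together with \<open>b\<close>. Being
  hermitian, it then also has its range in \<open>M\<close>.\<close>

lemma bounded_sqrt_proj:
  assumes M: "closed_csubspace M" and b: "unit_interval_op b" and bM: "\<And>x. b (proj M x) = b x"
  shows "bounded_sqrt b (proj M x) = bounded_sqrt b x" "bounded_sqrt b x \<in> M"
proof -
  have hb: "hermitian b" using b by (simp add: unit_interval_op_def)
  have "b x - b (proj M x) = 0" by (simp add: bM)
  then have "b (x - proj M x) = 0" by (simp add: clinearD[OF adjoint_pair_clinear[OF hb]])
  then have "bounded_sqrt b (x - proj M x) = 0" using bounded_sqrt_norm[OF b, of "x - proj M x"] by simp
  then show *: "bounded_sqrt b (proj M x) = bounded_sqrt b x" for x
    using bounded_sqrt_norm[OF b, of "x - proj M x"] bM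
    by (simp add: clinearD[OF adjoint_pair_clinear[OF bounded_sqrtD(1)[OF b]]] clinearD[OF adjoint_pair_clinear[OF hb]])
  show "bounded_sqrt b x \<in> M" by (rule adjoint_pair_proj_range[OF M bounded_sqrtD(1)[OF b] *])
qed

text \<open>The definite description ranges over possibly unbounded competitors; each is reduced to
  a total function, to which \<open>sqrt_of_unique\<close> applies.\<close>

lemma op_sqrt_graph_on:
  assumes M: "closed_csubspace M" and b: "unit_interval_op b" and bM: "\<And>x. b (proj M x) = b x"
  shows "op_sqrt M (graph_on M b) = graph_on M (bounded_sqrt b)"
  unfolding op_sqrt_def
proof (rule the_equality)
  note s = bounded_sqrtD[OF b] and sM = bounded_sqrt_proj[OF M b bM]
  have "0 \<le> Re (cinner x (bounded_sqrt b x))" for x by (metis s(2) Re_cinner_commute)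
  then have "positive_op M (graph_on M (bounded_sqrt b))"
    unfolding positive_op_def symmetric_op_def
    by (auto simp: graph_on_iff adjoint_pairD[OF s(1)] densely_defined_graph_on[OF adjoint_pair_clinear[OF s(1)] closed_csubspace_csubspace[OF M]] sM)
  moreover have "graph_on M (bounded_sqrt b) \<circ>\<^sub>o graph_on M (bounded_sqrt b) = graph_on M b"
    by (subst graph_on_comp) (auto simp: sM s(3))
  ultimately show "positive_selfadjoint M (graph_on M (bounded_sqrt b)) \<and> graph_on M (bounded_sqrt b) \<circ>\<^sub>o graph_on M (bounded_sqrt b) = graph_on M b"
    unfolding positive_selfadjoint_def by (simp add: selfadjoint_graph_on[OF M s(1)] sM)
next
  fix Q assume Q: "positive_selfadjoint M Q \<and> Q \<circ>\<^sub>o Q = graph_on M b"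
  then have lin: "linear_op Q" and sub: "Q \<subseteq> M \<times> M" and sym: "symmetric_op Q"
    and pos: "\<And>x y. (x, y) \<in> Q \<Longrightarrow> 0 \<le> Re (cinner y x)"
    by (auto simp: positive_selfadjoint_def positive_op_def densely_defined_def)
  \<comment> \<open>The domain of the square is contained in that of \<open>Q\<close>, so a root of
    an operator defined on all of \<open>M\<close> is itself defined on all of
    \<open>M\<close>.\<close>
  have "M \<subseteq> Domain Q"
  proof
    fix x assume "x \<in> M"
    then have "(x, b x) \<in> Q \<circ>\<^sub>o Q" using Q by (simp add: graph_on_iff)
    then show "x \<in> Domain Q" by auto
  qed
  then have D: "Domain Q = M" using sub by auto
  define q where "q x = ap Q (proj M x)" for x
  note rp = linear_op_repr[OF lin M D, folded q_def]
  have g: "(proj M x, q x) \<in> Q" for x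
    using rp(3)[of x] proj_in[OF M, of x] by (subst rp(2)) (simp add: graph_on_iff)
  have qM: "q x \<in> M" for x using g[of x] sub by auto
  have up: "cinner u (proj M x) = cinner u x" if "u \<in> M" for u x
    using that by (simp add: adjoint_pairD[OF hermitian_proj[OF M], symmetric] proj_id[OF M])
  have "sqrt_of q b"
    unfolding sqrt_of_def adjoint_pair_def
  proof (intro conjI allI)
    show "cinner (q x) y = cinner x (q y)" for x y
      using sym g[of x] g[of y] up[OF qM] unfolding symmetric_op_def
      by (metis cinner_commute)
    show "0 \<le> Re (cinner (q x) x)" for x using pos[OF g[of x]] up[OF qM] by simp
    show "q (q x) = b x" for x
    proof -
      have "(q x, q (q x)) \<in> Q" using g[of "q x"] qM by (simp add: proj_id[OF M])
      then have "(proj M x, q (q x)) \<in> Q \<circ>\<^sub>o Q" using g[of x] by auto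
      then show ?thesis using Q by (simp add: graph_on_iff bM)
    qed
  qed
  then show "Q = graph_on M (bounded_sqrt b)" using sqrt_of_unique[OF b] rp(2) by metis
qed

section \<open>Positive selfadjoint operators and their Cayley transforms\<close>

text \<open>If \<open>1 + B\<close> is injective, this is the graph of \<open>(1 - B) (1 + B)\<inverse>\<close>.\<close>

definition inv_cayley :: "('a::chilbert_space \<Rightarrow> 'a) \<Rightarrow> 'a rel" where
  "inv_cayley B = {(v + B v, v - B v) |v. True}"

text \<open>The parameter is recovered as v = (x + y)/2. Membership thereby becomes a linear
  equation, valid whether or not 1 + B is injective.\<close>

lemma inv_cayley_iff: "clinear B \<Longrightarrow> (x, y) \<in> inv_cayley B \<longleftrightarrow> B (x + y) = x - y"
proof
  assume B: "clinear B"
  show "B (x + y) = x - y" if "(x, y) \<in> inv_cayley B"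
    using that by (auto simp: inv_cayley_def clinearD[OF B])
  assume e: "B (x + y) = x - y"
  let ?v = "(1/2) *\<^sub>R (x + y)"
  have "B ?v = (1/2) *\<^sub>R (x - y)" by (simp only: clinearD(6)[OF B] e)
  then have "x = ?v + B ?v" "y = ?v - B ?v"
    by (simp_all only: scaleR_add_right[symmetric] scaleR_diff_right[symmetric])
      (simp_all add: scaleR_2[symmetric])
  then show "(x, y) \<in> inv_cayley B" unfolding inv_cayley_def by blast
qed

lemma closed_adj: "closed_csubspace H1 \<Longrightarrow> closed_csubspace H2 \<Longrightarrow> closed (adj H1 H2 G)"
  unfolding closed_sequential_limits
proof (intro allI impI, elim conjE)
  fix f l assume H: "closed_csubspace H1" "closed_csubspace H2" and f: "\<forall>n. f n \<in> adj H1 H2 G" and l: "f \<longlonglongrightarrow> l"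
  have l1: "(\<lambda>n. fst (f n)) \<longlonglongrightarrow> fst l" and l2: "(\<lambda>n. snd (f n)) \<longlonglongrightarrow> snd l"
    using l by (auto intro: tendsto_fst tendsto_snd)
  have f': "fst (f n) \<in> H2" "snd (f n) \<in> H1"
    "(x, w) \<in> G \<Longrightarrow> cinner w (fst (f n)) = cinner x (snd (f n))" for n x w
    using f by (auto simp: adj_def split: prod.splits) (metis prod.collapse)+
  have "fst l \<in> H2" "snd l \<in> H1"
    using closed_sequentially[OF _ _ l1, of H2] closed_sequentially[OF _ _ l2, of H1] H f'
    by (auto simp: closed_csubspace_def)
  moreover have "cinner w (fst l) = cinner x (snd l)" if "(x, w) \<in> G" for x w
  proof -
    have "(\<lambda>n. cinner w (fst (f n))) \<longlonglongrightarrow> cinner w (fst l)" by (intro tendsto_cinner tendsto_const l1)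
    moreover have "(\<lambda>n. cinner x (snd (f n))) \<longlonglongrightarrow> cinner x (snd l)" by (intro tendsto_cinner tendsto_const l2)
    ultimately show ?thesis using f'(3)[OF that] by (simp add: LIMSEQ_unique)
  qed
  ultimately show "l \<in> adj H1 H2 G" by (cases l) (simp add: adj_def)
qed

lemma adj_antimono: "G \<subseteq> G' \<Longrightarrow> adj H1 H2 G' \<subseteq> adj H1 H2 G"
  unfolding adj_def by auto

lemma selfadjoint_maximal:
  "selfadjoint M G \<Longrightarrow> selfadjoint M G' \<Longrightarrow> G \<subseteq> G' \<Longrightarrow> G = G'"
  using adj_antimono[of G G' M M] by (auto simp: selfadjoint_def)

lemma cayley_eq: "cayley S = {(x + y, x - z) |x y z. (x, y) \<in> S \<and> (x, z) \<in> S}"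
proof (rule set_eqI, clarify)
  fix u v
  have "(u, v) \<in> cayley S \<longleftrightarrow> (\<exists>x y z. u = x + y \<and> v = x - z \<and> (x, y) \<in> S \<and> (x, z) \<in> S)"
    unfolding cayley_def relcomp_unfold op_add_def op_diff_def by auto
  then show "(u, v) \<in> cayley S \<longleftrightarrow> (u, v) \<in> {(x + y, x - z) |x y z. (x, y) \<in> S \<and> (x, z) \<in> S}"
    by auto
qed

lemma cayley_graph: "single_valued S \<Longrightarrow> cayley S = {(x + y, x - y) |x y. (x, y) \<in> S}"
  unfolding cayley_eq single_valued_def by blast

lemma cayley_graph_on: "(Id -\<^sub>o graph_on UNIV B) \<circ>\<^sub>o (Id +\<^sub>o graph_on UNIV B)\<inverse> = inv_cayley B"
  by (auto simp: Id_graph_on graph_on_add graph_on_diff graph_on_iff inv_cayley_def relcomp_unfold)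

lemma positive_opD:
  assumes "positive_op M S"
  shows "linear_op S" "(x, y) \<in> S \<Longrightarrow> (x', y') \<in> S \<Longrightarrow> cinner y x' = cinner x y'"
    "(x, y) \<in> S \<Longrightarrow> 0 \<le> Re (cinner y x)" "S \<subseteq> M \<times> M" "M \<subseteq> closure (Domain S)"
  using assms by (auto simp: positive_op_def densely_defined_def symmetric_op_def)

text \<open>In the expanded squares the cross term is non-negative. The first bound makes the range
  of 1 + S closed; the last makes the Cayley transform single-valued and contractive.\<close>

lemma positive_op_norms:
  assumes S: "positive_op M S" and xy: "(x, y) \<in> S"
  shows "norm x \<le> norm (x + y)" "norm y \<le> norm (x + y)" "norm (x - y) \<le> norm (x + y)"
proof -
  have p: "0 \<le> Re (cinner x y)" using positive_opD(3)[OF S xy] Re_cinner_commute by metis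
  show "norm x \<le> norm (x + y)" "norm y \<le> norm (x + y)"
    by (rule power2_le_imp_le; use p in \<open>simp add: norm_add_sq\<close>)+
  show "norm (x - y) \<le> norm (x + y)"
    by (rule power2_le_imp_le; use p in \<open>simp add: norm_add_sq norm_diff_sq\<close>)
qed

lemma Domain_cayley: "Domain (cayley S) = {x + y |x y. (x, y) \<in> S}" if "single_valued S"
  unfolding cayley_graph[OF that] by auto

lemma cayley_symmetric_contraction:
  assumes S: "positive_op UNIV S" and cl: "closed S"
  shows "closed_csubspace (Domain (cayley S))" "contraction (Domain (cayley S)) UNIV (cayley S)"
    "symmetric_op (cayley S)"
proof -
  note l = linear_opD[OF positive_opD(1)[OF S]]
  note D = Domain_cayley[OF l(1)] and G = cayley_graph[OF l(1)]
  let ?D = "Domain (cayley S)"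
  have ls: "csubspace ?D" unfolding csubspace_def D
  proof (safe)
    show "\<exists>x y. 0 = x + y \<and> (x, y) \<in> S" using l(2) by (intro exI[of _ 0]) auto
    show "\<exists>xb yb. x + y + (xa + ya) = xb + yb \<and> (xb, yb) \<in> S"
      if "(x, y) \<in> S" "(xa, ya) \<in> S" for x y xa ya
      using l(3)[OF that] by (intro exI[of _ "x + xa"] exI[of _ "y + ya"]) auto
    show "\<exists>xa ya. c *\<^sub>C (x + y) = xa + ya \<and> (xa, ya) \<in> S" if "(x, y) \<in> S" for c x y
      using l(4)[OF that, of c] by (intro exI[of _ "c *\<^sub>C x"] exI[of _ "c *\<^sub>C y"]) (auto simp: scaleC_add_right)
  qed
  have "closed ?D" unfolding closed_sequential_limits
  proof (intro allI impI, elim conjE)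
    fix w z assume w: "\<forall>n. w n \<in> ?D" and z: "w \<longlonglongrightarrow> z"
    then have "\<forall>n. \<exists>x y. w n = x + y \<and> (x, y) \<in> S" by (auto simp: D)
    then obtain x y where wn: "\<And>n. w n = x n + y n" and xy: "\<And>n. (x n, y n) \<in> S" by metis
    \<comment> \<open>Convergence of \<open>x n + y n\<close> forces convergence of
      \<open>x n\<close>, by the first norm bound applied to differences, and hence of
      \<open>y n\<close>; closedness of \<open>S\<close> then catches the limit.\<close>
    have "Cauchy x"
    proof (rule metric_CauchyI)
      fix e :: real assume "e > 0"
      then obtain N where N: "\<forall>m\<ge>N. \<forall>n\<ge>N. dist (w m) (w n) < e"
        using LIMSEQ_imp_Cauchy[OF z] metric_CauchyD by blast
      have "dist (x m) (x n) \<le> dist (w m) (w n)" for m n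
        using positive_op_norms(1)[OF S l(6)[OF xy[of m] xy[of n]]]
        by (simp add: dist_norm wn algebra_simps)
      then show "\<exists>M. \<forall>m\<ge>M. \<forall>n\<ge>M. dist (x m) (x n) < e"
        using N by (meson le_less_trans)
    qed
    then obtain a where a: "x \<longlonglongrightarrow> a" using Cauchy_convergent convergent_def by blast
    have "y \<longlonglongrightarrow> z - a" using tendsto_diff[OF z a] by (simp add: wn)
    then have "(\<lambda>n. (x n, y n)) \<longlonglongrightarrow> (a, z - a)" using a by (intro tendsto_Pair)
    then have "(a, z - a) \<in> S" using closed_sequentially[OF cl, of "\<lambda>n. (x n, y n)"] xy by blast
    then have "\<exists>x y. z = x + y \<and> (x, y) \<in> S" by (intro exI[of _ a] exI[of _ "z - a"]) simp
    then show "z \<in> ?D" by (simp add: D)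
  qed
  then show "closed_csubspace ?D" using ls by (simp add: closed_csubspace_def)
  have mem: "(x + y, x - y) \<in> cayley S" if "(x, y) \<in> S" for x y using that by (auto simp: G)
  have "linear_op (cayley S)" unfolding linear_op_def
  proof (intro conjI allI impI)
    show "single_valued (cayley S)" unfolding single_valued_def G
    proof (safe)
      fix x y x' y' assume a: "(x, y) \<in> S" "(x', y') \<in> S" and e: "x + y = x' + y'"
      have "norm (x - x' - (y - y')) \<le> norm (x - x' + (y - y'))"
        by (rule positive_op_norms(3)[OF S l(6)[OF a]])
      also have "x - x' + (y - y') = x + y - (x' + y')" by simp
      finally have "x - x' - (y - y') = 0" by (simp only: e) simp
      then show "x - y = x' - y'" by (simp add: algebra_simps)
    qed
    show "(0, 0) \<in> cayley S" using mem[OF l(2)] by simp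
    show "(u + u', v + v') \<in> cayley S" if uv: "(u, v) \<in> cayley S" "(u', v') \<in> cayley S" for u v u' v'
    proof -
      obtain x y x' y' where "u = x + y" "v = x - y" "(x, y) \<in> S" "u' = x' + y'" "v' = x' - y'" "(x', y') \<in> S"
        using uv unfolding G by blast
      moreover from this have "u + u' = (x + x') + (y + y')" "v + v' = (x + x') - (y + y')" by simp_all
      ultimately show ?thesis using mem[OF l(3), of x y x' y'] by (simp only:)
    qed
    show "(c *\<^sub>C u, c *\<^sub>C v) \<in> cayley S" if uv: "(u, v) \<in> cayley S" for c u v
    proof -
      obtain x y where "u = x + y" "v = x - y" "(x, y) \<in> S" using uv unfolding G by blast
      then show ?thesis using mem[OF l(4), of x y c] by (simp add: scaleC_add_right scaleC_diff_right)
    qed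
  qed
  moreover have "norm v \<le> norm u" if "(u, v) \<in> cayley S" for u v
    using that positive_op_norms(3)[OF S] by (auto simp: G)
  ultimately show "contraction ?D UNIV (cayley S)" by (auto simp: contraction_def)
  show "symmetric_op (cayley S)" unfolding symmetric_op_def
  proof (intro allI impI)
    fix u v u' v' assume "(u, v) \<in> cayley S" "(u', v') \<in> cayley S"
    then obtain x y x' y' where "u = x + y" "v = x - y" "(x, y) \<in> S" "u' = x' + y'" "v' = x' - y'" "(x', y') \<in> S"
      unfolding G by blast
    then show "cinner v u' = cinner u v'" by (simp add: cinner_simps positive_opD(2)[OF S])
  qed
qed

text \<open>These are exactly the Cayley transforms of the positive selfadjoint operators on the
  whole space. Injectivity of 1 + B makes \<open>inv_cayley B\<close> single-valued and, as B is
  hermitian, densely defined.\<close>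

definition is_cayley_transform :: "('a::chilbert_space \<Rightarrow> 'a) \<Rightarrow> bool" where
  "is_cayley_transform B \<longleftrightarrow> hermitian B \<and> contractive B \<and> (\<forall>v. v + B v = 0 \<longrightarrow> v = 0)"

lemma is_cayley_transformD:
  assumes "is_cayley_transform B"
  shows "hermitian B" "contractive B" "v + B v = 0 \<Longrightarrow> v = 0"
  using assms unfolding is_cayley_transform_def by blast+

text \<open>At the parameter \<open>v\<close> the form is the squared norm of \<open>v\<close> minus
  that of \<open>B v\<close>, hence non-negative. A pair in the adjoint, tested on all
  \<open>v\<close>, satisfies the equation of \<open>inv_cayley_iff\<close>, so the adjoint is no
  larger than the operator.\<close>

lemma inv_cayley_pos_sa:
  assumes B: "is_cayley_transform B"
  shows "positive_selfadjoint UNIV (inv_cayley B)"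
proof -
  note h = is_cayley_transformD(1)[OF B] and c = is_cayley_transformD(2)[OF B] and inj = is_cayley_transformD(3)[OF B]
  note l = clinearD[OF adjoint_pair_clinear[OF h]] and iff = inv_cayley_iff[OF adjoint_pair_clinear[OF h]]
  have lin: "linear_op (inv_cayley B)"
    unfolding linear_op_def iff
  proof (intro conjI allI impI)
    show "single_valued (inv_cayley B)" unfolding single_valued_def iff
    proof (intro allI impI)
      fix x y z assume "B (x + y) = x - y" "B (x + z) = x - z"
      then have "B ((x + y) - (x + z)) = (x - y) - (x - z)" by (simp only: l)
      then have "(y - z) + B (y - z) = 0" by simp
      then have "y - z = 0" by (rule inj)
      then show "y = z" by simp
    qed
    show "B (x + x' + (y + y')) = x + x' - (y + y')" if "B (x + y) = x - y" "B (x' + y') = x' - y'" for x y x' y'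
    proof -
      have "B ((x + y) + (x' + y')) = (x - y) + (x' - y')" by (simp only: l(1)[of "x + y"] that)
      moreover have "(x + y) + (x' + y') = x + x' + (y + y')" "(x - y) + (x' - y') = x + x' - (y + y')"
        by simp_all
      ultimately show ?thesis by (simp only:)
    qed
    show "B (a *\<^sub>C x + a *\<^sub>C y) = a *\<^sub>C x - a *\<^sub>C y" if "B (x + y) = x - y" for a x y
      by (simp only: scaleC_add_right[symmetric] scaleC_diff_right[symmetric] l(2) that)
  qed (simp add: l)
  have hB: "cinner (B v) w = cinner v (B w)" for v w by (rule adjoint_pairD[OF h])
  have sym: "symmetric_op (inv_cayley B)" unfolding symmetric_op_def inv_cayley_def
    by (auto simp: cinner_simps hB)
  have rng: "Domain (inv_cayley B) = range (\<lambda>v. v + B v)" by (auto simp: inv_cayley_def)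
  \<comment> \<open>The complement of the range of the hermitian operator 1 + B is its
    kernel.\<close>
  have "closure (range (\<lambda>v. v + B v)) = UNIV"
  proof (rule dense_iff_orth)
    show "csubspace (range (\<lambda>v. v + B v))" by (rule csubspace_range) (simp add: clinear_def l scaleC_add_right)
    fix x assume "x \<in> orth (range (\<lambda>v. v + B v))"
    then have "cinner x (v + B v) = 0" for v by (auto simp: orth_def)
    then have "cinner (x + B x) v = cinner 0 v" for v by (simp add: cinner_simps hB)
    then have "x + B x = 0" by (rule cinner_eqI)
    then show "x = 0" by (rule inj)
  qed
  then have dd: "densely_defined UNIV (inv_cayley B)" unfolding densely_defined_def using lin rng by simp
  have "positive_op UNIV (inv_cayley B)" unfolding positive_op_def
  proof (intro conjI allI impI dd sym)
    fix x y assume "(x, y) \<in> inv_cayley B"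
    then obtain v where v: "x = v + B v" "y = v - B v" by (auto simp: inv_cayley_def)
    have "Re (cinner y x) = (norm v)\<^sup>2 - (norm (B v))\<^sup>2"
      unfolding v by (simp add: cinner_simps Re_cinner_commute[of "B v" v])
    also have "\<dots> \<ge> 0" using power_mono[OF contractiveD[OF c, of v], of 2] by simp
    finally show "0 \<le> Re (cinner y x)" .
  qed
  moreover have "adj UNIV UNIV (inv_cayley B) = inv_cayley B"
  proof (rule set_eqI, clarify)
    fix y z
    have "B (y + z) = y - z" if "\<And>x w. (x, w) \<in> inv_cayley B \<Longrightarrow> cinner w y = cinner x z"
    proof -
      have "cinner (v - B v) y = cinner (v + B v) z" for v by (rule that) (auto simp: inv_cayley_def)
      then have "cinner (y - B y) v = cinner (z + B z) v" for v
        by (simp add: cinner_simps hB) (metis cinner_commute complex_cnj_add complex_cnj_diff hB)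
      then have "y - B y = z + B z" by (rule cinner_eqI)
      then show ?thesis by (simp add: l algebra_simps)
    qed
    then show "(y, z) \<in> adj UNIV UNIV (inv_cayley B) \<longleftrightarrow> (y, z) \<in> inv_cayley B"
      using sym unfolding adj_def symmetric_op_def by (auto simp: iff)
  qed
  ultimately show ?thesis using dd by (simp add: positive_selfadjoint_def selfadjoint_def)
qed

lemma cayley_hermitian_repr:
  assumes S: "positive_op UNIV S" and cl: "closed S"
  obtains t where "clinear t" "contractive t" "\<And>x. t (proj (Domain (cayley S)) x) = t x"
    "cayley S = graph_on (Domain (cayley S)) t"
  using contraction_repr[OF cayley_symmetric_contraction(2,1)[OF S cl]] by metis

text \<open>Selfadjointness enters only in showing that 1 + R is onto: a vector \<open>z\<close>
  orthogonal to its range belongs to the domain of the adjoint, with R z = - z, and positivity then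
  gives \<open>z = 0\<close>. Since the range is closed, the Cayley transform is everywhere
  defined.\<close>

lemma pos_sa_inv_cayley:
  assumes R: "positive_selfadjoint UNIV R"
  obtains B where "is_cayley_transform B" "R = inv_cayley B"
proof -
  have P: "positive_op UNIV R" and A: "adj UNIV UNIV R = R"
    using R by (auto simp: positive_selfadjoint_def selfadjoint_def)
  have cl: "closed R" using closed_adj[OF closed_csubspace_UNIV closed_csubspace_UNIV, of R] by (simp add: A)
  note l = linear_opD[OF positive_opD(1)[OF P]]
  note D = Domain_cayley[OF l(1)] and G = cayley_graph[OF l(1)]
  note C = cayley_symmetric_contraction[OF P cl]
  have "closure (Domain (cayley R)) = UNIV"
  proof (rule dense_iff_orth[OF closed_csubspace_csubspace[OF C(1)]])
    fix z assume z: "z \<in> orth (Domain (cayley R))"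
    have "cinner w z = cinner x (- z)" if "(x, w) \<in> R" for x w
    proof -
      have "cinner (x + w) z = 0" using orthD(2)[OF z] that D by blast
      then show ?thesis by (simp add: cinner_simps add_eq_0_iff2 add.commute)
    qed
    then have "(z, - z) \<in> R" by (subst A[symmetric]) (simp add: adj_def)
    from positive_opD(3)[OF P this] show "z = 0" by (simp add: cinner_simps)
  qed
  then have DU: "Domain (cayley R) = UNIV" using C(1) by (simp add: closed_csubspace_def)
  obtain B where B: "clinear B" "contractive B" "cayley R = graph_on UNIV B"
    using cayley_hermitian_repr[OF P cl] DU by metis
  show thesis
  proof (rule that)
    have "hermitian B" using C(3) unfolding symmetric_op_def adjoint_pair_def B(3) by (auto simp: graph_on_iff)
    have iff: "(x, y) \<in> R \<longleftrightarrow> B (x + y) = x - y" for x y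
    proof
      assume "(x, y) \<in> R"
      then have "(x + y, x - y) \<in> cayley R" using G by blast
      then show "B (x + y) = x - y" by (simp add: B(3) graph_on_iff)
    next
      assume "B (x + y) = x - y"
      then have "(x + y, x - y) \<in> cayley R" by (simp add: B(3) graph_on_iff)
      then obtain x' y' where *: "x + y = x' + y'" "x - y = x' - y'" "(x', y') \<in> R" by (auto simp: G)
      have "(x + y) + (x - y) = (x' + y') + (x' - y')" by (simp only: *)
      then have "2 *\<^sub>R x = 2 *\<^sub>R x'" by (simp add: scaleR_2)
      then show "(x, y) \<in> R" using * by simp
    qed
    show "R = inv_cayley B" by (rule set_eqI) (auto simp: iff inv_cayley_iff[OF B(1)])
    \<comment> \<open>The equation puts \<open>(0, v)\<close> into the graph of \<open>R\<close>,
      which is single-valued.\<close>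
    have "v = 0" if "v + B v = 0" for v
    proof -
      have "(0, v) \<in> R" unfolding iff using that by (simp add: eq_neg_iff_add_eq_0 add.commute)
      then show "v = 0" using l(7)[OF l(2)] by metis
    qed
    then show "is_cayley_transform B" using \<open>hermitian B\<close> B(2) unfolding is_cayley_transform_def by blast
  qed
qed

text \<open>If \<open>s\<close> is injective, this is the graph of \<open>r s\<inverse>\<close>.\<close>

definition quotient_graph :: "('a::chilbert_space \<Rightarrow> 'a) \<Rightarrow> ('a \<Rightarrow> 'a) \<Rightarrow> 'a rel" where
  "quotient_graph s r = {(s v, r v) |v. True}"

section \<open>Square roots of unbounded positive selfadjoint operators, and the form order\<close>

definition half_sum_sqrt :: "('a::chilbert_space \<Rightarrow> 'a) \<Rightarrow> 'a \<Rightarrow> 'a" where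
  "half_sum_sqrt B = bounded_sqrt (\<lambda>x. (1/2) *\<^sub>R (x + B x))"

definition half_diff_sqrt :: "('a::chilbert_space \<Rightarrow> 'a) \<Rightarrow> 'a \<Rightarrow> 'a" where
  "half_diff_sqrt B = bounded_sqrt (\<lambda>x. (1/2) *\<^sub>R (x - B x))"

lemma unit_interval_half:
  assumes h: "hermitian B" and c: "contractive B"
  shows "unit_interval_op (\<lambda>x. (1/2) *\<^sub>R (x + B x))" "unit_interval_op (\<lambda>x. (1/2) *\<^sub>R (x - B x))"
proof -
  have b: "\<bar>Re (cinner (B x) x)\<bar> \<le> (norm x)\<^sup>2" for x
    using norm_cinner_le[of "B x" x] mult_right_mono[OF contractiveD[OF c, of x] norm_ge_zero[of x]]
      abs_Re_le_cmod[of "cinner (B x) x"] by (simp add: power2_eq_square)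
  show "unit_interval_op (\<lambda>x. (1/2) *\<^sub>R (x + B x))" "unit_interval_op (\<lambda>x. (1/2) *\<^sub>R (x - B x))"
    unfolding unit_interval_op_def
    using b by (auto simp: adjoint_pair_def cinner_simps adjoint_pairD[OF h] abs_le_iff) (smt (verit))+
qed

text \<open>The two roots commute by applying the commutation property twice: B commutes with (1 +
  B)/2, hence with its root; that root therefore commutes with (1 - B)/2, hence with the other
  root.\<close>

lemma half_sqrts:
  assumes h: "hermitian B" and c: "contractive B"
  shows "hermitian (half_sum_sqrt B)" "hermitian (half_diff_sqrt B)" "half_sum_sqrt B (half_sum_sqrt B x) = (1/2) *\<^sub>R (x + B x)"
    "half_diff_sqrt B (half_diff_sqrt B x) = (1/2) *\<^sub>R (x - B x)" "half_sum_sqrt B (half_diff_sqrt B x) = half_diff_sqrt B (half_sum_sqrt B x)"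
    "0 \<le> Re (cinner (half_sum_sqrt B x) x)" "0 \<le> Re (cinner (half_diff_sqrt B x) x)"
    "half_sum_sqrt B (half_sum_sqrt B x) + half_diff_sqrt B (half_diff_sqrt B x) = x"
    "(norm (half_sum_sqrt B x))\<^sup>2 + (norm (half_diff_sqrt B x))\<^sup>2 = (norm x)\<^sup>2"
proof -
  note u = unit_interval_half[OF h c]
  note l = clinearD[OF adjoint_pair_clinear[OF h]]
  note s = bounded_sqrtD[OF u(1), folded half_sum_sqrt_def] and r = bounded_sqrtD[OF u(2), folded half_diff_sqrt_def]
  note ls = clinearD[OF adjoint_pair_clinear[OF s(1)]]
  show "hermitian (half_sum_sqrt B)" "hermitian (half_diff_sqrt B)" "0 \<le> Re (cinner (half_sum_sqrt B x) x)" "0 \<le> Re (cinner (half_diff_sqrt B x) x)"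
    by (fact s r)+
  show 1: "half_sum_sqrt B (half_sum_sqrt B x) = (1/2) *\<^sub>R (x + B x)" and 2: "half_diff_sqrt B (half_diff_sqrt B x) = (1/2) *\<^sub>R (x - B x)" for x
    by (fact s(3) r(3))+
  show 3: "half_sum_sqrt B (half_sum_sqrt B x) + half_diff_sqrt B (half_diff_sqrt B x) = x" for x
    unfolding 1 2 by (simp add: algebra_simps) (simp add: scaleR_add_left[symmetric])
  have "B (half_sum_sqrt B x) = half_sum_sqrt B (B x)" for x by (rule s(4)[OF h]) (simp add: l)
  then show "half_sum_sqrt B (half_diff_sqrt B x) = half_diff_sqrt B (half_sum_sqrt B x)"
    by (intro r(4) s(1)) (simp add: ls)
  show "(norm (half_sum_sqrt B x))\<^sup>2 + (norm (half_diff_sqrt B x))\<^sup>2 = (norm x)\<^sup>2"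
    by (simp add: half_sum_sqrt_def half_diff_sqrt_def bounded_sqrt_norm[OF u(1)] bounded_sqrt_norm[OF u(2)] cinner_simps add_divide_distrib[symmetric])
qed

lemma hermitian_dense_range:
  assumes s: "hermitian s" and inj: "\<forall>v. s v = 0 \<longrightarrow> v = 0"
  shows "closure (range s) = UNIV"
proof (rule dense_iff_orth[OF csubspace_range[OF adjoint_pair_clinear[OF s]]])
  fix x assume "x \<in> orth (range s)"
  then have "cinner (s x) v = cinner 0 v" for v by (simp add: orth_def adjoint_pairD[OF s])
  then have "s x = 0" by (rule cinner_eqI)
  then show "x = 0" using inj by blast
qed

lemma quotient_graph_pos_sa:
  assumes s: "hermitian s" and r: "hermitian r" and sr: "\<And>x. s (r x) = r (s x)"
    and one: "\<And>x. s (s x) + r (r x) = x" and inj: "\<forall>v. s v = 0 \<longrightarrow> v = 0"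
    and pos: "\<And>x. 0 \<le> Re (cinner (r x) (s x))"
  shows "positive_selfadjoint UNIV (quotient_graph s r)"
proof -
  note ls = clinearD[OF adjoint_pair_clinear[OF s]] and lr = clinearD[OF adjoint_pair_clinear[OF r]]
  note hs = adjoint_pairD[OF s] and hr = adjoint_pairD[OF r]
  have sinj: "v = w" if "s v = s w" for v w using spec[OF inj, of "v - w"] that by (simp add: ls)
  have lin: "linear_op (quotient_graph s r)" unfolding linear_op_def
  proof (intro conjI allI impI)
    show "single_valued (quotient_graph s r)" by (auto simp: single_valued_def quotient_graph_def dest: sinj)
    show "(0, 0) \<in> quotient_graph s r" unfolding quotient_graph_def using ls(3) lr(3) by force
    show "(x + x', y + y') \<in> quotient_graph s r" if xy: "(x, y) \<in> quotient_graph s r" "(x', y') \<in> quotient_graph s r" for x y x' y'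
    proof -
      obtain v w where "x = s v" "y = r v" "x' = s w" "y' = r w" using xy unfolding quotient_graph_def by blast
      then have "x + x' = s (v + w)" "y + y' = r (v + w)" by (simp_all add: ls lr)
      then show ?thesis unfolding quotient_graph_def by blast
    qed
    show "(c *\<^sub>C x, c *\<^sub>C y) \<in> quotient_graph s r" if xy: "(x, y) \<in> quotient_graph s r" for c x y
    proof -
      obtain v where "x = s v" "y = r v" using xy unfolding quotient_graph_def by blast
      then have "c *\<^sub>C x = s (c *\<^sub>C v)" "c *\<^sub>C y = r (c *\<^sub>C v)" by (simp_all add: ls lr)
      then show ?thesis unfolding quotient_graph_def by blast
    qed
  qed
  have "Domain (quotient_graph s r) = range s" by (auto simp: quotient_graph_def)
  then have dd: "densely_defined UNIV (quotient_graph s r)"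
    unfolding densely_defined_def using lin hermitian_dense_range[OF s inj] by simp
  have sym: "symmetric_op (quotient_graph s r)"
    unfolding symmetric_op_def quotient_graph_def by (auto simp: hs hr sr)
  have "positive_op UNIV (quotient_graph s r)"
    unfolding positive_op_def using dd sym pos by (auto simp: quotient_graph_def)
  moreover have "adj UNIV UNIV (quotient_graph s r) = quotient_graph s r"
  proof
    show "quotient_graph s r \<subseteq> adj UNIV UNIV (quotient_graph s r)"
      using sym unfolding adj_def symmetric_op_def by auto
    show "adj UNIV UNIV (quotient_graph s r) \<subseteq> quotient_graph s r"
    proof clarify
      fix y z assume "(y, z) \<in> adj UNIV UNIV (quotient_graph s r)"
      then have "cinner (r v) y = cinner (s v) z" for v by (auto simp: adj_def quotient_graph_def)
      then have "cinner (r y) v = cinner (s z) v" for v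
        by (metis hs hr cinner_commute)
      then have e: "r y = s z" by (rule cinner_eqI)
      \<comment> \<open>The parameter of \<open>(y, z)\<close> is \<open>s y + r z\<close>: as
        \<open>r y = s z\<close>, the relation s s + r r = 1 gives back \<open>y\<close> under
        \<open>s\<close> and \<open>z\<close> under \<open>r\<close>.\<close>
      have "s (s y + r z) = s (s y) + r (s z)" "r (s y + r z) = s (r y) + r (r z)"
        by (simp_all add: ls lr sr)
      then have "y = s (s y + r z)" "z = r (s y + r z)"
        using one[of y] one[of z] by (simp_all add: e)
      then show "(y, z) \<in> quotient_graph s r" unfolding quotient_graph_def by blast
    qed
  qed
  ultimately show ?thesis using dd by (simp add: positive_selfadjoint_def selfadjoint_def)
qed

text \<open>The product of two commuting positive operators is positive. Writing \<open>s\<close> as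
  the square of its root, which commutes with \<open>r\<close>, turns the expression into the form
  of \<open>r\<close> at the root applied to \<open>x\<close>.\<close>

lemma cinner_comm_pos:
  assumes s: "hermitian s" "\<And>x. 0 \<le> Re (cinner (s x) x)" "\<And>x. Re (cinner (s x) x) \<le> (norm x)\<^sup>2"
    and r: "hermitian r" "\<And>x. 0 \<le> Re (cinner (r x) x)" and sr: "\<And>x. s (r x) = r (s x)"
  shows "0 \<le> Re (cinner (r x) (s x))"
proof -
  have u: "unit_interval_op s" using s by (simp add: unit_interval_op_def)
  note t = bounded_sqrtD[OF u]
  have "cinner (r x) (s x) = cinner (r x) (bounded_sqrt s (bounded_sqrt s x))" by (simp add: t(3))
  also have "\<dots> = cinner (bounded_sqrt s (r x)) (bounded_sqrt s x)" by (simp add: adjoint_pairD[OF t(1)])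
  also have "bounded_sqrt s (r x) = r (bounded_sqrt s x)" using t(4)[OF r(1), of x] sr by simp
  finally show ?thesis using r(2) by simp
qed

lemma contractive_form_le: "contractive s \<Longrightarrow> Re (cinner (s x) x) \<le> (norm x)\<^sup>2"
  using Re_cinner_le[of "s x" x] mult_right_mono[OF contractiveD[of s x] norm_ge_zero[of x]]
  by (simp add: power2_eq_square)

lemma contractive_half_sqrts: "hermitian B \<Longrightarrow> contractive B \<Longrightarrow> contractive (half_sum_sqrt B)" "hermitian B \<Longrightarrow> contractive B \<Longrightarrow> contractive (half_diff_sqrt B)"
  unfolding contractive_def using half_sqrts(9)[of B, unfolded contractive_def]
  by (metis le_add_same_cancel1 le_add_same_cancel2 norm_ge_zero power2_le_imp_le zero_le_power2)+

lemma sqrt_quotient_graph_pos_sa: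
  assumes B: "is_cayley_transform B"
  shows "positive_selfadjoint UNIV (quotient_graph (half_sum_sqrt B) (half_diff_sqrt B))"
    and "\<forall>v. half_sum_sqrt B v = 0 \<longrightarrow> v = 0"
proof -
  note h = is_cayley_transformD(1)[OF B] and c = is_cayley_transformD(2)[OF B] and inj = is_cayley_transformD(3)[OF B]
  note sr = half_sqrts[OF h c]
  have "v = 0" if "half_sum_sqrt B v = 0" for v
    using inj[of v] sr(3)[of v] that by (simp add: clinearD[OF adjoint_pair_clinear[OF sr(1)]])
  then show i: "\<forall>v. half_sum_sqrt B v = 0 \<longrightarrow> v = 0" by blast
  have "0 \<le> Re (cinner (half_diff_sqrt B x) (half_sum_sqrt B x))" for x
    by (rule cinner_comm_pos[OF sr(1,6) contractive_form_le[OF contractive_half_sqrts(1)[OF h c]] sr(2,7,5)])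
  from quotient_graph_pos_sa[OF sr(1,2,5,8) i this]
  show "positive_selfadjoint UNIV (quotient_graph (half_sum_sqrt B) (half_diff_sqrt B))" .
qed

lemma quotient_graph_squared:
  assumes h: "hermitian B" and c: "contractive B"
  shows "quotient_graph (half_sum_sqrt B) (half_diff_sqrt B) \<circ>\<^sub>o quotient_graph (half_sum_sqrt B) (half_diff_sqrt B) = inv_cayley B"
proof -
  let ?s = "half_sum_sqrt B" and ?r = "half_diff_sqrt B"
  note sr = half_sqrts[OF h c]
  note ls = clinearD[OF adjoint_pair_clinear[OF sr(1)]] and lr = clinearD[OF adjoint_pair_clinear[OF sr(2)]]
  have iff: "(x, z) \<in> quotient_graph ?s ?r \<circ>\<^sub>o quotient_graph ?s ?r \<longleftrightarrow> (\<exists>v w. x = ?s v \<and> ?r v = ?s w \<and> z = ?r w)" for x z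
    unfolding quotient_graph_def relcomp_unfold by blast
  show ?thesis
  proof (rule set_eqI, clarify)
    fix x z
    show "(x, z) \<in> quotient_graph ?s ?r \<circ>\<^sub>o quotient_graph ?s ?r \<longleftrightarrow> (x, z) \<in> inv_cayley B"
    proof
      assume "(x, z) \<in> quotient_graph ?s ?r \<circ>\<^sub>o quotient_graph ?s ?r"
      then obtain v w where vw: "x = ?s v" "?r v = ?s w" "z = ?r w" unfolding iff by blast
      \<comment> \<open>A common preimage: since \<open>?r v = ?s w\<close>, commutation and s s + r
        r = 1 give \<open>?s t = v\<close> and \<open>?r t = w\<close>. It replaces the formal
        cancellation of inverses.\<close>
      define t where "t = ?s v + ?r w"
      have "?s t = v" using sr(8)[of v] by (simp add: t_def ls sr(5) vw(2)[symmetric])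
      moreover have "?r t = w" using sr(8)[of w] by (simp add: t_def lr sr(5)[symmetric] vw(2))
      ultimately have "x = ?s (?s t)" "z = ?r (?r t)" using vw by simp_all
      then have "x = (1/2) *\<^sub>R t + B ((1/2) *\<^sub>R t)" "z = (1/2) *\<^sub>R t - B ((1/2) *\<^sub>R t)"
        unfolding sr(3,4) by (simp_all add: clinearD[OF adjoint_pair_clinear[OF h]] algebra_simps)
      then show "(x, z) \<in> inv_cayley B" unfolding inv_cayley_def by blast
    next
      assume "(x, z) \<in> inv_cayley B"
      then obtain v where v: "x = v + B v" "z = v - B v" by (auto simp: inv_cayley_def)
      have "x = ?s (?s (2 *\<^sub>R v))" "z = ?r (?r (2 *\<^sub>R v))"
        unfolding sr(3,4) v by (simp_all add: clinearD[OF adjoint_pair_clinear[OF h]] scaleR_right_distrib scaleR_right_diff_distrib)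
      then show "(x, z) \<in> quotient_graph ?s ?r \<circ>\<^sub>o quotient_graph ?s ?r" unfolding iff using sr(5)[of "2 *\<^sub>R v"] by metis
    qed
  qed
qed

text \<open>With \<open>X = (1 + Q\<^sup>2)\<inverse>\<close>, the bounded operator \<open>Z = Q X\<close> is positive and
  \<open>Z\<^sup>2 = X (1 - X)\<close>, hence \<open>Z = s r\<close>. This determines \<open>Q\<close> on the range of \<open>X\<close>, and then
  everywhere because \<open>Q\<close> is closed and selfadjoint operators are maximal.\<close>
lemma pos_sqrt_unique:
  assumes B: "is_cayley_transform B"
    and Q: "positive_selfadjoint UNIV Q" and QQ: "Q \<circ>\<^sub>o Q = inv_cayley B"
  shows "Q = quotient_graph (half_sum_sqrt B) (half_diff_sqrt B)"
proof -
  note h = is_cayley_transformD(1)[OF B] and c = is_cayley_transformD(2)[OF B]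
  let ?s = "half_sum_sqrt B" and ?r = "half_diff_sqrt B"
  note sr = half_sqrts[OF h c]
  note ls = clinearD[OF adjoint_pair_clinear[OF sr(1)]] and lr = clinearD[OF adjoint_pair_clinear[OF sr(2)]]
  note lB = clinearD[OF adjoint_pair_clinear[OF h]]
  have P: "positive_op UNIV Q" and A: "adj UNIV UNIV Q = Q" and saQ: "selfadjoint UNIV Q"
    using Q by (auto simp: positive_selfadjoint_def selfadjoint_def)
  note l = linear_opD[OF positive_opD(1)[OF P]] and sym = positive_opD(2)[OF P] and pos = positive_opD(3)[OF P]
  define X where "X v = (1/2) *\<^sub>R (v + B v)" for v
  have half: "2 *\<^sub>R x = w \<longleftrightarrow> x = (1/2) *\<^sub>R w" for x w :: 'a by auto
  have iff: "(x, y) \<in> inv_cayley B \<longleftrightarrow> x = X (x + y)" for x y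
  proof -
    have "(x, y) \<in> inv_cayley B \<longleftrightarrow> B (x + y) = x - y" by (rule inv_cayley_iff[OF adjoint_pair_clinear[OF h]])
    also have "\<dots> \<longleftrightarrow> 2 *\<^sub>R x = (x + y) + B (x + y)" by (auto simp: scaleR_2 algebra_simps)
    also have "\<dots> \<longleftrightarrow> x = X (x + y)" unfolding X_def by (rule half)
    finally show ?thesis .
  qed
  have "\<exists>q. (X v, q) \<in> Q \<and> (q, v - X v) \<in> Q" for v
  proof -
    have "(X v, v - X v) \<in> Q \<circ>\<^sub>o Q" unfolding QQ iff by simp
    then show ?thesis by auto
  qed
  then obtain Z where Z: "\<And>v. (X v, Z v) \<in> Q" "\<And>v. (Z v, v - X v) \<in> Q" by metis
  define b where "b v = X (v - X v)" for v
  have bsr: "b v = ?s (?r (?s (?r v)))" for v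
  proof -
    have "?s (?r (?s (?r v))) = ?s (?s (?r (?r v)))" by (simp add: sr(5))
    also have "\<dots> = X (v - X v)" unfolding sr(4)
      unfolding X_def sr(3) by (simp add: lB algebra_simps) (simp add: scaleR_add_left[symmetric])
    finally show ?thesis by (simp add: b_def)
  qed
  have hsr: "hermitian (\<lambda>v. ?s (?r v))" unfolding adjoint_pair_def
    by (simp add: adjoint_pairD[OF sr(1)] adjoint_pairD[OF sr(2)] sr(5))
  have csr: "norm (?s (?r v)) \<le> norm v" for v
    using contractiveD[OF contractive_half_sqrts(1)[OF h c], of "?r v"] contractiveD[OF contractive_half_sqrts(2)[OF h c], of v] by linarith
  have sqsr: "sqrt_of (\<lambda>v. ?s (?r v)) b" unfolding sqrt_of_def
  proof (intro conjI allI hsr)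
    show "0 \<le> Re (cinner (?s (?r v)) v)" for v
      using cinner_comm_pos[OF sr(1,6) contractive_form_le[OF contractive_half_sqrts(1)[OF h c]] sr(2,7,5), of v]
      by (simp add: adjoint_pairD[OF sr(1)])
  qed (simp add: bsr)
  have ub: "unit_interval_op b" unfolding unit_interval_op_def
  proof (intro conjI allI)
    have "cinner (b v) w = cinner (?s (?r v)) (?s (?r w))" for v w
      unfolding bsr by (rule adjoint_pairD[OF hsr])
    then have eq: "cinner (b v) v = of_real ((norm (?s (?r v)))\<^sup>2)" for v by (simp add: cinner_self)
    show "hermitian b" unfolding bsr[abs_def] adjoint_pair_def by (metis adjoint_pairD[OF hsr])
    show "0 \<le> Re (cinner (b v) v)" "Re (cinner (b v) v) \<le> (norm v)\<^sup>2" for v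
      unfolding eq using power_mono[OF csr[of v], of 2] by simp_all
  qed
  have "sqrt_of Z b" unfolding sqrt_of_def adjoint_pair_def
  proof (intro conjI allI)
    show "cinner (Z v) w = cinner v (Z w)" for v w
    proof -
      have "cinner (Z v) (X w) = cinner (X v) (Z w)" by (rule sym[OF Z(1) Z(1)])
      moreover have "cinner (Z v) (w - X w) = cinner (v - X v) (Z w)"
        by (rule sym[OF Z(2) Z(2), symmetric])
      ultimately have "cinner (Z v) (X w + (w - X w)) = cinner (X v + (v - X v)) (Z w)"
        by (simp only: cinner_add_left cinner_add_right)
      then show ?thesis by simp
    qed
    show "0 \<le> Re (cinner (Z v) v)" for v
    proof -
      have "0 \<le> Re (cinner (Z v) (X v))" "0 \<le> Re (cinner (v - X v) (Z v))"
        using pos[OF Z(1)] pos[OF Z(2)] by auto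
      then have "0 \<le> Re (cinner (Z v) (X v + (v - X v)))"
        using Re_cinner_commute[of "v - X v" "Z v"] by (simp only: cinner_add_right plus_complex.sel)
      then show ?thesis by simp
    qed
    show "Z (Z v) = b v" for v
    proof -
      define q where "q = Z v"
      \<comment> \<open>This pair and the next one compose to an element of Q Q with first entry
        \<open>Z q\<close> and sum of entries \<open>v - X v\<close>; by \<open>iff\<close>,
        \<open>Z q\<close> is then \<open>X (v - X v)\<close>.\<close>
      have "(q - X q, v - X v - Z q) \<in> Q" unfolding q_def by (rule l(6)[OF Z(2) Z(1)])
      moreover have "(Z q, q - X q) \<in> Q" by (rule Z(2))
      ultimately have "(Z q, v - X v - Z q) \<in> inv_cayley B" using QQ by auto
      then show ?thesis unfolding iff b_def q_def by simp
    qed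
  qed
  then have Zsr: "Z = (\<lambda>v. ?s (?r v))" using sqrt_of_unique[OF ub] sqsr by metis
  have base: "(?s (?s v), ?r (?s v)) \<in> Q" for v
    using Z(1)[of v] by (simp add: Zsr X_def sr(3)[symmetric] sr(5))
  have cl: "closed Q" using closed_adj[OF closed_csubspace_UNIV closed_csubspace_UNIV, of Q] by (simp add: A)
  note i = sqrt_quotient_graph_pos_sa(2)[OF B]
  have "(?s v, ?r v) \<in> Q" for v
  proof -
    have "v \<in> closure (range ?s)" using hermitian_dense_range[OF sr(1) i] by simp
    then obtain f where f: "\<And>n. f n \<in> range ?s" "f \<longlonglongrightarrow> v" unfolding closure_sequential by blast
    have "(\<lambda>n. (?s (f n), ?r (f n))) \<longlonglongrightarrow> (?s v, ?r v)"
      by (rule tendsto_Pair[OF contractive_tendsto[OF adjoint_pair_clinear[OF sr(1)] contractive_half_sqrts(1)[OF h c] f(2)]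
          contractive_tendsto[OF adjoint_pair_clinear[OF sr(2)] contractive_half_sqrts(2)[OF h c] f(2)]])
    then show ?thesis
    proof (rule closed_sequentially[OF cl, rotated])
      show "(?s (f n), ?r (f n)) \<in> Q" for n using f(1)[of n] base by auto
    qed
  qed
  then have "quotient_graph ?s ?r \<subseteq> Q" by (auto simp: quotient_graph_def)
  then show ?thesis
    using selfadjoint_maximal[OF _ saQ] sqrt_quotient_graph_pos_sa(1)[OF B] by (auto simp: positive_selfadjoint_def)
qed

lemma op_sqrt_inv_cayley:
  assumes B: "is_cayley_transform B"
  shows "op_sqrt UNIV (inv_cayley B) = quotient_graph (half_sum_sqrt B) (half_diff_sqrt B)"
  unfolding op_sqrt_def
proof (rule the_equality)
  show "positive_selfadjoint UNIV (quotient_graph (half_sum_sqrt B) (half_diff_sqrt B)) \<and>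
    quotient_graph (half_sum_sqrt B) (half_diff_sqrt B) \<circ>\<^sub>o quotient_graph (half_sum_sqrt B) (half_diff_sqrt B) = inv_cayley B"
    using sqrt_quotient_graph_pos_sa(1)[OF B] quotient_graph_squared[OF is_cayley_transformD(1,2)[OF B]] by simp
qed (use pos_sqrt_unique[OF B] in blast)

text \<open>Squared norms of s x and r x add up to that of x. For s2 v = s1 w, the bound of r1 w by
  r2 v therefore means that w is no longer than v. So the form order amounts to a factorization of
  s2 through s1 by a contraction, which is the comparison of the norms of s1 x and s2 x.\<close>

lemma form_le_inv_cayley:
  assumes B1: "is_cayley_transform B1" and B2: "is_cayley_transform B2"
  shows "form_le (inv_cayley B1) (inv_cayley B2) \<longleftrightarrow> (\<forall>x. Re (cinner (B2 x) x) \<le> Re (cinner (B1 x) x))"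
proof -
  note h1 = is_cayley_transformD(1)[OF B1] and c1 = is_cayley_transformD(2)[OF B1]
  note h2 = is_cayley_transformD(1)[OF B2] and c2 = is_cayley_transformD(2)[OF B2]
  let ?s1 = "half_sum_sqrt B1" and ?r1 = "half_diff_sqrt B1" and ?s2 = "half_sum_sqrt B2" and ?r2 = "half_diff_sqrt B2"
  note sr1 = half_sqrts[OF h1 c1] and sr2 = half_sqrts[OF h2 c2]
  have sv: "single_valued (quotient_graph ?s1 ?r1)" "single_valued (quotient_graph ?s2 ?r2)"
    using sqrt_quotient_graph_pos_sa(1)[OF B1] sqrt_quotient_graph_pos_sa(1)[OF B2]
    by (auto simp: positive_selfadjoint_def positive_op_def densely_defined_def linear_op_def)
  have ap1: "ap (quotient_graph ?s1 ?r1) (?s1 v) = ?r1 v" for v by (rule ap_eqI[OF sv(1)]) (auto simp: quotient_graph_def)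
  have ap2: "ap (quotient_graph ?s2 ?r2) (?s2 v) = ?r2 v" for v by (rule ap_eqI[OF sv(2)]) (auto simp: quotient_graph_def)
  have D: "Domain (quotient_graph s r) = range s" for s r :: "'a \<Rightarrow> 'a" by (auto simp: quotient_graph_def)
  have form: "form_le (inv_cayley B1) (inv_cayley B2) \<longleftrightarrow>
    (\<forall>v. \<exists>w. ?s2 v = ?s1 w \<and> norm (?r1 w) \<le> norm (?r2 v))"
    unfolding form_le_def op_sqrt_inv_cayley[OF B1] op_sqrt_inv_cayley[OF B2] D
    by (auto simp: ap2 ap1 image_subset_iff) (metis ap1 rangeE rangeI)+
  have "norm (?s1 x) \<ge> norm (?s2 x) \<longleftrightarrow> Re (cinner (B2 x) x) \<le> Re (cinner (B1 x) x)" for x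
  proof -
    have "(norm (?s1 x))\<^sup>2 = (1/2) * ((norm x)\<^sup>2 + Re (cinner (B1 x) x))"
      "(norm (?s2 x))\<^sup>2 = (1/2) * ((norm x)\<^sup>2 + Re (cinner (B2 x) x))"
      unfolding half_sum_sqrt_def bounded_sqrt_norm[OF unit_interval_half(1)[OF h1 c1]] bounded_sqrt_norm[OF unit_interval_half(1)[OF h2 c2]]
      by (simp_all add: cinner_simps)
    moreover have "norm (?s2 x) \<le> norm (?s1 x) \<longleftrightarrow> (norm (?s2 x))\<^sup>2 \<le> (norm (?s1 x))\<^sup>2"
      by (simp add: abs_le_square_iff[symmetric])
    ultimately have "norm (?s2 x) \<le> norm (?s1 x) \<longleftrightarrow>
      (1/2) * ((norm x)\<^sup>2 + Re (cinner (B2 x) x)) \<le> (1/2) * ((norm x)\<^sup>2 + Re (cinner (B1 x) x))"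
      by (simp only:)
    then show ?thesis by simp
  qed
  then have ord: "(\<forall>x. Re (cinner (B2 x) x) \<le> Re (cinner (B1 x) x)) \<longleftrightarrow> (\<forall>x. norm (?s2 x) \<le> norm (?s1 x))"
    by simp
  show ?thesis unfolding form ord
  proof
    assume *: "\<forall>v. \<exists>w. ?s2 v = ?s1 w \<and> norm (?r1 w) \<le> norm (?r2 v)"
    show "\<forall>x. norm (?s2 x) \<le> norm (?s1 x)"
    proof
      fix x
      \<comment> \<open>The choice v = s2 x lets \<open>?s2 v\<close> be paired with
        \<open>x\<close> to produce the squared norm of s2 x.\<close>
      obtain w where w: "?s2 (?s2 x) = ?s1 w" "norm (?r1 w) \<le> norm (?r2 (?s2 x))" using * by blast
      have "(norm w)\<^sup>2 \<le> (norm (?s2 x))\<^sup>2"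
        using sr1(9)[of w] sr2(9)[of "?s2 x"] power_mono[OF w(2) norm_ge_zero, of 2] unfolding w(1) by linarith
      then have nw: "norm w \<le> norm (?s2 x)" by (rule power2_le_imp_le) simp
      have "(norm (?s2 x))\<^sup>2 = Re (cinner (?s2 (?s2 x)) x)" by (simp only: adjoint_pairD[OF sr2(1), of "?s2 x"]) simp
      also have "\<dots> = Re (cinner w (?s1 x))" by (simp add: w(1) adjoint_pairD[OF sr1(1)])
      also have "\<dots> \<le> norm w * norm (?s1 x)" by (rule Re_cinner_le)
      also have "\<dots> \<le> norm (?s2 x) * norm (?s1 x)" using nw by (intro mult_right_mono) auto
      finally have "norm (?s2 x) * norm (?s2 x) \<le> norm (?s2 x) * norm (?s1 x)"
        by (simp add: power2_eq_square)
      then show "norm (?s2 x) \<le> norm (?s1 x)" by (cases "?s2 x = 0") auto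
    qed
  next
    assume *: "\<forall>x. norm (?s2 x) \<le> norm (?s1 x)"
    obtain k where k: "clinear k" "contractive k" "\<And>x. k (?s1 x) = ?s2 x"
      using douglas_factorization[OF adjoint_pair_clinear[OF sr2(1)] adjoint_pair_clinear[OF sr1(1)]] * by metis
    obtain k' where k': "adjoint_pair k k'" "contractive k'" using adjoint_exists[OF k(1,2)] by blast
    \<comment> \<open>The adjoint of the relation k s1 = s2 between hermitian maps.\<close>
    have e: "?s2 v = ?s1 (k' v)" for v
    proof (rule cinner_eqI)
      show "cinner (?s2 v) y = cinner (?s1 (k' v)) y" for y
        by (simp add: adjoint_pairD[OF sr2(1)] adjoint_pairD[OF sr1(1)] adjoint_pairD[OF adjoint_pair_sym[OF k'(1)]] k(3))
    qed
    show "\<forall>v. \<exists>w. ?s2 v = ?s1 w \<and> norm (?r1 w) \<le> norm (?r2 v)"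
    proof (intro allI exI conjI)
      fix v
      show "?s2 v = ?s1 (k' v)" by (rule e)
      have "(norm (?r1 (k' v)))\<^sup>2 \<le> (norm (?r2 v))\<^sup>2"
        using sr1(9)[of "k' v"] sr2(9)[of v] power_mono[OF contractiveD[OF k'(2), of v] norm_ge_zero, of 2]
        unfolding e[of v] by linarith
      then show "norm (?r1 (k' v)) \<le> norm (?r2 v)" by (rule power2_le_imp_le) simp
    qed
  qed
qed

section \<open>Selfadjoint contractive extensions of a symmetric contraction\<close>

lemma eq_on_closure_range:
  assumes f: "clinear f" "contractive f" and g: "clinear g" "contractive g" and eq: "\<And>x. f (d x) = g (d x)"
    and y: "y \<in> closure (range d)"
  shows "f y = g y"
proof -
  obtain w where w: "\<And>n. w n \<in> range d" "w \<longlonglongrightarrow> y" using y unfolding closure_sequential by blast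
  have "f (w n) = g (w n)" for n using w(1)[of n] eq by auto
  then show ?thesis using contractive_tendsto[OF f w(2)] contractive_tendsto[OF g w(2)] by (simp add: LIMSEQ_unique)
qed

text \<open>Douglas factorization is applied twice: first N = k d, with adjoint N = d k', and then
  k' = m d. The form hypothesis, rather than a bound on \<open>N\<close> alone, is what makes the
  second factorization possible.\<close>

lemma form_factorization:
  assumes N: "hermitian N" and d: "hermitian d" "contractive d"
    and le: "\<And>x y. norm (cinner (N x) y) \<le> norm (d x) * norm (d y)"
  obtains \<gamma> where "hermitian \<gamma>" "contractive \<gamma>" "\<And>x. \<gamma> (proj (closure (range d)) x) = \<gamma> x"
    "\<And>x. N x = d (\<gamma> (d x))"
proof -
  let ?C = "closure (range d)"
  note dl = adjoint_pair_clinear[OF d(1)]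
  have C: "closed_csubspace ?C" by (intro closed_csubspace_closure csubspace_range dl)
  have "norm (N x) \<le> norm (d x)" for x
  proof -
    have "(norm (N x))\<^sup>2 \<le> norm (d x) * norm (d (N x))"
      using le[of x "N x"] by (simp add: cinner_self norm_power)
    also have "\<dots> \<le> norm (d x) * norm (N x)" by (intro mult_left_mono contractiveD[OF d(2)]) simp
    finally show ?thesis by (cases "N x = 0") (simp_all add: power2_eq_square)
  qed
  from douglas_factorization[OF adjoint_pair_clinear[OF N] dl this]
  obtain k where k: "clinear k" "contractive k" "\<And>x. k (d x) = N x" "\<And>x. k (proj ?C x) = k x" by blast
  obtain k' where k': "adjoint_pair k k'" "contractive k'" using adjoint_exists[OF k(1,2)] by blast
  have k'C: "k' x \<in> ?C" for x by (rule adjoint_pair_proj_range[OF C k'(1) k(4)])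
  have Nk': "N x = d (k' x)" for x
  proof (rule cinner_eqI)
    show "cinner (N x) y = cinner (d (k' x)) y" for y
      by (simp add: adjoint_pairD[OF N] adjoint_pairD[OF d(1)] adjoint_pairD[OF adjoint_pair_sym[OF k'(1)]] k(3))
  qed
  \<comment> \<open>The hypothesis bounds \<open>k' x\<close> against vectors of the range of
    \<open>d\<close>. These approximate \<open>k' x\<close> itself, because \<open>k'\<close> takes
    its values in the closure.\<close>
  have "norm (k' x) \<le> norm (d x)" for x
  proof -
    obtain w where w: "\<And>n. w n \<in> range d" "w \<longlonglongrightarrow> k' x" using k'C[of x] unfolding closure_sequential by blast
    have "norm (cinner (k' x) (d y)) \<le> norm (d x) * norm (d y)" for y
      using le[of x y] by (simp add: Nk' adjoint_pairD[OF d(1)])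
    then have "norm (cinner (k' x) (w n)) \<le> norm (d x) * norm (w n)" for n using w(1)[of n] by auto
    moreover have "(\<lambda>n. norm (cinner (k' x) (w n))) \<longlonglongrightarrow> norm (cinner (k' x) (k' x))"
      by (intro tendsto_norm tendsto_cinner tendsto_const w)
    moreover have "(\<lambda>n. norm (d x) * norm (w n)) \<longlonglongrightarrow> norm (d x) * norm (k' x)"
      by (intro tendsto_intros w)
    ultimately have "norm (cinner (k' x) (k' x)) \<le> norm (d x) * norm (k' x)"
      using LIMSEQ_le by blast
    then show ?thesis by (cases "k' x = 0") (simp_all add: cinner_self norm_power power2_eq_square norm_mult)
  qed
  from douglas_factorization[OF adjoint_pair_clinear[OF adjoint_pair_sym[OF k'(1)]] dl this]
  obtain m where m: "clinear m" "contractive m" "\<And>x. m (d x) = k' x" "\<And>x. m (proj ?C x) = m x" by blast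
  let ?Q = "proj ?C"
  \<comment> \<open>The outer projection puts the range in the closure, so hermiticity need only be
    checked there; \<open>d1\<close> and \<open>d2\<close> do this by density, one argument at a
    time.\<close>
  define \<gamma> where "\<gamma> x = ?Q (m x)" for x
  have up: "cinner (?Q u) v = cinner (?Q u) (?Q v)" for u v
    by (metis adjoint_pairD[OF hermitian_proj[OF C]] proj_id[OF C] proj_in[OF C])
  have dd: "cinner (m (d x)) (d y) = cinner (d x) (m (d y))" for x y
    using adjoint_pairD[OF N, of x y] by (simp add: m(3) Nk' adjoint_pairD[OF d(1)])
  have d1: "cinner (m p) (d y) = cinner p (m (d y))" if p: "p \<in> ?C" for p y
  proof -
    obtain w where w: "\<And>n. w n \<in> range d" "w \<longlonglongrightarrow> p" using p unfolding closure_sequential by blast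
    have "cinner (m (w n)) (d y) = cinner (w n) (m (d y))" for n using w(1)[of n] dd by auto
    moreover have "(\<lambda>n. cinner (m (w n)) (d y)) \<longlonglongrightarrow> cinner (m p) (d y)"
      by (rule tendsto_cinner[OF contractive_tendsto[OF m(1,2) w(2)] tendsto_const])
    moreover have "(\<lambda>n. cinner (w n) (m (d y))) \<longlonglongrightarrow> cinner p (m (d y))"
      by (intro tendsto_cinner tendsto_const w)
    ultimately show ?thesis by (simp add: LIMSEQ_unique)
  qed
  have d2: "cinner (m p) q = cinner p (m q)" if p: "p \<in> ?C" and q: "q \<in> ?C" for p q
  proof -
    obtain w where w: "\<And>n. w n \<in> range d" "w \<longlonglongrightarrow> q" using q unfolding closure_sequential by blast
    have "cinner (m p) (w n) = cinner p (m (w n))" for n using w(1)[of n] d1[OF p] by auto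
    moreover have "(\<lambda>n. cinner p (m (w n))) \<longlonglongrightarrow> cinner p (m q)"
      by (rule tendsto_cinner[OF tendsto_const contractive_tendsto[OF m(1,2) w(2)]])
    moreover have "(\<lambda>n. cinner (m p) (w n)) \<longlonglongrightarrow> cinner (m p) q"
      by (intro tendsto_cinner tendsto_const w)
    ultimately show ?thesis by (simp add: LIMSEQ_unique)
  qed
  show thesis
  proof (rule that)
    show "hermitian \<gamma>" unfolding adjoint_pair_def
    proof (intro allI)
      fix x y
      have "cinner (\<gamma> x) y = cinner (m (?Q x)) (?Q y)"
        by (simp add: \<gamma>_def adjoint_pairD[OF hermitian_proj[OF C]] m(4))
      also have "\<dots> = cinner (?Q x) (m (?Q y))" by (rule d2) (auto intro: proj_in C)
      also have "\<dots> = cinner x (\<gamma> y)" by (simp add: \<gamma>_def adjoint_pairD[OF hermitian_proj[OF C]] m(4))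
      finally show "cinner (\<gamma> x) y = cinner x (\<gamma> y)" .
    qed
    show "contractive \<gamma>" unfolding contractive_def \<gamma>_def
      using contractiveD[OF contractive_proj[OF C]] contractiveD[OF m(2)] order_trans by blast
    show "\<gamma> (?Q x) = \<gamma> x" for x by (simp add: \<gamma>_def m(4))
    show "N x = d (\<gamma> (d x))" for x by (simp add: \<gamma>_def m(3) Nk' proj_id[OF C] k'C)
  qed
qed

lemma block_op_graph_on:
  assumes M: "closed_csubspace M"
  shows "block_op (graph_on M f1) (graph_on (orth M) f2) (graph_on M f3) (graph_on (orth M) f4) =
    graph_on UNIV (\<lambda>x. (f1 (proj M x) + f2 (x - proj M x)) + (f3 (proj M x) + f4 (x - proj M x)))"
proof (rule set_eqI, clarify)
  fix x y
  have 1: "proj M (h + k) = h" if "h \<in> M" "k \<in> orth M" for h k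
    using that by (intro proj_eqI[OF M]) auto
  show "(x, y) \<in> block_op (graph_on M f1) (graph_on (orth M) f2) (graph_on M f3) (graph_on (orth M) f4) \<longleftrightarrow>
    (x, y) \<in> graph_on UNIV (\<lambda>x. (f1 (proj M x) + f2 (x - proj M x)) + (f3 (proj M x) + f4 (x - proj M x)))"
  proof
    show "(x, y) \<in> graph_on UNIV (\<lambda>x. (f1 (proj M x) + f2 (x - proj M x)) + (f3 (proj M x) + f4 (x - proj M x)))"
      if "(x, y) \<in> block_op (graph_on M f1) (graph_on (orth M) f2) (graph_on M f3) (graph_on (orth M) f4)"
      using that unfolding block_op_def graph_on_iff by (auto simp: 1)
    assume A: "(x, y) \<in> graph_on UNIV (\<lambda>x. (f1 (proj M x) + f2 (x - proj M x)) + (f3 (proj M x) + f4 (x - proj M x)))"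
    show "(x, y) \<in> block_op (graph_on M f1) (graph_on (orth M) f2) (graph_on M f3) (graph_on (orth M) f4)"
      unfolding block_op_def mem_Collect_eq
      by (rule exI[of _ "proj M x"], rule exI[of _ "x - proj M x"])
        (use A in \<open>simp add: graph_on_iff proj_in[OF M] proj_orth[OF M]\<close>)
  qed
qed

text \<open>In this locale, \<open>a\<close>, \<open>dA\<close>, \<open>g\<close>, \<open>g'\<close>, \<open>dG\<close> are \<open>A\<close>, \<open>D\<^sub>A\<close>, \<open>\<Gamma>\<^sub>2\<close>, \<open>\<Gamma>\<^sub>2*\<close> and the defect operator
  of \<open>\<Gamma>\<^sub>2*\<close>, each extended by \<open>0\<close> to the orthogonal complement of its domain.\<close>

locale symmetric_contraction =
  fixes T :: "'a::chilbert_space rel" and t :: "'a \<Rightarrow> 'a"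
  assumes closed_csubspace_D: "closed_csubspace (Domain T)"
    and t_lin: "clinear t" and t_contractive: "contractive t" and t_P: "t (proj (Domain T) x) = t x"
    and T_graph_on: "T = graph_on (Domain T) t" and T_sym: "symmetric_op T"
begin

abbreviation "D \<equiv> Domain T"
abbreviation "P \<equiv> proj D"

definition "a x = P (t x)"
definition "dA = bounded_sqrt (\<lambda>x. P x - a (a x))"
definition "DA = closure (range dA)"
definition "g = (SOME g. clinear g \<and> contractive g \<and> (\<forall>x. g (dA x) = t x - P (t x)) \<and> (\<forall>x. g (proj DA x) = g x))"
definition "g' = (SOME g'. adjoint_pair g g' \<and> contractive g')"
definition "dG = bounded_sqrt (\<lambda>x. x - P x - g (g' x))"
definition "DG = closure (range dG)"

section \<open>The entries of the block matrix as total functions\<close>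

lemmas P_lin = clinearD[OF adjoint_pair_clinear[OF hermitian_proj[OF closed_csubspace_D]]]
lemmas hP = adjoint_pairD[OF hermitian_proj[OF closed_csubspace_D]]
lemmas tl = clinearD[OF t_lin]

lemma P_in: "P x \<in> D" by (rule proj_in[OF closed_csubspace_D])

lemma P_id: "x \<in> D \<Longrightarrow> P x = x" by (rule proj_id[OF closed_csubspace_D])

lemma P_E: "x \<in> orth D \<Longrightarrow> P x = 0" by (rule proj_zero[OF closed_csubspace_D])

lemma E_in: "x - P x \<in> orth D" by (rule proj_orth[OF closed_csubspace_D])

lemma hermitian_a: "hermitian a" unfolding adjoint_pair_def
proof (intro allI)
  fix x y
  have "cinner (a x) y = cinner (t (P x)) (P y)" by (simp add: a_def hP t_P)
  also have "\<dots> = cinner (P x) (t (P y))"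
  proof -
    have "(P x, t (P x)) \<in> T" "(P y, t (P y)) \<in> T" by (subst T_graph_on, simp add: graph_on_iff P_in)+
    then show ?thesis using T_sym unfolding symmetric_op_def by blast
  qed
  also have "\<dots> = cinner x (a y)" by (simp add: a_def hP t_P)
  finally show "cinner (a x) y = cinner x (a y)" .
qed

lemmas ha = adjoint_pairD[OF hermitian_a] and a_lin = clinearD[OF adjoint_pair_clinear[OF hermitian_a]]

lemma contractive_a: "contractive a" unfolding contractive_def a_def
  using contractiveD[OF contractive_proj[OF closed_csubspace_D]] contractiveD[OF t_contractive] order_trans by blast

lemma a_P: "a (P x) = a x" by (simp add: a_def t_P)

lemma P_a: "P (a x) = a x" by (simp add: a_def P_id P_in)

lemma a_in: "a x \<in> D" by (simp add: a_def P_in)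

lemma norm_a_le: "norm (a x) \<le> norm (P x)"
  using contractiveD[OF contractive_a, of "P x"] by (simp add: a_P)

lemma norm_P_sq: "(norm (P x))\<^sup>2 = Re (cinner (P x) x)"
  by (metis Re_cinner_self hP P_id P_in)

lemma uA: "unit_interval_op (\<lambda>x. P x - a (a x))"
  unfolding unit_interval_op_def
proof (intro conjI allI)
  show "hermitian (\<lambda>x. P x - a (a x))" unfolding adjoint_pair_def by (simp add: cinner_simps ha hP)
  fix x
  have "Re (cinner (P x - a (a x)) x) = (norm (P x))\<^sup>2 - (norm (a x))\<^sup>2"
    by (simp add: cinner_diff_left norm_P_sq ha[of "a x"])
  then show "0 \<le> Re (cinner (P x - a (a x)) x)" "Re (cinner (P x - a (a x)) x) \<le> (norm x)\<^sup>2"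
    using power_mono[OF norm_a_le[of x] norm_ge_zero, of 2]
      power_mono[OF contractiveD[OF contractive_proj[OF closed_csubspace_D], of x] norm_ge_zero, of 2] zero_le_power2[of "norm (a x)"]
    by linarith+
qed

lemma hermitian_dA: "hermitian dA" unfolding dA_def by (rule bounded_sqrtD(1)[OF uA])

lemmas hdA = adjoint_pairD[OF hermitian_dA] and dA_lin = clinearD[OF adjoint_pair_clinear[OF hermitian_dA]]

lemma dA_sq: "dA (dA x) = P x - a (a x)" unfolding dA_def by (rule bounded_sqrtD(3)[OF uA])

lemma a_dA: "a (dA x) = dA (a x)" unfolding dA_def
  by (rule bounded_sqrtD(4)[OF uA hermitian_a]) (simp add: a_lin a_P P_a)

lemma dA_P: "dA (P x) = dA x" and dA_in: "dA x \<in> D"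
proof -
  have b: "P (P x) - a (a (P x)) = P x - a (a x)" for x by (simp add: a_P P_id P_in)
  show "dA (P x) = dA x" "dA x \<in> D" unfolding dA_def by (rule bounded_sqrt_proj[OF closed_csubspace_D uA b])+
qed

lemma norm_dA: "(norm (dA x))\<^sup>2 = (norm (P x))\<^sup>2 - (norm (a x))\<^sup>2"
  unfolding dA_def bounded_sqrt_norm[OF uA] by (simp add: cinner_diff_left norm_P_sq ha[of "a x"])

lemma closed_csubspace_DA: "closed_csubspace DA" unfolding DA_def by (intro closed_csubspace_closure csubspace_range adjoint_pair_clinear[OF hermitian_dA])

lemma DA_sub: "DA \<subseteq> D"
  unfolding DA_def using closed_csubspace_D dA_in by (intro closure_minimal) (auto simp: closed_csubspace_def)

lemma dA_DA: "dA x \<in> DA" using closure_subset[of "range dA"] by (auto simp: DA_def)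

lemma t_split: "(norm (t x))\<^sup>2 = (norm (a x))\<^sup>2 + (norm (t x - P (t x)))\<^sup>2"
  unfolding a_def by (rule proj_norm_sq[OF closed_csubspace_D])

text \<open>By orthogonality the component of \<open>t x\<close> off \<open>D\<close> has squared
  norm that of \<open>t x\<close> minus that of \<open>a x\<close>. As \<open>t\<close> is a
  contraction, this is at most the squared norm of \<open>dA x\<close>, and Douglas factorization
  produces the operator.\<close>

lemma g_ex: "\<exists>g. clinear g \<and> contractive g \<and> (\<forall>x. g (dA x) = t x - P (t x)) \<and> (\<forall>x. g (proj DA x) = g x)"
  unfolding DA_def
proof (rule douglas_factorization)
  show "clinear (\<lambda>x. t x - P (t x))"
    unfolding clinear_def by (simp add: tl P_lin scaleC_diff_right)
  show "clinear dA" by (rule adjoint_pair_clinear[OF hermitian_dA])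
  fix x
  have "(norm (t x - P (t x)))\<^sup>2 \<le> (norm (dA x))\<^sup>2"
    using t_split[of x] norm_dA[of x] power_mono[OF contractiveD[OF t_contractive, of "P x"] norm_ge_zero, of 2]
    by (simp add: t_P)
  then show "norm (t x - P (t x)) \<le> norm (dA x)" by (rule power2_le_imp_le) simp
qed

lemma g_props: "clinear g" "contractive g" "g (dA x) = t x - P (t x)" "g (proj DA x) = g x"
  using someI_ex[OF g_ex, folded g_def] by auto

lemma g'_props: "adjoint_pair g g'" "contractive g'"
  using someI_ex[OF adjoint_exists[OF g_props(1,2)], folded g'_def] by auto

lemmas hg = adjoint_pairD[OF g'_props(1)] and hg' = adjoint_pairD[OF adjoint_pair_sym[OF g'_props(1)]]
lemmas g_lin = clinearD[OF g_props(1)] and g'_lin = clinearD[OF adjoint_pair_clinear[OF adjoint_pair_sym[OF g'_props(1)]]]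

lemma g'_DA: "g' x \<in> DA" by (rule adjoint_pair_proj_range[OF closed_csubspace_DA g'_props(1) g_props(4)])

text \<open>Against \<open>dA u\<close>, the vector \<open>g' x\<close> gives the product of
  \<open>x\<close> with the component of \<open>t u\<close> off \<open>D\<close>, which is zero. So
  \<open>g' x\<close> is orthogonal to \<open>DA\<close>, where it lies. The range statement
  \<open>g_E\<close> is then the dual assertion.\<close>

lemma g'_D: assumes "x \<in> D" shows "g' x = 0"
proof -
  have "cinner (g' x) y = 0" if "y \<in> DA" for y
  proof (rule cinner_closure_ext)
    show "y \<in> closure (range dA)" using that by (simp add: DA_def)
    fix z assume "z \<in> range dA"
    then obtain u where "z = dA u" by blast
    then have "cinner (g' x) z = cinner x (t u - P (t u))" by (simp add: hg' g_props)
    then show "cinner (g' x) z = 0" using orthD(2)[OF E_in assms] by simp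
  qed
  from this[OF g'_DA[of x]] show ?thesis by (simp add: cinner_self)
qed

lemma g_E: "g x \<in> orth D"
  unfolding orth_def using g'_D by (simp add: hg)

lemma P_g: "P (g x) = 0" by (rule P_E[OF g_E])

lemma g'_E: "g' (x - P x) = g' x" using g'_D[OF P_in] by (simp add: g'_lin)

lemma P_g': "P (g' x) = g' x" using g'_DA DA_sub P_id by blast

lemma norm_E_sq: "(norm (x - P x))\<^sup>2 = Re (cinner (x - P x) x)"
  using orthD(1)[OF E_in P_in, of x x] by (simp add: Re_cinner_self[symmetric] cinner_diff_right[of _ x "P x"] del: Re_cinner_self)

lemma uG_form: "Re (cinner (x - P x - g (g' x)) x) = (norm (x - P x))\<^sup>2 - (norm (g' x))\<^sup>2"
  by (simp add: cinner_diff_left[of "x - P x"] norm_E_sq hg[of "g' x"])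

lemma norm_g'_le: "norm (g' x) \<le> norm (x - P x)"
  using contractiveD[OF g'_props(2), of "x - P x"] by (simp add: g'_E)

lemma norm_E_le: "norm (x - P x) \<le> norm x"
  using contractiveD[OF contractive_proj[OF closed_csubspace_orth], of D x] by (simp add: proj_orth_eq[OF closed_csubspace_D])

lemma uG: "unit_interval_op (\<lambda>x. x - P x - g (g' x))"
  unfolding unit_interval_op_def uG_form
proof (intro conjI allI)
  show "hermitian (\<lambda>x. x - P x - g (g' x))" unfolding adjoint_pair_def by (simp add: cinner_simps hP hg hg')
  fix x
  show "0 \<le> (norm (x - P x))\<^sup>2 - (norm (g' x))\<^sup>2" "(norm (x - P x))\<^sup>2 - (norm (g' x))\<^sup>2 \<le> (norm x)\<^sup>2"
    using power_mono[OF norm_g'_le[of x] norm_ge_zero, of 2] power_mono[OF norm_E_le[of x] norm_ge_zero, of 2]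
      zero_le_power2[of "norm (g' x)"] by linarith+
qed

lemma hermitian_dG: "hermitian dG" unfolding dG_def by (rule bounded_sqrtD(1)[OF uG])

lemmas hdG = adjoint_pairD[OF hermitian_dG] and dG_lin = clinearD[OF adjoint_pair_clinear[OF hermitian_dG]]

lemma norm_dG: "(norm (dG x))\<^sup>2 = (norm (x - P x))\<^sup>2 - (norm (g' x))\<^sup>2"
  unfolding dG_def bounded_sqrt_norm[OF uG] by (rule uG_form)

lemma contractive_dG: "contractive dG" unfolding contractive_def
proof
  fix x
  have "(norm (dG x))\<^sup>2 \<le> (norm x)\<^sup>2"
    using norm_dG[of x] power_mono[OF norm_E_le[of x] norm_ge_zero, of 2]
      zero_le_power2[of "norm (g' x)"] by linarith
  then show "norm (dG x) \<le> norm x" by (rule power2_le_imp_le) simp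
qed

lemma bG: "proj (orth D) x - P (proj (orth D) x) - g (g' (proj (orth D) x)) = x - P x - g (g' x)"
  unfolding proj_orth_eq[OF closed_csubspace_D] by (simp add: P_lin P_id P_in g'_E)

lemma dG_E: "dG (x - P x) = dG x" and dG_in: "dG x \<in> orth D"
  using bounded_sqrt_proj[OF closed_csubspace_orth uG bG, folded dG_def] by (simp_all add: proj_orth_eq[OF closed_csubspace_D])

lemma P_dG: "P (dG x) = 0" by (rule P_E[OF dG_in])

lemma dG_D: "x \<in> D \<Longrightarrow> dG x = 0" using dG_E[of x] by (simp add: P_id dG_lin)

lemma closed_csubspace_DG: "closed_csubspace DG" unfolding DG_def by (intro closed_csubspace_closure csubspace_range adjoint_pair_clinear[OF hermitian_dG])

lemma dG_DG: "dG x \<in> DG" using closure_subset[of "range dG"] by (auto simp: DG_def)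

section \<open>Evaluation of the relational definitions by these functions\<close>

lemma compr_graph_on: "compr T = graph_on D a"
proof (rule set_eqI, clarify)
  fix x y
  have mem: "(x, z) \<in> T \<longleftrightarrow> x \<in> D \<and> z = t x" for z by (subst T_graph_on) (simp add: graph_on_iff)
  have "y = a x" if "y \<in> D" "b \<in> orth D" "y + b = t x" for b
  proof -
    have "t x - y = b" using that(3) by (metis add_diff_cancel_left')
    then have "P (t x) = y" using that by (intro proj_eqI[OF closed_csubspace_D]) auto
    then show ?thesis by (simp add: a_def)
  qed
  moreover have "\<exists>b\<in>orth D. a x + b = t x" unfolding a_def
    using E_in by (intro bexI[of _ "t x - P (t x)"]) auto
  ultimately show "(x, y) \<in> compr T \<longleftrightarrow> (x, y) \<in> graph_on D a"
    unfolding compr_def graph_on_iff using mem a_in by auto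
qed

lemma D_A_graph_on: "D_A T = graph_on D dA"
proof -
  have "adj D D (graph_on D a) = graph_on D a" by (rule adj_graph_on[OF closed_csubspace_D hermitian_a]) (rule a_in)
  then have "Id_on D -\<^sub>o adj D D (compr T) \<circ>\<^sub>o compr T = graph_on D (\<lambda>x. x - a (a x))"
    unfolding compr_graph_on using a_in by (simp add: graph_on_comp image_subset_iff Id_on_graph_on graph_on_diff)
  also have "\<dots> = graph_on D (\<lambda>x. P x - a (a x))" unfolding graph_on_eq_iff by (simp add: P_id)
  finally show ?thesis unfolding defect_op_def dA_def
    using op_sqrt_graph_on[OF closed_csubspace_D uA] by (simp add: P_id P_in a_P)
qed

lemma D_A_space_eq: "D_A_space T = DA"
proof -
  have "dA ` D = range dA" using dA_P P_in by (metis (no_types, lifting) image_iff rangeI subsetI subset_antisym image_subset_iff)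
  then show ?thesis unfolding defect_space_def D_A_graph_on Range_graph_on DA_def by simp
qed

lemma Gamma2_graph_on: "Gamma2 T = graph_on DA g"
  unfolding Gamma2_def D_A_space_eq
proof (rule the_equality)
  have cm: "compr T +\<^sub>o graph_on DA f \<circ>\<^sub>o D_A T = graph_on D (\<lambda>x. a x + f (dA x))" for f
    unfolding D_A_graph_on unfolding compr_graph_on using dA_DA by (simp add: graph_on_comp image_subset_iff graph_on_add)
  have "graph_on D (\<lambda>x. a x + g (dA x)) = graph_on D t" unfolding graph_on_eq_iff by (simp add: g_props a_def)
  then show "contraction DA (orth D) (graph_on DA g) \<and> T = compr T +\<^sub>o graph_on DA g \<circ>\<^sub>o D_A T"
    using contraction_graph_on[OF g_props(1,2) closed_csubspace_csubspace[OF closed_csubspace_DA] g_E] cm T_graph_on by simp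
  fix G assume G: "contraction DA (orth D) G \<and> T = compr T +\<^sub>o G \<circ>\<^sub>o D_A T"
  then obtain f where f: "clinear f" "contractive f" "G = graph_on DA f"
    using contraction_repr[OF _ closed_csubspace_DA] by metis
  have "graph_on D (\<lambda>x. a x + f (dA x)) = graph_on D t" using G cm T_graph_on unfolding f(3) by simp
  \<comment> \<open>Comparing with the column of \<open>T\<close> fixes a competitor on the range of
    \<open>dA\<close>; continuity extends the equality to \<open>DA\<close>.\<close>
  then have "f (dA x) = g (dA x)" if "x \<in> D" for x
    using that unfolding graph_on_eq_iff by (simp add: g_props a_def) (metis add_diff_cancel_left')
  then have "f (dA x) = g (dA x)" for x using P_in dA_P by metis
  then show "G = graph_on DA g" unfolding f(3) graph_on_eq_iff DA_def
    using eq_on_closure_range[OF f(1,2) g_props(1,2)] by blast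
qed

lemma Gamma2_adj_graph_on: "Gamma2_adj T = graph_on (orth D) g'"
  unfolding Gamma2_adj_def D_A_space_eq Gamma2_graph_on
  by (rule adj_graph_on[OF closed_csubspace_DA g'_props(1)]) (rule g'_DA)

lemma D_Gamma2_adj_graph_on: "D_Gamma2_adj T = graph_on (orth D) dG"
proof -
  have "adj (orth D) DA (graph_on (orth D) g') = graph_on DA g"
    by (rule adj_graph_on[OF closed_csubspace_orth adjoint_pair_sym[OF g'_props(1)]]) (rule g_E)
  then have "Id_on (orth D) -\<^sub>o adj (orth D) (D_A_space T) (Gamma2_adj T) \<circ>\<^sub>o Gamma2_adj T
    = graph_on (orth D) (\<lambda>x. x - g (g' x))"
    unfolding Gamma2_adj_graph_on D_A_space_eq using g'_DA by (simp add: graph_on_comp image_subset_iff Id_on_graph_on graph_on_diff)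
  also have "\<dots> = graph_on (orth D) (\<lambda>x. x - P x - g (g' x))" unfolding graph_on_eq_iff by (simp add: P_E)
  finally show ?thesis unfolding defect_op_def dG_def
    using op_sqrt_graph_on[OF closed_csubspace_orth uG bG] by simp
qed

lemma D_Gamma2_adj_space_eq: "D_Gamma2_adj_space T = DG"
proof -
  have "dG ` orth D = range dG" using dG_E E_in by (metis (no_types, lifting) image_iff rangeI subsetI subset_antisym image_subset_iff)
  then show ?thesis unfolding defect_space_def[of "orth D"] D_Gamma2_adj_graph_on Range_graph_on DG_def by simp
qed

text \<open>The representatives of selfadjoint contractions on \<open>DG\<close>, extended by zero
  to the complement of \<open>DG\<close>.\<close>

definition "param \<gamma> \<longleftrightarrow> hermitian \<gamma> \<and> contractive \<gamma> \<and> (\<forall>x. \<gamma> (proj DG x) = \<gamma> x)"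

lemma paramD:
  assumes "param \<gamma>"
  shows "hermitian \<gamma>" "contractive \<gamma>" "\<gamma> (proj DG x) = \<gamma> x" "\<gamma> x \<in> DG"
  using assms adjoint_pair_proj_range[OF closed_csubspace_DG, of \<gamma> \<gamma> x] by (auto simp: param_def)

lemma sa_contractions_eq: "sa_contractions T = graph_on DG ` {\<gamma>. param \<gamma>}"
proof
  show "graph_on DG ` {\<gamma>. param \<gamma>} \<subseteq> sa_contractions T"
    unfolding sa_contractions_def D_Gamma2_adj_space_eq
  proof clarify
    fix \<gamma> assume c: "param \<gamma>"
    show "contraction DG DG (graph_on DG \<gamma>) \<and> selfadjoint DG (graph_on DG \<gamma>)"
      using contraction_graph_on[OF adjoint_pair_clinear[OF paramD(1)[OF c]] paramD(2)[OF c] closed_csubspace_csubspace[OF closed_csubspace_DG] paramD(4)[OF c]]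
        selfadjoint_graph_on[OF closed_csubspace_DG paramD(1)[OF c] paramD(4)[OF c]] by simp
  qed
  show "sa_contractions T \<subseteq> graph_on DG ` {\<gamma>. param \<gamma>}"
  proof
    fix \<Gamma> assume "\<Gamma> \<in> sa_contractions T"
    then have c: "contraction DG DG \<Gamma>" and s: "adj DG DG \<Gamma> = \<Gamma>"
      unfolding sa_contractions_def D_Gamma2_adj_space_eq selfadjoint_def by auto
    obtain f where f: "clinear f" "contractive f" "\<And>x. f (proj DG x) = f x" "\<And>x. f x \<in> DG" "\<Gamma> = graph_on DG f"
      using contraction_repr[OF c closed_csubspace_DG] by metis
    have up: "cinner u (proj DG x) = cinner u x" if "u \<in> DG" for u x
      using that by (simp add: adjoint_pairD[OF hermitian_proj[OF closed_csubspace_DG], symmetric] proj_id[OF closed_csubspace_DG])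
    have "cinner (f x) y = cinner x (f y)" for x y
    proof -
      have "(proj DG y, f y) \<in> \<Gamma>" unfolding f(5) graph_on_iff by (simp add: f(3) proj_in closed_csubspace_DG)
      then have "(proj DG y, f y) \<in> adj DG DG \<Gamma>" by (simp only: s)
      moreover have "(proj DG x, f x) \<in> \<Gamma>" unfolding f(5) graph_on_iff by (simp add: f(3) proj_in closed_csubspace_DG)
      ultimately have "cinner (f x) (proj DG y) = cinner (proj DG x) (f y)" unfolding adj_def by blast
      then show ?thesis using up[OF f(4)] up[OF f(4), of y x] by (metis cinner_commute)
    qed
    then have "param f" using f by (simp add: param_def adjoint_pair_def)
    then show "\<Gamma> \<in> graph_on DG ` {\<gamma>. param \<gamma>}" using f(5) by blast
  qed
qed

section \<open>Parametrization of the selfadjoint contractive extensions\<close>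

text \<open>The block matrix without explicit projections: each entry already vanishes off its own
  domain, \<open>D\<close> or \<open>orth D\<close>.\<close>

definition "T_ext \<gamma> x = (a x + dA (g' x)) + (g (dA x) + (dG (\<gamma> (dG x)) - g (a (g' x))))"

lemma T_tilde_graph_on:
  assumes "param \<gamma>" shows "T_tilde T (graph_on DG \<gamma>) = graph_on UNIV (T_ext \<gamma>)"
proof -
  \<comment> \<open>The operator \<open>g\<close> is composed as a graph over \<open>DA\<close>
    only, so \<open>a\<close> has to leave \<open>DA\<close> invariant. It does because it commutes
    with \<open>dA\<close> and is continuous.\<close>
  have aDA: "a y \<in> DA" if "y \<in> DA" for y
  proof -
    obtain w where w: "\<And>n. w n \<in> range dA" "w \<longlonglongrightarrow> y" using \<open>y \<in> DA\<close> unfolding DA_def closure_sequential by blast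
    have "a (w n) \<in> DA" for n using w(1)[of n] a_dA dA_DA by auto
    then show ?thesis using closed_sequentially[OF _ _ contractive_tendsto[OF adjoint_pair_clinear[OF hermitian_a] contractive_a w(2)], of DA] closed_csubspace_DA
      by (auto simp: closed_csubspace_def)
  qed
  have DGE: "DG \<subseteq> orth D"
    unfolding DG_def using closed_csubspace_orth[of D] dG_in by (intro closure_minimal) (auto simp: closed_csubspace_def)
  have 12: "graph_on D dA \<circ>\<^sub>o graph_on (orth D) g' = graph_on (orth D) (\<lambda>x. dA (g' x))"
    by (rule graph_on_comp) (use g'_DA DA_sub in auto)
  have 21: "graph_on DA g \<circ>\<^sub>o graph_on D dA = graph_on D (\<lambda>x. g (dA x))" by (rule graph_on_comp) (use dA_DA in auto)
  have 22: "graph_on DA g \<circ>\<^sub>o graph_on D a \<circ>\<^sub>o graph_on (orth D) g' = graph_on (orth D) (\<lambda>x. g (a (g' x)))"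
  proof -
    have "graph_on D a \<circ>\<^sub>o graph_on (orth D) g' = graph_on (orth D) (\<lambda>x. a (g' x))" by (rule graph_on_comp) (use g'_DA DA_sub in auto)
    then show ?thesis using graph_on_comp[of "\<lambda>x. a (g' x)" "orth D" DA g] g'_DA aDA by auto
  qed
  have 3: "graph_on (orth D) dG \<circ>\<^sub>o graph_on DG \<gamma> \<circ>\<^sub>o graph_on (orth D) dG = graph_on (orth D) (\<lambda>x. dG (\<gamma> (dG x)))"
  proof -
    have "graph_on DG \<gamma> \<circ>\<^sub>o graph_on (orth D) dG = graph_on (orth D) (\<lambda>x. \<gamma> (dG x))" by (rule graph_on_comp) (use dG_DG in auto)
    then show ?thesis using graph_on_comp[of "\<lambda>x. \<gamma> (dG x)" "orth D" "orth D" dG] paramD(4)[OF assms] DGE by auto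
  qed
  show ?thesis
    unfolding T_tilde_def D_Gamma2_adj_graph_on unfolding D_A_graph_on unfolding compr_graph_on Gamma2_graph_on Gamma2_adj_graph_on 12 21 22 3
      graph_on_scale graph_on_add block_op_graph_on[OF closed_csubspace_D]
    by (simp add: T_ext_def[abs_def] a_P dA_P g'_E dG_E scaleC_minus_one)
qed

lemma hermitian_T_ext: "param \<gamma> \<Longrightarrow> hermitian (T_ext \<gamma>)"
  unfolding adjoint_pair_def T_ext_def
  by (simp add: cinner_simps ha hdA hg hg' hdG adjoint_pairD[OF paramD(1)])

text \<open>The row formed by \<open>g\<close> and \<open>dG\<close> has as adjoint the column
  formed by \<open>g'\<close> and \<open>dG\<close>, which is contractive by \<open>norm_dG\<close>.
  The estimate is the duality argument written out at \<open>?z\<close>.\<close>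

lemma row_bound: "(norm (g p + dG q))\<^sup>2 \<le> (norm p)\<^sup>2 + (norm q)\<^sup>2"
proof -
  let ?z = "g p + dG q"
  have am: "x * y \<le> (x\<^sup>2 + y\<^sup>2) / 2" for x y :: real using sum_squares_bound[of x y] by simp
  have lin: "z \<le> x + y" if "z \<le> (x + u) / 2 + (y + v) / 2" "u + v \<le> z" for x y z u v :: real
    using that by argo
  have sum: "(norm (g' ?z))\<^sup>2 + (norm (dG ?z))\<^sup>2 \<le> (norm ?z)\<^sup>2"
    using norm_dG[of ?z] power_mono[OF norm_E_le[of ?z] norm_ge_zero, of 2] by linarith
  have "(norm ?z)\<^sup>2 = Re (cinner (g p + dG q) ?z)" by simp
  also have "\<dots> = Re (cinner p (g' ?z)) + Re (cinner q (dG ?z))" by (simp only: cinner_add_left plus_complex.sel hg hdG)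
  also have "\<dots> \<le> norm p * norm (g' ?z) + norm q * norm (dG ?z)"
    by (intro add_mono Re_cinner_le)
  also have "\<dots> \<le> ((norm p)\<^sup>2 + (norm (g' ?z))\<^sup>2) / 2 + ((norm q)\<^sup>2 + (norm (dG ?z))\<^sup>2) / 2"
    by (intro add_mono am)
  finally show ?thesis using sum by (rule lin)
qed

text \<open>The Julia operator of \<open>a\<close> is unitary.\<close>
lemma julia: "(norm (a x + dA e))\<^sup>2 + (norm (dA x - a e))\<^sup>2 = (norm (P x))\<^sup>2 + (norm (P e))\<^sup>2"
proof -
  have "cinner (a x) (dA e) = cinner (dA x) (a e)" by (simp add: ha hdA a_dA)
  then show ?thesis unfolding norm_add_sq norm_diff_sq norm_dA by simp
qed

lemma contractive_T_ext: assumes "param \<gamma>" shows "contractive (T_ext \<gamma>)"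
  unfolding contractive_def
proof
  fix x
  let ?e = "g' x"
  \<comment> \<open>The component \<open>?u\<close> lies in \<open>D\<close> and \<open>?w\<close>
    in \<open>orth D\<close>. Together with \<open>dA x - a ?e\<close>, \<open>?u\<close> is the
    Julia operator at \<open>(x, ?e)\<close>, and \<open>?w\<close> is the row applied to
    \<open>dA x - a ?e\<close> and \<open>\<gamma> (dG x)\<close>. The squares of \<open>?e\<close>
    and \<open>dG x\<close> add up to that of \<open>x - P x\<close>.\<close>
  let ?u = "a x + dA ?e" and ?w = "g (dA x - a ?e) + dG (\<gamma> (dG x))"
  have T_ext: "T_ext \<gamma> x = ?u + ?w" by (simp add: T_ext_def g_lin)
  have "P ?u = ?u" "P ?w = 0" by (simp_all add: P_lin P_a P_id dA_in P_g P_dG)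
  then have "(norm (T_ext \<gamma> x))\<^sup>2 = (norm ?u)\<^sup>2 + (norm ?w)\<^sup>2"
    using proj_norm_sq[OF closed_csubspace_D, of "T_ext \<gamma> x"] by (simp add: T_ext P_lin(1)[of ?u ?w])
  also have "\<dots> \<le> (norm ?u)\<^sup>2 + ((norm (dA x - a ?e))\<^sup>2 + (norm (\<gamma> (dG x)))\<^sup>2)"
    by (intro add_left_mono row_bound)
  also have "\<dots> \<le> (norm (P x))\<^sup>2 + (norm ?e)\<^sup>2 + (norm (dG x))\<^sup>2"
    using julia[of x ?e] power_mono[OF contractiveD[OF paramD(2)[OF assms], of "dG x"] norm_ge_zero, of 2]
    unfolding P_g' by linarith
  also have "\<dots> = (norm x)\<^sup>2" using norm_dG[of x] proj_norm_sq[OF closed_csubspace_D, of x] by simp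
  finally show "norm (T_ext \<gamma> x) \<le> norm x" by (rule power2_le_imp_le) simp
qed

lemma T_ext_extends: assumes "param \<gamma>" "x \<in> D" shows "T_ext \<gamma> x = t x"
  using assms(2) clinearD(3)[OF adjoint_pair_clinear[OF paramD(1)[OF assms(1)]]]
  by (simp add: T_ext_def g'_D dG_D dA_lin a_lin g_lin dG_lin g_props(3)) (simp add: a_def)

lemma T_ext_form:
  assumes "param \<gamma>" "param \<delta>"
  shows "cinner (T_ext \<gamma> x) y - cinner (T_ext \<delta> x) y = cinner (\<gamma> (dG x)) (dG y) - cinner (\<delta> (dG x)) (dG y)"
  by (simp add: T_ext_def cinner_simps hdG)

text \<open>By \<open>T_ext_form\<close> the comparison only tests the range of \<open>dG\<close>;
  that range is dense in \<open>DG\<close> and the parameters are continuous.\<close>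

lemma T_ext_le_iff:
  assumes c: "param \<gamma>" and d: "param \<delta>"
  shows "(\<forall>x. Re (cinner (T_ext \<gamma> x) x) \<le> Re (cinner (T_ext \<delta> x) x)) \<longleftrightarrow> sa_le (graph_on DG \<gamma>) (graph_on DG \<delta>)"
proof -
  have 1: "Re (cinner (T_ext \<gamma> x) x) \<le> Re (cinner (T_ext \<delta> x) x) \<longleftrightarrow>
    Re (cinner (\<gamma> (dG x)) (dG x)) \<le> Re (cinner (\<delta> (dG x)) (dG x))" for x
    using arg_cong[OF T_ext_form[OF c d, of x x], of Re] by simp linarith
  have "Re (cinner (\<gamma> y) y) \<le> Re (cinner (\<delta> y) y)"
    if le: "\<And>x. Re (cinner (\<gamma> (dG x)) (dG x)) \<le> Re (cinner (\<delta> (dG x)) (dG x))" and y: "y \<in> DG" for y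
  proof -
    obtain w where w: "\<And>n. w n \<in> range dG" "w \<longlonglongrightarrow> y" using y unfolding DG_def closure_sequential by blast
    have lim: "(\<lambda>n. Re (cinner (f (w n)) (w n))) \<longlonglongrightarrow> Re (cinner (f y) y)" if "param f" for f
      by (intro tendsto_Re tendsto_cinner w contractive_tendsto[OF adjoint_pair_clinear[OF paramD(1)[OF that]] paramD(2)[OF that] w(2)])
    have "Re (cinner (\<gamma> (w n)) (w n)) \<le> Re (cinner (\<delta> (w n)) (w n))" for n using w(1)[of n] le by auto
    then show ?thesis using LIMSEQ_le[OF lim[OF c] lim[OF d]] by blast
  qed
  then have "sa_le (graph_on DG \<gamma>) (graph_on DG \<delta>) \<longleftrightarrow>
    (\<forall>x. Re (cinner (\<gamma> (dG x)) (dG x)) \<le> Re (cinner (\<delta> (dG x)) (dG x)))"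
    unfolding sa_le_def graph_on_iff using dG_DG by blast
  then show ?thesis using 1 by simp
qed

lemma T_ext_inj:
  assumes c: "param \<gamma>" and d: "param \<delta>" and eq: "T_ext \<gamma> = T_ext \<delta>"
  shows "graph_on DG \<gamma> = graph_on DG \<delta>"
proof -
  have "\<gamma> (dG x) = \<delta> (dG x)" for x
  proof -
    have "cinner (\<gamma> (dG x) - \<delta> (dG x)) z = 0" if "z \<in> DG" for z
    proof (rule cinner_closure_ext)
      show "z \<in> closure (range dG)" using that by (simp add: DG_def)
      fix y assume "y \<in> range dG"
      then obtain u where "y = dG u" by blast
      then show "cinner (\<gamma> (dG x) - \<delta> (dG x)) y = 0"
        using T_ext_form[OF c d, of x u] by (simp add: eq cinner_diff_left)
    qed
    from this[OF csubspaceD(5)[OF closed_csubspace_csubspace[OF closed_csubspace_DG] paramD(4)[OF c, of "dG x"] paramD(4)[OF d, of "dG x"]]]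
    show ?thesis by (simp add: cinner_self)
  qed
  then show ?thesis unfolding graph_on_eq_iff DG_def
    using eq_on_closure_range[OF adjoint_pair_clinear[OF paramD(1)[OF c]] paramD(2)[OF c] adjoint_pair_clinear[OF paramD(1)[OF d]] paramD(2)[OF d]]
    by blast
qed

text \<open>Minimising the form of \<open>1 - s B\<close> over \<open>h \<in> D\<close>; the minimum is approached at
  \<open>h = u + s a u\<close> with \<open>dA u\<close> tending to \<open>s g' k\<close>.\<close>
lemma schur_complement_bound:
  assumes B: "hermitian B" "contractive B" and Bt: "\<And>x. x \<in> D \<Longrightarrow> B x = t x" and s: "s * s = (1::real)"
    and k: "k \<in> orth D"
  shows "s * (Re (cinner (B k) k) + Re (cinner (a (g' k)) (g' k))) \<le> (norm k)\<^sup>2 - (norm (g' k))\<^sup>2"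
proof -
  let ?e = "g' k"
  note Bl = clinearD[OF adjoint_pair_clinear[OF B(1)]]
  \<comment> \<open>This is the form of 1 - s B at \<open>h + k\<close> for
    \<open>h = P u + s *\<^sub>R a u\<close>, expressed through \<open>v = dA u\<close>. Unlike
    \<open>u\<close>, the variable \<open>v\<close> admits a passage to the limit.\<close>
  define F where "F v = Re (cinner v (v + s *\<^sub>R a v)) - 2 * s * Re (cinner (v + s *\<^sub>R a v) ?e)
      + (norm k)\<^sup>2 - s * Re (cinner (B k) k)" for v
  have abs_s: "\<bar>s\<bar> = 1" using s by (metis abs_1 abs_mult abs_mult_self_eq abs_square_eq_1 power2_eq_square)
  have F: "0 \<le> F (dA u)" for u
  proof -
    define h where "h = P u + s *\<^sub>R a u"
    let ?v = "dA u"
    have hD: "h \<in> D" unfolding h_def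
      by (intro csubspaceD(2,6)[OF closed_csubspace_csubspace[OF closed_csubspace_D]] P_in a_in)
    have "s * Re (cinner (B (h + k)) (h + k)) \<le> \<bar>s\<bar> * \<bar>Re (cinner (B (h + k)) (h + k))\<bar>"
      by (metis abs_ge_self abs_mult)
    also have "\<dots> \<le> norm (B (h + k)) * norm (h + k)"
      unfolding abs_s using norm_cinner_le abs_Re_le_cmod order_trans by (metis mult_1)
    also have "\<dots> \<le> (norm (h + k))\<^sup>2"
      using contractiveD[OF B(2), of "h + k"] by (simp add: power2_eq_square mult_right_mono)
    finally have 1: "s * Re (cinner (B (h + k)) (h + k)) \<le> (norm h)\<^sup>2 + (norm k)\<^sup>2"
      using orthD(2)[OF k hD] by (simp add: norm_add_sq)
    have Bkh: "Re (cinner (B k) h) = Re (cinner (t h) k)"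
      using Bt[OF hD] adjoint_pairD[OF B(1), of k h] Re_cinner_commute by metis
    have 2: "Re (cinner (B (h + k)) (h + k)) = Re (cinner (t h) h) + 2 * Re (cinner (t h) k) + Re (cinner (B k) k)"
      using Bkh Bt[OF hD] by (simp add: Bl cinner_simps)
    have th: "cinner (t h) h = cinner (a h) h" unfolding a_def by (simp add: hP P_id[OF hD])
    have dAh: "dA h = ?v + s *\<^sub>R a ?v" unfolding h_def by (simp add: dA_lin dA_P a_dA)
    have tk: "cinner (t h) k = cinner (?v + s *\<^sub>R a ?v) ?e"
    proof -
      have "cinner (t h) k = cinner (t h - P (t h)) k"
        using orthD(2)[OF k P_in, of "t h"] by (simp add: cinner_diff_left)
      also have "\<dots> = cinner (dA h) ?e" by (simp add: g_props(3)[symmetric] hg)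
      finally show ?thesis by (simp only: dAh)
    qed
    \<comment> \<open>The shape of \<open>h\<close> is chosen for this: on \<open>D\<close>, the
      product of 1 - s a and 1 + s a is 1 - a a, because \<open>s * s = 1\<close>.\<close>
    have "h - s *\<^sub>R a h = dA ?v"
      unfolding h_def dA_sq by (simp add: a_lin a_P scaleR_add_right s)
    then have "cinner (h - s *\<^sub>R a h) h = cinner ?v (?v + s *\<^sub>R a ?v)" by (simp add: hdA dAh)
    then have "(norm h)\<^sup>2 - s * Re (cinner (a h) h) = Re (cinner ?v (?v + s *\<^sub>R a ?v))"
      by (metis (no_types, lifting) Re_cinner_self cinner_diff_left cinner_scaleR_left minus_complex.sel(1) Re_complex_of_real times_complex.sel(1) Im_complex_of_real mult_zero_left diff_zero)
    then show ?thesis using 1 unfolding F_def 2 th tk by (simp add: algebra_simps)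
  qed
  \<comment> \<open>The minimiser \<open>s *\<^sub>R ?e\<close> lies in \<open>DA\<close> but need
    not be of the form \<open>dA u\<close>, so it is only approximated.\<close>
  obtain w where w: "\<And>n. w n \<in> range dA" "w \<longlonglongrightarrow> s *\<^sub>R ?e"
    using csubspaceD(6)[OF closed_csubspace_csubspace[OF closed_csubspace_DA] g'_DA, of s k] unfolding DA_def closure_sequential by blast
  have aw: "(\<lambda>n. a (w n)) \<longlonglongrightarrow> a (s *\<^sub>R ?e)"
    by (rule contractive_tendsto[OF adjoint_pair_clinear[OF hermitian_a] contractive_a w(2)])
  have "(\<lambda>n. F (w n)) \<longlonglongrightarrow> F (s *\<^sub>R ?e)" unfolding F_def
    by (intro tendsto_intros tendsto_cinner w aw)
  moreover have "0 \<le> F (w n)" for n using w(1)[of n] F by auto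
  ultimately have "0 \<le> F (s *\<^sub>R ?e)"
    by (intro LIMSEQ_le_const) auto
  moreover have "F (s *\<^sub>R ?e) = - ((norm ?e)\<^sup>2 + s * Re (cinner (a ?e) ?e)) + (norm k)\<^sup>2 - s * Re (cinner (B k) k)"
  proof -
    have ss: "s * (s * r) = r" for r using s by (simp add: mult.assoc[symmetric])
    have "s *\<^sub>R a (s *\<^sub>R ?e) = a ?e" by (simp add: a_lin s)
    moreover have "Re (cinner (s *\<^sub>R ?e) (s *\<^sub>R ?e + a ?e)) = (norm ?e)\<^sup>2 + s * Re (cinner (a ?e) ?e)"
      by (simp add: cinner_simps ha ss)
    moreover have "2 * s * Re (cinner (s *\<^sub>R ?e + a ?e) ?e) = 2 * ((norm ?e)\<^sup>2 + s * Re (cinner (a ?e) ?e))"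
      by (simp add: cinner_simps ss distrib_left)
    ultimately show ?thesis unfolding F_def by simp
  qed
  ultimately show ?thesis by (simp add: algebra_simps)
qed

lemma T_ext_surj:
  assumes B: "hermitian B" "contractive B" and Bt: "\<And>x. x \<in> D \<Longrightarrow> B x = t x"
  obtains \<gamma> where "param \<gamma>" "B = T_ext \<gamma>"
proof -
  note Bl = clinearD[OF adjoint_pair_clinear[OF B(1)]]
  \<comment> \<open>The lower right block of \<open>B\<close> plus \<open>g a g'\<close>, extended
    by zero to \<open>D\<close>.\<close>
  define N where "N x = (B (x - P x) - P (B (x - P x))) + g (a (g' x))" for x
  have hN: "hermitian N" unfolding adjoint_pair_def N_def
    by (simp add: cinner_simps Bl P_lin hg hg' ha hP adjoint_pairD[OF B(1)])
  have form: "cinner (N x) x = cinner (B (x - P x)) (x - P x) + cinner (a (g' x)) (g' x)" for x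
    unfolding N_def by (simp add: cinner_simps hg hP)
  \<comment> \<open>The signs 1 and -1 bound the form of \<open>N\<close> from above and from below,
    as \<open>hermitian_form_bound\<close> demands.\<close>
  have "\<bar>Re (cinner (N x) x)\<bar> \<le> (norm (dG x))\<^sup>2" for x
    using schur_complement_bound[OF B Bt _ E_in, of 1 x] schur_complement_bound[OF B Bt _ E_in, of "-1" x]
    unfolding form norm_dG by (simp add: g'_E)
  from hermitian_form_bound[OF hN adjoint_pair_clinear[OF hermitian_dG] this]
  obtain \<gamma> where c: "hermitian \<gamma>" "contractive \<gamma>" "\<And>x. \<gamma> (proj DG x) = \<gamma> x" and N: "\<And>x. N x = dG (\<gamma> (dG x))"
    using form_factorization[OF hN hermitian_dG contractive_dG] unfolding DG_def by metis
  have "B x = T_ext \<gamma> x" for x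
  proof -
    let ?k = "x - P x"
    \<comment> \<open>Hermiticity determines the upper right block as the adjoint of the lower left
      one, which is read off from \<open>t\<close>.\<close>
    have "P (B ?k) = dA (g' x)"
    proof (rule cinner_eqI)
      fix y
      have "cinner (P (B ?k)) y = cinner ?k (t y)"
        using Bt[OF P_in[of y]] by (simp add: hP adjoint_pairD[OF B(1)] t_P)
      also have "\<dots> = cinner ?k (t y - P (t y))"
        using orthD(1)[OF E_in P_in, of x "t y"] by (simp add: cinner_diff_right[of ?k])
      also have "\<dots> = cinner (dA (g' x)) y"
        by (simp add: g_props(3)[symmetric] hdA hg'[symmetric] g'_E)
      finally show "cinner (P (B ?k)) y = cinner (dA (g' x)) y" .
    qed
    moreover have "B ?k - P (B ?k) = dG (\<gamma> (dG x)) - g (a (g' x))"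
      using N[of x] unfolding N_def by (simp add: algebra_simps)
    ultimately have "B ?k = dA (g' x) + (dG (\<gamma> (dG x)) - g (a (g' x)))" by (simp add: algebra_simps)
    moreover have "B (P x) = a x + g (dA x)" using Bt[OF P_in] by (simp add: t_P g_props(3) a_def)
    moreover have "B x = B (P x) + B ?k" by (simp add: Bl)
    ultimately show ?thesis by (simp add: T_ext_def)
  qed
  then have "B = T_ext \<gamma>" by (rule ext)
  moreover have "param \<gamma>" using c by (simp add: param_def)
  ultimately show thesis using that by blast
qed

end

section \<open>Strong resolvent convergence\<close>

lemma closed_range_bounded_below:
  assumes f: "clinear f" and cont: "\<And>u l. u \<longlonglongrightarrow> l \<Longrightarrow> (\<lambda>n. f (u n)) \<longlonglongrightarrow> f l"
    and K: "\<And>v. norm v \<le> K * norm (f v)" "K > 0"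
  shows "closed (range f)"
  unfolding closed_sequential_limits
proof (intro allI impI, elim conjE)
  fix y l assume y: "\<forall>n. y n \<in> range f" and l: "y \<longlonglongrightarrow> l"
  then have "\<forall>n. \<exists>v. y n = f v" by blast
  then obtain v where v: "\<And>n. y n = f (v n)" by metis
  have "Cauchy v"
  proof (rule metric_CauchyI)
    fix e :: real assume "e > 0"
    then obtain N where N: "\<forall>m\<ge>N. \<forall>n\<ge>N. dist (y m) (y n) < e / K"
      using metric_CauchyD[OF LIMSEQ_imp_Cauchy[OF l], of "e / K"] K(2) by auto
    have "dist (v m) (v n) < e" if "m \<ge> N" "n \<ge> N" for m n
    proof -
      have "dist (v m) (v n) \<le> K * dist (y m) (y n)"
        using K(1)[of "v m - v n"] by (simp add: dist_norm v clinearD[OF f])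
      also have "\<dots> < e" using N that K(2) by (simp add: pos_less_divide_eq mult.commute)
      finally show ?thesis .
    qed
    then show "\<exists>M. \<forall>m\<ge>M. \<forall>n\<ge>M. dist (v m) (v n) < e" by blast
  qed
  then obtain w where "v \<longlonglongrightarrow> w" using Cauchy_convergent convergent_def by blast
  from cont[OF this] have "y \<longlonglongrightarrow> f w" by (simp add: v[symmetric])
  then have "l = f w" using l LIMSEQ_unique by blast
  then show "l \<in> range f" by blast
qed

text \<open>For R = \<open>inv_cayley B\<close>, this is z - R evaluated at the domain element
  \<open>v + B v\<close>.\<close>

definition shifted :: "('a::chilbert_space \<Rightarrow> 'a) \<Rightarrow> complex \<Rightarrow> 'a \<Rightarrow> 'a" where
  "shifted B z v = z *\<^sub>C (v + B v) - (v - B v)"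

lemma resolvent_inv_cayley: "resolvent (inv_cayley B) z = {(shifted B z v, v + B v) |v. True}"
  unfolding resolvent_def op_diff_def op_scale_def inv_cayley_def shifted_def by auto

lemma adjoint_pair_shifted: "hermitian B \<Longrightarrow> adjoint_pair (shifted B z) (shifted B (cnj z))"
  unfolding adjoint_pair_def shifted_def by (simp add: cinner_simps adjoint_pair_def)

text \<open>The product of R y with y is real, so the imaginary part of the product of (z - R) y
  with y is that of \<open>z\<close> times the squared norm of y. This is the usual resolvent
  estimate, in the parameter \<open>v\<close>.\<close>

lemma shifted_bound:
  assumes B: "hermitian B" and z: "z \<notin> \<real>"
  shows "norm (v + B v) \<le> norm (shifted B z v) / \<bar>Im z\<bar>"
proof -
  let ?y = "v + B v"
  have Imz: "\<bar>Im z\<bar> > 0" using z by (auto simp: complex_is_Real_iff)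
  have "cinner (B v) v = cinner v (B v)" by (rule adjoint_pairD[OF B])
  then have "cinner (v - B v) ?y = of_real ((norm v)\<^sup>2 - (norm (B v))\<^sup>2)"
    by (simp add: cinner_simps cinner_self)
  then have "Im (cinner (shifted B z v) ?y) = Im z * (norm ?y)\<^sup>2"
    unfolding shifted_def cinner_diff_left cinner_scaleC_left cinner_self[of ?y] by simp
  then have "\<bar>Im z\<bar> * (norm ?y)\<^sup>2 = \<bar>Im (cinner (shifted B z v) ?y)\<bar>" by (simp add: abs_mult)
  also have "\<dots> \<le> norm (shifted B z v) * norm ?y"
    using abs_Im_le_cmod norm_cinner_le order_trans by blast
  finally have "\<bar>Im z\<bar> * norm ?y * norm ?y \<le> norm (shifted B z v) * norm ?y"
    by (simp add: power2_eq_square mult.assoc)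
  then have "\<bar>Im z\<bar> * norm ?y \<le> norm (shifted B z v)"
    by (cases "norm ?y = 0") (auto dest: mult_right_le_imp_le)
  then show ?thesis using Imz by (simp add: pos_le_divide_eq mult.commute)
qed

text \<open>The range is closed because the map is bounded below, and dense because the adjoint
  belongs to \<open>cnj z\<close>, which is not real either, and so has trivial kernel.\<close>

lemma shifted_surj:
  assumes B: "is_cayley_transform B" and z: "z \<notin> \<real>"
  shows "range (shifted B z) = UNIV"
proof -
  note h = is_cayley_transformD(1)[OF B]
  note Bl = adjoint_pair_clinear[OF h] and sl = adjoint_pair_clinear[OF adjoint_pair_shifted[OF h]]
  have Imz: "\<bar>Im z\<bar> > 0" using z by (auto simp: complex_is_Real_iff)
  define K where "K = (1 + norm z) / \<bar>Im z\<bar> + 1"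
  have "closed (range (shifted B z))"
  proof (rule closed_range_bounded_below[OF sl])
    show "(\<lambda>n. shifted B z (u n)) \<longlonglongrightarrow> shifted B z l" if u: "u \<longlonglongrightarrow> l" for u l
    proof -
      have "(\<lambda>n. B (u n)) \<longlonglongrightarrow> B l" by (rule contractive_tendsto[OF Bl is_cayley_transformD(2)[OF B] u])
      then show ?thesis unfolding shifted_def by (intro tendsto_diff tendsto_scaleC tendsto_add u)
    qed
    show "K > 0" using Imz unfolding K_def by (intro add_nonneg_pos divide_nonneg_pos) auto
    fix v
    let ?y = "v + B v"
    \<comment> \<open>This identity controls \<open>v\<close> by \<open>?y\<close> and the shifted
      vector; inserting \<open>shifted_bound\<close> for \<open>?y\<close> produces the constant
      \<open>K\<close>.\<close>
    have "2 *\<^sub>R v = ?y + z *\<^sub>C ?y - shifted B z v" unfolding shifted_def by (simp add: scaleR_2)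
    then have "2 * norm v = norm (?y + z *\<^sub>C ?y - shifted B z v)" by (metis norm_scaleR abs_numeral)
    also have "\<dots> \<le> norm ?y + norm (z *\<^sub>C ?y) + norm (shifted B z v)"
      by (intro norm_triangle_le_diff add_right_mono norm_triangle_ineq)
    also have "\<dots> = (1 + norm z) * norm ?y + norm (shifted B z v)" by (simp add: norm_scaleC distrib_right)
    also have "\<dots> \<le> (1 + norm z) * (norm (shifted B z v) / \<bar>Im z\<bar>) + norm (shifted B z v)"
      by (intro add_right_mono mult_left_mono shifted_bound h z) simp
    also have "\<dots> = K * norm (shifted B z v)" by (simp add: K_def distrib_right)
    finally show "norm v \<le> K * norm (shifted B z v)" using norm_ge_zero[of v] by linarith
  qed
  moreover have "closure (range (shifted B z)) = UNIV"
  proof (rule dense_iff_orth[OF csubspace_range[OF sl]])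
    fix x assume "x \<in> orth (range (shifted B z))"
    then have "cinner (shifted B (cnj z) x) v = cinner 0 v" for v
      using adjoint_pairD[OF adjoint_pair_sym[OF adjoint_pair_shifted[OF h, of z]], of x v] by (simp add: orth_def)
    then have "shifted B (cnj z) x = 0" by (rule cinner_eqI)
    moreover have "cnj z \<notin> \<real>" using z by (simp add: complex_is_Real_iff)
    ultimately have "norm (x + B x) \<le> 0" using shifted_bound[OF h, of "cnj z" x] by simp
    then have "x + B x = 0" by simp
    then show "x = 0" by (rule is_cayley_transformD(3)[OF B])
  qed
  ultimately show ?thesis by simp
qed

lemma ap_resolvent_inv_cayley:
  assumes B: "is_cayley_transform B" and z: "z \<notin> \<real>"
  shows "ap (resolvent (inv_cayley B) z) (shifted B z v) = v + B v"
proof (rule ap_eqI)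
  note h = is_cayley_transformD(1)[OF B]
  note sl = clinearD[OF adjoint_pair_clinear[OF adjoint_pair_shifted[OF h]]] and Bl = clinearD[OF adjoint_pair_clinear[OF h]]
  show "(shifted B z v, v + B v) \<in> resolvent (inv_cayley B) z" unfolding resolvent_inv_cayley by blast
  have "v + B v = w + B w" if "shifted B z v = shifted B z w" for v w
  proof -
    have "shifted B z (v - w) = 0" using that by (simp add: sl)
    then have "norm ((v - w) + B (v - w)) \<le> 0" using shifted_bound[OF h z, of "v - w"] by simp
    then show ?thesis by (simp add: Bl algebra_simps)
  qed
  note inj = this
  show "single_valued (resolvent (inv_cayley B) z)"
    unfolding resolvent_inv_cayley
  proof (rule single_valuedI)
    fix x y y'
    assume "(x, y) \<in> {(shifted B z v, v + B v) |v. True}" "(x, y') \<in> {(shifted B z v, v + B v) |v. True}"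
    then obtain v w where "x = shifted B z v" "y = v + B v" "x = shifted B z w" "y' = w + B w" by blast
    then show "y = y'" using inj[of v w] by simp
  qed
qed

text \<open>The parameter \<open>v\<close> of the limit is kept fixed. The shifted image of
  \<open>w n - v\<close> is \<open>\<xi> - shifted (Bn n) z v\<close>, which tends to zero by
  pointwise convergence, and the resolvent estimate transfers this with a factor independent of
  \<open>n\<close>.\<close>

lemma strong_resolvent_conv_inv_cayley:
  assumes Bn: "\<And>n. is_cayley_transform (Bn n)" and B: "is_cayley_transform B" and lim: "\<And>v. (\<lambda>n. Bn n v) \<longlonglongrightarrow> B v"
  shows "strong_resolvent_conv (\<lambda>n. inv_cayley (Bn n)) (inv_cayley B)"
  unfolding strong_resolvent_conv_def
proof (intro allI impI)
  fix z :: complex and \<xi> :: 'a assume z: "z \<notin> \<real>"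
  obtain v where v: "\<xi> = shifted B z v" using shifted_surj[OF B z] by blast
  have "\<exists>w. \<xi> = shifted (Bn n) z w" for n using shifted_surj[OF Bn z, of n] by blast
  then obtain w where w: "\<And>n. \<xi> = shifted (Bn n) z (w n)" by metis
  have 1: "ap (resolvent (inv_cayley (Bn n)) z) \<xi> = w n + Bn n (w n)" for n
    using ap_resolvent_inv_cayley[OF Bn z, of n "w n"] w[of n] by simp
  have 2: "ap (resolvent (inv_cayley B) z) \<xi> = v + B v"
    using ap_resolvent_inv_cayley[OF B z, of v] v by simp
  have s: "(\<lambda>n. shifted (Bn n) z v) \<longlonglongrightarrow> \<xi>"
    unfolding v shifted_def by (intro tendsto_diff tendsto_scaleC tendsto_add tendsto_const lim)
  have "(\<lambda>n. (w n + Bn n (w n)) - (v + Bn n v)) \<longlonglongrightarrow> 0"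
  proof (rule Lim_null_comparison)
    show "\<forall>\<^sub>F n in sequentially. norm ((w n + Bn n (w n)) - (v + Bn n v))
        \<le> norm (\<xi> - shifted (Bn n) z v) / \<bar>Im z\<bar>"
    proof (rule always_eventually, rule allI)
      fix n
      note h = is_cayley_transformD(1)[OF Bn[of n]]
      have "(w n + Bn n (w n)) - (v + Bn n v) = (w n - v) + Bn n (w n - v)"
        by (simp add: clinearD[OF adjoint_pair_clinear[OF h]])
      moreover have "\<xi> - shifted (Bn n) z v = shifted (Bn n) z (w n - v)"
        using w[of n] by (simp add: clinearD[OF adjoint_pair_clinear[OF adjoint_pair_shifted[OF h]]])
      ultimately show "norm ((w n + Bn n (w n)) - (v + Bn n v)) \<le> norm (\<xi> - shifted (Bn n) z v) / \<bar>Im z\<bar>"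
        using shifted_bound[OF h z, of "w n - v"] by (simp only:)
    qed
    have "(\<lambda>n. norm (\<xi> - shifted (Bn n) z v) / \<bar>Im z\<bar>) \<longlonglongrightarrow> norm (\<xi> - \<xi>) / \<bar>Im z\<bar>"
      using z by (intro tendsto_intros s) (auto simp: complex_is_Real_iff)
    then show "(\<lambda>n. norm (\<xi> - shifted (Bn n) z v) / \<bar>Im z\<bar>) \<longlonglongrightarrow> 0" by simp
  qed
  from tendsto_add[OF this tendsto_add[OF tendsto_const[of v] lim[of v]]]
  show "(\<lambda>n. ap (resolvent (inv_cayley (Bn n)) z) \<xi>) \<longlonglongrightarrow> ap (resolvent (inv_cayley B) z) \<xi>"
    unfolding 1 2 by simp
qed

section \<open>Positive selfadjoint extensions\<close>

lemma inv_cayley_inject: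
  assumes "clinear B" "clinear B'" "inv_cayley B = inv_cayley B'" shows "B = B'"
proof
  fix v
  have "(v + B v, v - B v) \<in> inv_cayley B'" using assms(3) unfolding inv_cayley_def by blast
  then have "B' ((v + B v) + (v - B v)) = (v + B v) - (v - B v)" unfolding inv_cayley_iff[OF assms(2)] .
  moreover have "(v + B v) + (v - B v) = 2 *\<^sub>R v" "(v + B v) - (v - B v) = 2 *\<^sub>R B v"
    by (simp_all add: scaleR_2)
  ultimately have "2 *\<^sub>R B' v = 2 *\<^sub>R B v" by (simp only: clinearD(6)[OF assms(2)])
  then show "B v = B' v" by simp
qed

text \<open>On the graph of \<open>S\<close>, \<open>t (x + y)\<close> is \<open>x - y\<close>, and
  membership in \<open>inv_cayley B\<close> is the same equation for \<open>B\<close>. Extending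
  \<open>S\<close> therefore means extending its Cayley transform.\<close>

lemma inv_cayley_extends_iff:
  assumes "single_valued S" "clinear B" and T: "cayley S = graph_on (Domain (cayley S)) t"
  shows "S \<subseteq> inv_cayley B \<longleftrightarrow> (\<forall>x\<in>Domain (cayley S). B x = t x)"
proof -
  have mem: "t (x + y) = x - y" if "(x, y) \<in> S" for x y
  proof -
    have "(x + y, x - y) \<in> cayley S" using that cayley_graph[OF assms(1)] by blast
    then show ?thesis by (subst (asm) T) (simp add: graph_on_iff)
  qed
  have "S \<subseteq> inv_cayley B \<longleftrightarrow> (\<forall>x y. (x, y) \<in> S \<longrightarrow> B (x + y) = t (x + y))"
    unfolding subset_iff split_paired_All inv_cayley_iff[OF assms(2)] using mem by simp
  then show ?thesis unfolding Domain_cayley[OF assms(1)] by blast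
qed

lemma extension_is_cayley_transform:
  assumes S: "positive_op UNIV S" and B: "hermitian B" "contractive B" and ext: "S \<subseteq> inv_cayley B"
  shows "is_cayley_transform B"
  unfolding is_cayley_transform_def
proof (intro conjI allI impI B)
  fix v assume v: "v + B v = 0"
  have *: "cinner v x = 0" if "x \<in> Domain S" for x
  proof -
    obtain w where "x = w + B w" using ext \<open>x \<in> Domain S\<close> unfolding inv_cayley_def by blast
    then have "cinner v x = cinner (v + B v) w" by (simp add: cinner_simps adjoint_pairD[OF B(1)])
    then show ?thesis by (simp add: v)
  qed
  have "cinner v v = 0"
    by (rule cinner_closure_ext[of "Domain S"]) (use * positive_opD(5)[OF S] in auto)
  then show "v = 0" by (simp add: cinner_self)
qed

text \<open>The a priori constant \<open>K\<close> bounds the set whose supremum is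
  \<open>op_norm\<close>; only then does \<open>Sup\<close> dominate its elements.\<close>

lemma op_norm_bound:
  assumes f: "clinear f" and K: "\<And>x. norm (f x) \<le> K * norm x" and M: "csubspace M" and x: "x \<in> M" and "K \<ge> 0"
  shows "norm (f x) \<le> op_norm (graph_on M f) * norm x"
proof (cases "x = 0")
  case False
  let ?A = "{norm y |x y. (x, y) \<in> graph_on M f \<and> norm x \<le> 1}"
  let ?u = "inverse (norm x) *\<^sub>R x"
  have "norm (f ?u) \<in> ?A"
    using False csubspaceD(6)[OF M x] by (auto simp: graph_on_iff intro!: exI[of _ ?u])
  moreover have "bdd_above ?A"
  proof (rule bdd_aboveI[of _ K])
    fix r assume "r \<in> ?A"
    then obtain u where "r = norm (f u)" "norm u \<le> 1" by (auto simp: graph_on_iff)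
    then show "r \<le> K" using K[of u] mult_left_mono[of "norm u" 1 K] \<open>K \<ge> 0\<close> by simp
  qed
  ultimately have "norm (f ?u) \<le> op_norm (graph_on M f)" unfolding op_norm_def by (rule cSup_upper)
  then have "inverse (norm x) * norm (f x) \<le> op_norm (graph_on M f)" by (simp add: clinearD[OF f])
  then show ?thesis using False by (simp add: field_simps)
qed (use clinearD(3)[OF f] in simp)

context symmetric_contraction
begin

lemma param_proj: "param (proj DG)" "param (\<lambda>x. - proj DG x)"
  unfolding param_def using hermitian_proj[OF closed_csubspace_DG] contractive_proj[OF closed_csubspace_DG]
  by (auto simp: adjoint_pair_def contractive_def cinner_simps proj_id closed_csubspace_DG proj_in)

lemma graph_on_proj: "Id_on DG = graph_on DG (proj DG)" "(-1) \<cdot>\<^sub>o Id_on DG = graph_on DG (\<lambda>x. - proj DG x)"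
  unfolding Id_on_graph_on graph_on_scale graph_on_eq_iff by (auto simp: proj_id closed_csubspace_DG scaleC_minus_one)

lemma sa_le_extremal:
  assumes "param \<gamma>"
  shows "sa_le (graph_on DG \<gamma>) (graph_on DG (proj DG))" "sa_le (graph_on DG (\<lambda>x. - proj DG x)) (graph_on DG \<gamma>)"
proof -
  have "\<bar>Re (cinner (\<gamma> x) x)\<bar> \<le> (norm x)\<^sup>2" for x
    using abs_Re_le_cmod[of "cinner (\<gamma> x) x"] norm_cinner_le[of "\<gamma> x" x]
      mult_right_mono[OF contractiveD[OF paramD(2)[OF assms], of x] norm_ge_zero[of x]]
    by (simp add: power2_eq_square)
  then have "Re (cinner (\<gamma> x) x) \<le> (norm x)\<^sup>2" "- (norm x)\<^sup>2 \<le> Re (cinner (\<gamma> x) x)" for x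
    by (simp_all add: abs_le_iff minus_le_iff)
  then show "sa_le (graph_on DG \<gamma>) (graph_on DG (proj DG))" "sa_le (graph_on DG (\<lambda>x. - proj DG x)) (graph_on DG \<gamma>)"
    unfolding sa_le_def graph_on_iff by (auto simp: proj_id closed_csubspace_DG cinner_simps)
qed

text \<open>Only the block \<open>dG\<close>, \<open>\<gamma>\<close>, \<open>dG\<close> varies, so
  convergence is needed at the single vector \<open>dG v\<close>. A difference of two contractions
  is bounded by 2, the a priori constant for \<open>op_norm_bound\<close>.\<close>

lemma T_ext_tendsto:
  assumes c: "\<And>n. param (\<gamma>s n)" and d: "param \<gamma>"
    and lim: "(\<lambda>n. op_norm (graph_on DG (\<gamma>s n) -\<^sub>o graph_on DG \<gamma>)) \<longlonglongrightarrow> 0"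
  shows "(\<lambda>n. T_ext (\<gamma>s n) v) \<longlonglongrightarrow> T_ext \<gamma> v"
proof -
  have "(\<lambda>n. \<gamma>s n (dG v) - \<gamma> (dG v)) \<longlonglongrightarrow> 0"
  proof (rule Lim_null_comparison)
    show "\<forall>\<^sub>F n in sequentially. norm (\<gamma>s n (dG v) - \<gamma> (dG v))
        \<le> op_norm (graph_on DG (\<gamma>s n) -\<^sub>o graph_on DG \<gamma>) * norm (dG v)"
    proof (rule always_eventually, rule allI)
      fix n
      note cl = clinearD[OF adjoint_pair_clinear[OF paramD(1)[OF c[of n]]]] and dl = clinearD[OF adjoint_pair_clinear[OF paramD(1)[OF d]]]
      have "norm (\<gamma>s n x - \<gamma> x) \<le> 2 * norm x" for x
        using norm_triangle_ineq4[of "\<gamma>s n x" "\<gamma> x"] contractiveD[OF paramD(2)[OF c[of n]], of x]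
          contractiveD[OF paramD(2)[OF d], of x] by linarith
      moreover have "clinear (\<lambda>x. \<gamma>s n x - \<gamma> x)" unfolding clinear_def by (simp add: cl dl scaleC_diff_right)
      ultimately show "norm (\<gamma>s n (dG v) - \<gamma> (dG v)) \<le> op_norm (graph_on DG (\<gamma>s n) -\<^sub>o graph_on DG \<gamma>) * norm (dG v)"
        unfolding graph_on_diff by (intro op_norm_bound[where K = 2] closed_csubspace_csubspace closed_csubspace_DG dG_DG) auto
    qed
    show "(\<lambda>n. op_norm (graph_on DG (\<gamma>s n) -\<^sub>o graph_on DG \<gamma>) * norm (dG v)) \<longlonglongrightarrow> 0"
      using tendsto_mult_left_zero[OF lim] by simp
  qed
  from contractive_tendsto[OF adjoint_pair_clinear[OF hermitian_dG] contractive_dG Lim_null[THEN iffD2, OF this]]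
  have "(\<lambda>n. dG (\<gamma>s n (dG v))) \<longlonglongrightarrow> dG (\<gamma> (dG v))" .
  then show ?thesis unfolding T_ext_def by (intro tendsto_add tendsto_diff tendsto_const)
qed

end

theorem theorem3p3:
  fixes S :: "'a::chilbert_space rel"
  assumes "positive_op UNIV S" and "closed S"
  shows "(\<forall>\<Gamma>\<in>sa_contractions (cayley S).
            Domain (T_tilde (cayley S) \<Gamma>) = UNIV \<and> single_valued (T_tilde (cayley S) \<Gamma>) \<and>
            single_valued ((Id +\<^sub>o T_tilde (cayley S) \<Gamma>)\<inverse>) \<and>
            Domain (S_tilde S \<Gamma>) = Range (Id +\<^sub>o T_tilde (cayley S) \<Gamma>))
    \<and> bij_betw (S_tilde S) (sa_contractions (cayley S)) (pos_sa_extensions S)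
    \<and> (\<forall>\<Gamma>s \<Gamma>. (\<forall>n::nat. \<Gamma>s n \<in> sa_contractions (cayley S)) \<longrightarrow>
            \<Gamma> \<in> sa_contractions (cayley S) \<longrightarrow>
            (\<lambda>n. op_norm (\<Gamma>s n -\<^sub>o \<Gamma>)) \<longlonglongrightarrow> 0 \<longrightarrow>
            strong_resolvent_conv (\<lambda>n. S_tilde S (\<Gamma>s n)) (S_tilde S \<Gamma>))
    \<and> (\<forall>\<Gamma>'\<in>sa_contractions (cayley S). \<forall>\<Gamma>''\<in>sa_contractions (cayley S).
            sa_le \<Gamma>' \<Gamma>'' \<longleftrightarrow> form_le (S_tilde S \<Gamma>'') (S_tilde S \<Gamma>'))
    \<and> S_K S \<in> pos_sa_extensions S \<and> S_F S \<in> pos_sa_extensions S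
    \<and> form_le (S_K S) (S_F S)
    \<and> (\<forall>R. positive_selfadjoint UNIV R \<longrightarrow>
            (R \<in> pos_sa_extensions S \<longleftrightarrow> form_le (S_K S) R \<and> form_le R (S_F S)))"
proof -
  note S = assms(1)
  have sv: "single_valued S" by (rule linear_opD(1)[OF positive_opD(1)[OF S]])
  obtain t where t: "clinear t" "contractive t" "\<And>x. t (proj (Domain (cayley S)) x) = t x"
    "cayley S = graph_on (Domain (cayley S)) t"
    using cayley_hermitian_repr[OF assms] by blast
  interpret symmetric_contraction "cayley S" t
    by (intro symmetric_contraction.intro t cayley_symmetric_contraction[OF assms])
  note sa = sa_contractions_eq
  have St: "S_tilde S (graph_on DG \<gamma>) = inv_cayley (T_ext \<gamma>)" if "param \<gamma>" for \<gamma>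
    unfolding S_tilde_def T_tilde_graph_on[OF that] by (rule cayley_graph_on)
  have sub: "S \<subseteq> inv_cayley (T_ext \<gamma>)" if "param \<gamma>" for \<gamma>
    using inv_cayley_extends_iff[OF sv adjoint_pair_clinear[OF hermitian_T_ext[OF that]] t(4)] T_ext_extends[OF that] by blast
  have co: "is_cayley_transform (T_ext \<gamma>)" if "param \<gamma>" for \<gamma>
    by (rule extension_is_cayley_transform[OF S hermitian_T_ext[OF that] contractive_T_ext[OF that] sub[OF that]])
  have ext: "inv_cayley (T_ext \<gamma>) \<in> pos_sa_extensions S" if "param \<gamma>" for \<gamma>
    using inv_cayley_pos_sa[OF co[OF that]] sub[OF that] by (simp add: pos_sa_extensions_def)
  have le: "form_le (inv_cayley (T_ext \<delta>)) (inv_cayley (T_ext \<gamma>)) \<longleftrightarrow> sa_le (graph_on DG \<gamma>) (graph_on DG \<delta>)"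
    if "param \<gamma>" "param \<delta>" for \<gamma> \<delta>
    unfolding form_le_inv_cayley[OF co[OF that(2)] co[OF that(1)]] by (rule T_ext_le_iff[OF that])
  have surj: "\<exists>\<gamma>. param \<gamma> \<and> R = inv_cayley (T_ext \<gamma>)" if R: "R \<in> pos_sa_extensions S" for R
  proof -
    obtain B where B: "is_cayley_transform B" "R = inv_cayley B"
      using R pos_sa_inv_cayley[of R] unfolding pos_sa_extensions_def by blast
    have "B x = t x" if "x \<in> D" for x
      using inv_cayley_extends_iff[OF sv adjoint_pair_clinear[OF is_cayley_transformD(1)[OF B(1)]] t(4)] R B(2) that
      unfolding pos_sa_extensions_def by blast
    then obtain \<gamma> where "param \<gamma>" "B = T_ext \<gamma>" using T_ext_surj[OF is_cayley_transformD(1,2)[OF B(1)]] by blast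
    then show ?thesis using B(2) by blast
  qed
  let ?K = "proj DG" and ?F = "\<lambda>x. - proj DG x"
  have K: "S_K S = inv_cayley (T_ext ?K)" and F: "S_F S = inv_cayley (T_ext ?F)"
    unfolding S_K_def S_F_def D_Gamma2_adj_space_eq graph_on_proj(2) using St[OF param_proj(1)] St[OF param_proj(2)]
    by (simp_all only: graph_on_proj(1))
  have 1: "Domain (T_tilde (cayley S) \<Gamma>) = UNIV \<and> single_valued (T_tilde (cayley S) \<Gamma>) \<and>
      single_valued ((Id +\<^sub>o T_tilde (cayley S) \<Gamma>)\<inverse>) \<and>
      Domain (S_tilde S \<Gamma>) = Range (Id +\<^sub>o T_tilde (cayley S) \<Gamma>)"
    if \<Gamma>: "\<Gamma> \<in> sa_contractions (cayley S)" for \<Gamma>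
  proof -
    obtain \<gamma> where c: "param \<gamma>" "\<Gamma> = graph_on DG \<gamma>" using \<Gamma> unfolding sa by blast
    note TTl = clinearD[OF adjoint_pair_clinear[OF hermitian_T_ext[OF c(1)]]]
    have "v = w" if "v + T_ext \<gamma> v = w + T_ext \<gamma> w" for v w
    proof -
      have "(v - w) + T_ext \<gamma> (v - w) = 0" using that by (simp add: TTl algebra_simps)
      then have "v - w = 0" by (rule is_cayley_transformD(3)[OF co[OF c(1)]])
      then show ?thesis by simp
    qed
    then have "single_valued ((Id +\<^sub>o graph_on UNIV (T_ext \<gamma>))\<inverse>)"
      unfolding Id_graph_on graph_on_add single_valued_def converse_iff graph_on_iff by blast
    moreover have "Domain (inv_cayley (T_ext \<gamma>)) = Range (Id +\<^sub>o graph_on UNIV (T_ext \<gamma>))"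
      unfolding Id_graph_on graph_on_add Range_graph_on inv_cayley_def by blast
    ultimately show ?thesis
      unfolding c(2) St[OF c(1)] T_tilde_graph_on[OF c(1)] by (simp add: Domain_graph_on single_valued_graph_on)
  qed
  have 2: "bij_betw (S_tilde S) (sa_contractions (cayley S)) (pos_sa_extensions S)"
    unfolding bij_betw_def
  proof
    show "inj_on (S_tilde S) (sa_contractions (cayley S))"
    proof (rule inj_onI)
      fix \<Gamma> \<Delta> assume "\<Gamma> \<in> sa_contractions (cayley S)" "\<Delta> \<in> sa_contractions (cayley S)"
        and e: "S_tilde S \<Gamma> = S_tilde S \<Delta>"
      then obtain \<gamma> \<delta> where c: "param \<gamma>" "param \<delta>" "\<Gamma> = graph_on DG \<gamma>" "\<Delta> = graph_on DG \<delta>" unfolding sa by blast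
      have "T_ext \<gamma> = T_ext \<delta>"
        using inv_cayley_inject[OF adjoint_pair_clinear[OF hermitian_T_ext[OF c(1)]] adjoint_pair_clinear[OF hermitian_T_ext[OF c(2)]]] e
        unfolding c(3,4) St[OF c(1)] St[OF c(2)] by blast
      then show "\<Gamma> = \<Delta>" unfolding c(3,4) by (rule T_ext_inj[OF c(1,2)])
    qed
    show "S_tilde S ` sa_contractions (cayley S) = pos_sa_extensions S"
    proof
      show "S_tilde S ` sa_contractions (cayley S) \<subseteq> pos_sa_extensions S"
        unfolding sa using St ext by auto
      show "pos_sa_extensions S \<subseteq> S_tilde S ` sa_contractions (cayley S)"
      proof
        fix R assume "R \<in> pos_sa_extensions S"
        then obtain \<gamma> where c: "param \<gamma>" "R = inv_cayley (T_ext \<gamma>)" using surj by blast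
        then have "R = S_tilde S (graph_on DG \<gamma>)" by (simp add: St)
        then show "R \<in> S_tilde S ` sa_contractions (cayley S)" unfolding sa using c(1) by blast
      qed
    qed
  qed
  have 3: "strong_resolvent_conv (\<lambda>n. S_tilde S (\<Gamma>s n)) (S_tilde S \<Gamma>)"
    if G: "\<forall>n::nat. \<Gamma>s n \<in> sa_contractions (cayley S)" "\<Gamma> \<in> sa_contractions (cayley S)"
      and lim: "(\<lambda>n. op_norm (\<Gamma>s n -\<^sub>o \<Gamma>)) \<longlonglongrightarrow> 0" for \<Gamma>s \<Gamma>
  proof -
    obtain \<gamma> where c: "param \<gamma>" "\<Gamma> = graph_on DG \<gamma>" using G(2) unfolding sa by blast
    have "\<forall>n. \<exists>\<gamma>. param \<gamma> \<and> \<Gamma>s n = graph_on DG \<gamma>" using G(1) unfolding sa by blast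
    then obtain \<gamma>s where cs: "\<And>n. param (\<gamma>s n)" "\<And>n. \<Gamma>s n = graph_on DG (\<gamma>s n)" by metis
    show ?thesis
      unfolding c(2) cs(2) St[OF c(1)] St[OF cs(1)]
      by (rule strong_resolvent_conv_inv_cayley[OF co[OF cs(1)] co[OF c(1)] T_ext_tendsto[OF cs(1) c(1)]])
        (use lim in \<open>simp only: c(2) cs(2)\<close>)
  qed
  have 4: "sa_le \<Gamma>' \<Gamma>'' \<longleftrightarrow> form_le (S_tilde S \<Gamma>'') (S_tilde S \<Gamma>')"
    if G: "\<Gamma>' \<in> sa_contractions (cayley S)" "\<Gamma>'' \<in> sa_contractions (cayley S)" for \<Gamma>' \<Gamma>''
  proof -
    obtain \<gamma> \<delta> where c: "param \<gamma>" "param \<delta>" "\<Gamma>' = graph_on DG \<gamma>" "\<Gamma>'' = graph_on DG \<delta>" using G unfolding sa by blast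
    show ?thesis unfolding c(3,4) St[OF c(1)] St[OF c(2)] by (rule le[OF c(1,2), symmetric])
  qed
  have 5: "form_le (S_K S) (S_F S)"
    unfolding K F le[OF param_proj(2,1)] by (rule sa_le_extremal(2)[OF param_proj(1)])
  have 6: "R \<in> pos_sa_extensions S \<longleftrightarrow> form_le (S_K S) R \<and> form_le R (S_F S)"
    if R: "positive_selfadjoint UNIV R" for R
  proof
    assume "R \<in> pos_sa_extensions S"
    then obtain \<gamma> where c: "param \<gamma>" "R = inv_cayley (T_ext \<gamma>)" using surj by blast
    show "form_le (S_K S) R \<and> form_le R (S_F S)"
      unfolding K F c(2) le[OF c(1) param_proj(1)] le[OF param_proj(2) c(1)]
      using sa_le_extremal[OF c(1)] by blast
  next
    assume A: "form_le (S_K S) R \<and> form_le R (S_F S)"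
    obtain B where B: "is_cayley_transform B" "R = inv_cayley B" using pos_sa_inv_cayley[OF R] by blast
    note hB = is_cayley_transformD(1)[OF B(1)] and hF = hermitian_T_ext[OF param_proj(2)]
    have b: "Re (cinner (B x) x) \<le> Re (cinner (T_ext ?K x) x)" "Re (cinner (T_ext ?F x) x) \<le> Re (cinner (B x) x)" for x
      using A unfolding K F B(2) form_le_inv_cayley[OF co[OF param_proj(1)] B(1)] form_le_inv_cayley[OF B(1) co[OF param_proj(2)]]
      by auto
    have "B x = t x" if "x \<in> D" for x
    proof -
      have "hermitian (\<lambda>x. B x - T_ext ?F x)" unfolding adjoint_pair_def
        by (simp add: cinner_simps adjoint_pairD[OF hB] adjoint_pairD[OF hF])
      moreover have "0 \<le> Re (cinner (B y - T_ext ?F y) y)" for y using b(2)[of y] by (simp add: cinner_simps)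
      \<comment> \<open>Both extremal extensions equal \<open>t\<close> at \<open>x\<close>, so the
        form is squeezed to zero there, and a positive operator annihilates a vector on which its
        form vanishes.\<close>
      moreover have "Re (cinner (B x - T_ext ?F x) x) = 0"
        using b[of x] T_ext_extends[OF param_proj(1) that] T_ext_extends[OF param_proj(2) that]
        by (simp add: cinner_simps)
      ultimately have "B x - T_ext ?F x = 0" by (rule pos_hermitian_zero)
      then show ?thesis using T_ext_extends[OF param_proj(2) that] by simp
    qed
    then have "S \<subseteq> inv_cayley B" using inv_cayley_extends_iff[OF sv adjoint_pair_clinear[OF hB] t(4)] by blast
    then show "R \<in> pos_sa_extensions S" using R B(2) by (simp add: pos_sa_extensions_def)
  qed
  show ?thesis
  proof (intro conjI ballI allI impI)
    show "S_K S \<in> pos_sa_extensions S" "S_F S \<in> pos_sa_extensions S" unfolding K F by (intro ext param_proj)+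
    show "form_le (S_K S) (S_F S)" by (rule 5)
    show "bij_betw (S_tilde S) (sa_contractions (cayley S)) (pos_sa_extensions S)" by (rule 2)
  qed (use 1 3 4 6 in blast)+
qed

end
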